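(* Let $\Omega$ be open in $\mathbb{R}^n$ (respectively in $\mathbb{C}^n$) and let $E\subseteq\Omega$ be a Borel set. If $u\in C^{1,p}(\Omega)$, $p\in(0,1]$, is subharmonic (respectively plurisubharmonic) in some open neighborhood of $\Omega\setminus E$ and the Hausdorff measure $\mathcal{H}^p(u(E))=0$, then $u$ is actually subharmonic (respectively plurisubharmonic) in $\Omega$. If $u\in C^1(\Omega)$, then the same conclusion holds if $u(E)$ is at most countable. The results are optimal with respect to the size of the image of $E$.
   Context: Here $n$ is a positive integer and functions $u$ are real valued. $\mathcal{H}^p$ denotes the $p$-dimensional Hausdorff measure on $\mathbb{R}$. $C^{1,p}(\Omega)$ denotes the class of $C^1$ functions on $\Omega$ whose first order partial derivatives are (locally) Hölder continuous with exponent $p$ (Lipschitz if $p=1$). The "respectively" alternatives are read consistently: $\mathbb{R}^n$ goes with subharmonic, $\mathbb{C}^n$ with plurisubharmonic; differentiability on $\mathbb{C}^n$ is real differentiability on $\mathbb{C}^n\cong\mathbb{R}^{2n}$. In the second assertion, as in the first, $u$ is assumed subharmonic (respectively plurisubharmonic) in some open neighborhood of $\Omega\setminus E$. *)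

theory Defs
  imports "HOL-Analysis.Analysis"
begin

text \<open>
  Functions are total in HOL; every notion below only looks at the values of the function on
  the given open set.
\<close>

definition upper_semicontinuous_on :: "'a::topological_space set \<Rightarrow> ('a \<Rightarrow> real) \<Rightarrow> bool" where
  "upper_semicontinuous_on U u \<longleftrightarrow>
     (\<forall>x\<in>U. \<forall>c. u x < c \<longrightarrow> (\<forall>\<^sub>F y in at x within U. u y < c))"

text \<open>
  Subharmonicity of a real valued function: upper semicontinuity and the sub-mean value
  inequality over all closed balls contained in the open set. The integral of an upper
  semicontinuous function over a closed ball always exists in $[-\infty,\infty)$, and the
  sub-mean value inequality at a point where the function is finite forces it to be finite.
  Integrability has to be spelled out because the Bochner integral of a non-integrable
  function is 0.
\<close>

definition subharmonic_on :: "'a::euclidean_space set \<Rightarrow> ('a \<Rightarrow> real) \<Rightarrow> bool" where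
  "subharmonic_on U u \<longleftrightarrow>
     upper_semicontinuous_on U u \<and>
     (\<forall>x r. 0 < r \<longrightarrow> cball x r \<subseteq> U \<longrightarrow>
        set_integrable lborel (cball x r) u \<and>
        u x \<le> (LINT y:cball x r|lborel. u y) / measure lborel (cball x r))"

text \<open>
  Plurisubharmonicity: upper semicontinuity, and the restriction to every complex line is
  subharmonic as a function on an open subset of the plane. The alternative that a restriction
  is identically $-\infty$ cannot occur for real valued functions.
\<close>

definition plurisubharmonic_on :: "(complex ^ 'n) set \<Rightarrow> (complex ^ 'n \<Rightarrow> real) \<Rightarrow> bool" where
  "plurisubharmonic_on U u \<longleftrightarrow>
     upper_semicontinuous_on U u \<and>
     (\<forall>a b. subharmonic_on {\<zeta>. a + \<zeta> *s b \<in> U} (\<lambda>\<zeta>. u (a + \<zeta> *s b)))"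

text \<open>
  For a basis vector \<open>b\<close>, \<open>frechet_derivative u (at x) b\<close> is the partial derivative of \<open>u\<close>
  at \<open>x\<close> in direction \<open>b\<close>. On \<open>complex ^ 'n\<close> the canonical basis consists of the real and
  imaginary coordinate directions, so that these are the \<open>2n\<close> real partial derivatives.
\<close>

definition C1_on :: "'a::euclidean_space set \<Rightarrow> ('a \<Rightarrow> real) \<Rightarrow> bool" where
  "C1_on \<Omega> u \<longleftrightarrow>
     (\<forall>x\<in>\<Omega>. u differentiable (at x)) \<and>
     (\<forall>b\<in>Basis. continuous_on \<Omega> (\<lambda>x. frechet_derivative u (at x) b))"

definition locally_Hoelder_on :: "real \<Rightarrow> 'a::metric_space set \<Rightarrow> ('a \<Rightarrow> real) \<Rightarrow> bool" where
  "locally_Hoelder_on p \<Omega> g \<longleftrightarrow>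
     (\<forall>x\<in>\<Omega>. \<exists>r>0. \<exists>C. \<forall>y \<in> ball x r \<inter> \<Omega>. \<forall>z \<in> ball x r \<inter> \<Omega>.
        \<bar>g y - g z\<bar> \<le> C * dist y z powr p)"

definition C1p_on :: "real \<Rightarrow> 'a::euclidean_space set \<Rightarrow> ('a \<Rightarrow> real) \<Rightarrow> bool" where
  "C1p_on p \<Omega> u \<longleftrightarrow>
     C1_on \<Omega> u \<and>
     (\<forall>b\<in>Basis. locally_Hoelder_on p \<Omega> (\<lambda>x. frechet_derivative u (at x) b))"

text \<open>
  Hausdorff (outer) measure of dimension \<open>p\<close>, used for \<open>p > 0\<close> only (for \<open>p = 0\<close> the value
  \<open>0 powr 0 = 0\<close> would be wrong), without a normalising constant. The covering sets are
  required to be bounded since \<open>diameter\<close> is meaningless on unbounded sets. Finite covers are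
  included because the empty set has diameter 0.
\<close>

definition hausdorff_premeasure :: "real \<Rightarrow> real \<Rightarrow> 'a::metric_space set \<Rightarrow> ennreal" where
  "hausdorff_premeasure p \<delta> A =
     (INF C \<in> {C :: nat \<Rightarrow> 'a set.
                 A \<subseteq> (\<Union>i. C i) \<and> (\<forall>i. bounded (C i) \<and> diameter (C i) \<le> \<delta>)}.
        \<Sum>i. ennreal (diameter (C i) powr p))"

definition hausdorff_measure :: "real \<Rightarrow> 'a::metric_space set \<Rightarrow> ennreal" where
  "hausdorff_measure p A = (SUP \<delta> \<in> {0<..}. hausdorff_premeasure p \<delta> A)"

end

theory Submission
  imports Defs
begin

text \<open>
  Subharmonicity of a continuous function is tested by touching: if no polynomial with negative
  Laplacian touches \<open>u\<close> from above, comparison with the harmonic polynomial that extends a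
  polynomial approximation of \<open>u\<close> from a sphere gives the sub-mean value inequality. Points near
  which \<open>u\<close> is subharmonic are never touched, so every contact value lies in \<open>u(E)\<close>.

  Suppose that \<open>\<phi>\<close> touches \<open>u\<close> strictly at a point where \<open>\<nabla>u \<noteq> 0\<close>, and let \<open>x\<^sub>t\<close> maximise
  \<open>u - (1 + t) \<phi>\<close> nearby. For \<open>t < t'\<close> the point \<open>x\<^sub>t\<close> is maximal for \<open>u - (1 + t') \<phi>\<close> up to
  an error \<open>(t' - t) (u(x\<^sub>t) - u(x\<^sub>t'))\<close>, while the gradient of that function at \<open>x\<^sub>t\<close> has size
  comparable to \<open>t' - t\<close>. Hence \<open>t \<mapsto> u(x\<^sub>t)\<close> is injective, and \<open>|t' - t| \<le> C |u(x\<^sub>t) - u(x\<^sub>t')|\<^sup>p\<close>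
  if \<open>\<nabla>u\<close> is Hoelder continuous. So \<open>u(E)\<close> can be neither countable nor \<open>\<H>\<^sup>p\<close>-null, respectively.
  If \<open>\<nabla>u\<close> vanishes at all contact points, tilting \<open>\<phi>\<close> gives a contradiction. The
  plurisubharmonic case follows by restriction to complex lines.

  For sharpness, let \<open>F\<close> be a nonconstant continuous increasing function that is locally constant
  off a closed subset of the given set: the Hausdorff content of initial segments, or a devil's
  staircase. The inverse of an antiderivative of \<open>1 + F\<close>, applied to one real coordinate, is
  concave and not affine, but locally affine off the closed set where \<open>F\<close> grows.
\<close>

section \<open>Polynomials and their Laplacian\<close>

text \<open>Surface integrals and the Poisson kernel are avoided: polynomial boundary values on the
  unit sphere have a polynomial harmonic extension \<open>h\<close>, and \<open>h 0\<close> stands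
  for the spherical mean. The integral identities behind this are divergence theorems for polynomial
  fields that vanish on the sphere.

  Scaling a test function separates these values only through its gradient, which is useless at a
  critical point. Critical contacts therefore get a separate argument, where a tilt moves the
  contact point and only its location matters.

  The exponent \<open>p\<close> comes from a balance. A step of length l in an ascent direction
  gains about |t' - t| l, and Hoelder continuity of the gradient allows a loss of order l^(1+p). The
  best l has l^p comparable to |t' - t|, and the contact values then differ by at least a multiple
  of l.\<close>

definition pd :: "'a::euclidean_space \<Rightarrow> ('a \<Rightarrow> real) \<Rightarrow> 'a \<Rightarrow> real" where
  "pd e f x = frechet_derivative f (at x) e"

definition lap :: "('a::euclidean_space \<Rightarrow> real) \<Rightarrow> 'a \<Rightarrow> real" where
  "lap f x = (\<Sum>e\<in>Basis. pd e (pd e f) x)"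

lemma pd_eqI: "(f has_derivative f') (at x) \<Longrightarrow> pd e f x = f' e"
  unfolding pd_def by (metis frechet_derivative_at)

lemma poly_differentiable:
  "real_polynomial_function (f :: 'a::euclidean_space \<Rightarrow> real) \<Longrightarrow> f differentiable (at x)"
  by (rule differentiable_at_real_polynomial_function)

lemma poly_has_derivative:
  assumes "real_polynomial_function (f :: 'a::euclidean_space \<Rightarrow> real)"
  shows "(f has_derivative (\<lambda>h. pd h f x)) (at x)"
  using poly_differentiable[OF assms, of x] unfolding pd_def
  by (simp add: frechet_derivative_works eta_contract_eq)

text \<open>Linearity in the direction, which may itself depend on the point: with \<open>v\<close>
  equal to \<open>x\<close> it exhibits the radial derivative \<open>pd x f x\<close> as a
  polynomial.\<close>

lemma pd_basis:
  assumes "real_polynomial_function (f :: 'a::euclidean_space \<Rightarrow> real)"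
  shows "pd v f x = (\<Sum>e\<in>Basis. (v \<bullet> e) * pd e f x)"
proof -
  interpret bounded_linear "\<lambda>h. pd h f x"
    using poly_has_derivative[OF assms] by (rule has_derivative_bounded_linear)
  have "pd v f x = pd (\<Sum>e\<in>Basis. (v \<bullet> e) *\<^sub>R e) f x" by (simp add: euclidean_representation)
  also have "\<dots> = (\<Sum>e\<in>Basis. (v \<bullet> e) * pd e f x)" by (simp add: sum scaleR)
  finally show ?thesis .
qed

lemma pd_const [simp]: "pd e (\<lambda>x. c) = (\<lambda>x. 0)"
  by (rule ext, rule pd_eqI[THEN trans]) auto

lemma pd_linear: "bounded_linear f \<Longrightarrow> pd e f = (\<lambda>x. f e)"
  by (rule ext, rule pd_eqI) (rule bounded_linear_imp_has_derivative)

lemma pd_add: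
  assumes "real_polynomial_function f" "real_polynomial_function (g :: 'a::euclidean_space \<Rightarrow> real)"
  shows "pd e (\<lambda>x. f x + g x) = (\<lambda>x. pd e f x + pd e g x)"
  by (rule ext, rule pd_eqI) (intro has_derivative_add poly_has_derivative assms)

lemma pd_diff:
  assumes "real_polynomial_function f" "real_polynomial_function (g :: 'a::euclidean_space \<Rightarrow> real)"
  shows "pd e (\<lambda>x. f x - g x) = (\<lambda>x. pd e f x - pd e g x)"
  by (rule ext, rule pd_eqI) (intro has_derivative_diff poly_has_derivative assms)

lemma pd_mult:
  assumes "real_polynomial_function f" "real_polynomial_function (g :: 'a::euclidean_space \<Rightarrow> real)"
  shows "pd e (\<lambda>x. f x * g x) = (\<lambda>x. f x * pd e g x + pd e f x * g x)"
  by (rule ext, rule pd_eqI) (intro has_derivative_mult poly_has_derivative assms)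

lemma pd_cmult:
  assumes "real_polynomial_function (f :: 'a::euclidean_space \<Rightarrow> real)"
  shows "pd e (\<lambda>x. c * f x) = (\<lambda>x. c * pd e f x)"
  by (subst pd_mult) (auto intro: assms real_polynomial_function.intros(2))

lemma pd_scale:
  assumes "real_polynomial_function (f :: 'a::euclidean_space \<Rightarrow> real)"
  shows "pd e (\<lambda>x. f (a + c *\<^sub>R x)) = (\<lambda>x. c * pd e f (a + c *\<^sub>R x))"
proof (rule ext, rule pd_eqI[THEN trans])
  fix x
  show "((\<lambda>x. f (a + c *\<^sub>R x)) has_derivative (\<lambda>h. pd (c *\<^sub>R h) f (a + c *\<^sub>R x))) (at x)"
    by (rule has_derivative_compose[OF _ poly_has_derivative[OF assms]]) (auto intro!: derivative_eq_intros)
  show "pd (c *\<^sub>R e) f (a + c *\<^sub>R x) = c * pd e f (a + c *\<^sub>R x)"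
    by (subst (1 2) pd_basis[OF assms]) (simp add: sum_distrib_left mult.assoc)
qed

lemma poly_pd [intro]:
  assumes "real_polynomial_function (f :: 'a::euclidean_space \<Rightarrow> real)"
  shows "real_polynomial_function (pd e f)"
  using assms
  by induction (auto simp: pd_linear pd_add pd_mult intro: real_polynomial_function.intros)

lemma poly_scale:
  assumes "real_polynomial_function (f :: 'a::euclidean_space \<Rightarrow> real)"
  shows "real_polynomial_function (\<lambda>x. f (a + c *\<^sub>R x))"
proof -
  have "polynomial_function (\<lambda>x::'a. a + c *\<^sub>R x)"
    by (intro polynomial_function_add polynomial_function_const polynomial_function_cmul polynomial_function_id)
  from real_polynomial_function_compose[OF this assms] show ?thesis by (simp add: o_def)
qed

lemma poly_lap [intro]:
  "real_polynomial_function (f :: 'a::euclidean_space \<Rightarrow> real) \<Longrightarrow> real_polynomial_function (lap f)"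
  unfolding lap_def[abs_def] by (intro real_polynomial_function_sum poly_pd) auto

lemma poly_inner [intro]: "real_polynomial_function (\<lambda>x. x \<bullet> (a :: 'a::euclidean_space))"
  by (intro real_polynomial_function.intros(1) bounded_linear_inner_left)

lemma poly_inner' [intro]: "real_polynomial_function (\<lambda>x. (a :: 'a::euclidean_space) \<bullet> x)"
  by (intro real_polynomial_function.intros(1) bounded_linear_inner_right)

lemma poly_sqnorm [intro]: "real_polynomial_function (\<lambda>x :: 'a::euclidean_space. x \<bullet> x)"
  by (subst euclidean_inner)
    (intro real_polynomial_function_sum finite_Basis real_polynomial_function.intros(4) poly_inner)

lemmas poly_intros = real_polynomial_function.intros(3) real_polynomial_function.intros(4)
  real_polynomial_function.intros(2) real_polynomial_function_diff poly_inner poly_inner' poly_sqnorm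
  poly_pd poly_lap poly_scale

lemma pd_inner [simp]: "pd e (\<lambda>x. x \<bullet> (a :: 'a::euclidean_space)) = (\<lambda>x. e \<bullet> a)"
  by (rule pd_linear) (rule bounded_linear_inner_left)

lemma pd_inner' [simp]: "pd e (\<lambda>x. (a :: 'a::euclidean_space) \<bullet> x) = (\<lambda>x. a \<bullet> e)"
  by (rule pd_linear) (rule bounded_linear_inner_right)

lemma pd_sqnorm [simp]: "pd e (\<lambda>x::'a::euclidean_space. x \<bullet> x) = (\<lambda>x. 2 * (x \<bullet> e))"
  by (rule ext, rule pd_eqI[THEN trans]) (auto intro!: derivative_eq_intros simp: inner_commute)

lemma lap_const [simp]: "lap (\<lambda>x::'a::euclidean_space. c) = (\<lambda>x. 0)"
  by (simp add: lap_def[abs_def])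

lemma lap_inner' [simp]: "lap (\<lambda>x::'a::euclidean_space. a \<bullet> x) = (\<lambda>x. 0)"
  by (simp add: lap_def[abs_def])

lemma lap_add:
  assumes "real_polynomial_function f" "real_polynomial_function (g :: 'a::euclidean_space \<Rightarrow> real)"
  shows "lap (\<lambda>x. f x + g x) = (\<lambda>x. lap f x + lap g x)"
  by (simp add: lap_def[abs_def] pd_add assms poly_pd sum.distrib)

lemma lap_diff:
  assumes "real_polynomial_function f" "real_polynomial_function (g :: 'a::euclidean_space \<Rightarrow> real)"
  shows "lap (\<lambda>x. f x - g x) = (\<lambda>x. lap f x - lap g x)"
  by (simp add: lap_def[abs_def] pd_diff assms poly_pd sum_subtractf)

lemma lap_mult:
  assumes "real_polynomial_function f" "real_polynomial_function (g :: 'a::euclidean_space \<Rightarrow> real)"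
  shows "lap (\<lambda>x. f x * g x) =
    (\<lambda>x. f x * lap g x + 2 * (\<Sum>e\<in>Basis. pd e f x * pd e g x) + lap f x * g x)"
  by (rule ext) (simp add: lap_def[abs_def] pd_mult pd_add assms poly_pd poly_intros sum.distrib
      sum_distrib_left sum_distrib_right algebra_simps)

lemma lap_cmult:
  assumes "real_polynomial_function (f :: 'a::euclidean_space \<Rightarrow> real)"
  shows "lap (\<lambda>x. c * f x) = (\<lambda>x. c * lap f x)"
  by (simp add: lap_def[abs_def] pd_cmult assms poly_pd sum_distrib_left)

lemma lap_scale:
  assumes "real_polynomial_function (f :: 'a::euclidean_space \<Rightarrow> real)"
  shows "lap (\<lambda>x. f (a + c *\<^sub>R x)) = (\<lambda>x. c\<^sup>2 * lap f (a + c *\<^sub>R x))"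
  by (simp add: lap_def[abs_def] pd_scale pd_cmult poly_scale assms poly_pd sum_distrib_left power2_eq_square
      mult.assoc)

lemma lap_sqnorm [simp]: "lap (\<lambda>x::'a::euclidean_space. x \<bullet> x) = (\<lambda>x. 2 * real DIM('a))"
  by (rule ext) (simp add: lap_def pd_cmult poly_inner)

section \<open>Homogeneous polynomials and the Dirichlet problem in the unit ball\<close>

text \<open>Homogeneity is given by generators, so that Euler's identity and the degree of a
  derivative follow by induction. The degree is a label and not a function of the polynomial: zero
  carries every degree.\<close>

inductive hom_poly :: "nat \<Rightarrow> ('a::euclidean_space \<Rightarrow> real) \<Rightarrow> bool" where
  const: "hom_poly 0 (\<lambda>x. c)"
| coord: "e \<in> Basis \<Longrightarrow> hom_poly 1 (\<lambda>x. x \<bullet> e)"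
| add: "hom_poly k f \<Longrightarrow> hom_poly k g \<Longrightarrow> hom_poly k (\<lambda>x. f x + g x)"
| mult: "hom_poly j f \<Longrightarrow> hom_poly k g \<Longrightarrow> hom_poly (j + k) (\<lambda>x. f x * g x)"

lemma hom_poly_poly: "hom_poly k f \<Longrightarrow> real_polynomial_function f"
  by (induction rule: hom_poly.induct) (auto intro: poly_intros)

lemma hom_poly_cmult: "hom_poly k f \<Longrightarrow> hom_poly k (\<lambda>x. c * f x)"
  using hom_poly.mult[OF hom_poly.const, of k f c] by simp

lemma hom_poly_zero: "hom_poly k (\<lambda>x::'a::euclidean_space. 0)"
proof (induction k)
  case (Suc k)
  obtain e :: 'a where "e \<in> Basis" using nonempty_Basis by blast
  from hom_poly.mult[OF hom_poly.coord[OF this] Suc] show ?case by simp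
qed (rule hom_poly.const)

lemma hom_poly_diff: "hom_poly k f \<Longrightarrow> hom_poly k g \<Longrightarrow> hom_poly k (\<lambda>x. f x - g x)"
  using hom_poly.add[of k f "\<lambda>x. -1 * g x"] hom_poly_cmult[of k g "-1"] by simp

lemma hom_poly_sum:
  "finite I \<Longrightarrow> (\<And>i. i \<in> I \<Longrightarrow> hom_poly k (f i)) \<Longrightarrow> hom_poly k (\<lambda>x. \<Sum>i\<in>I. f i x)"
  by (induction rule: finite_induct) (auto intro: hom_poly_zero hom_poly.add)

lemma hom_poly_sqnorm: "hom_poly 2 (\<lambda>x::'a::euclidean_space. x \<bullet> x)"
proof -
  have "hom_poly (1 + 1) (\<lambda>x::'a. (x \<bullet> e) * (x \<bullet> e))" if "e \<in> Basis" for e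
    using that by (intro hom_poly.mult hom_poly.coord)
  then show ?thesis
    by (subst euclidean_inner) (intro hom_poly_sum, auto simp: numeral_2_eq_2)
qed

text \<open>Truncated subtraction makes the degree \<open>k - 1\<close> misleading at
  \<open>k = 0\<close>. The second conjunct repairs this: there the derivative is zero, which has
  every degree, and this carries the product rule through the induction.\<close>

lemma hom_poly_pd:
  "hom_poly k f \<Longrightarrow> hom_poly (k - 1) (pd e f) \<and> (k = 0 \<longrightarrow> pd e f = (\<lambda>x. 0))"
proof (induction rule: hom_poly.induct)
  case (mult j f k g)
  have "hom_poly (j + k - 1) (\<lambda>x. f x * pd e g x)"
  proof (cases "k = 0")
    case False
    then show ?thesis using hom_poly.mult[of j f "k - 1" "pd e g"] mult by simp
  qed (use mult hom_poly_zero in auto)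
  moreover have "hom_poly (j + k - 1) (\<lambda>x. pd e f x * g x)"
  proof (cases "j = 0")
    case False
    then show ?thesis using hom_poly.mult[of "j - 1" "pd e f" k g] mult by simp
  qed (use mult hom_poly_zero in auto)
  ultimately show ?case
    using mult by (auto simp: pd_mult hom_poly_poly intro: hom_poly.add)
qed (auto simp: pd_add hom_poly_poly intro: hom_poly.intros)

lemma hom_poly_lap: "hom_poly k f \<Longrightarrow> hom_poly (k - 2) (lap f)"
proof -
  assume "hom_poly k f"
  then have "hom_poly (k - 1 - 1) (pd e (pd e f))" for e
    using hom_poly_pd by blast
  then show ?thesis unfolding lap_def[abs_def] by (intro hom_poly_sum) (auto simp: numeral_2_eq_2)
qed

lemma lap_hom_poly_eq_0: "hom_poly k f \<Longrightarrow> k < 2 \<Longrightarrow> lap f = (\<lambda>x. 0)"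
proof -
  assume a: "hom_poly k f" "k < 2"
  then have "hom_poly 0 (pd e f)" for e
    using hom_poly_pd[OF a(1), of e] by (cases k) auto
  then have "pd e (pd e f) = (\<lambda>x. 0)" for e using hom_poly_pd by blast
  then show ?thesis by (simp add: lap_def[abs_def])
qed

lemma euler_identity:
  "hom_poly k f \<Longrightarrow> (\<Sum>e\<in>Basis. (x \<bullet> e) * pd e f x) = real k * f x"
proof (induction rule: hom_poly.induct)
  case (coord b)
  then show ?case by (simp add: inner_Basis if_distrib cong: if_cong)
next
  case (add k f g)
  then show ?case by (simp add: pd_add hom_poly_poly distrib_left sum.distrib)
next
  case (mult j f k g)
  have "(\<Sum>e\<in>Basis. (x \<bullet> e) * pd e (\<lambda>x. f x * g x) x) =
    f x * (\<Sum>e\<in>Basis. (x \<bullet> e) * pd e g x) + g x * (\<Sum>e\<in>Basis. (x \<bullet> e) * pd e f x)"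
    using mult.hyps by (simp add: pd_mult hom_poly_poly sum_distrib_left algebra_simps sum.distrib)
  then show ?case by (simp only: mult.IH of_nat_add) (simp add: algebra_simps)
qed auto

text \<open>The gradient of |x|^2 is 2x, so the cross term of the product rule is four times the
  Euler operator, which gives 4k. The term 2n is the Laplacian of |x|^2.\<close>

lemma lap_sqnorm_mult:
  assumes "hom_poly k (r :: 'a::euclidean_space \<Rightarrow> real)"
  shows "lap (\<lambda>x. (x \<bullet> x) * r x) x = (x \<bullet> x) * lap r x + (4 * real k + 2 * real DIM('a)) * r x"
proof -
  have "lap (\<lambda>x. (x \<bullet> x) * r x) x = (x \<bullet> x) * lap r x +
      4 * (\<Sum>e\<in>Basis. (x \<bullet> e) * pd e r x) + 2 * real DIM('a) * r x"
    using assms by (simp add: lap_mult hom_poly_poly poly_intros sum_distrib_left mult.assoc)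
  then show ?thesis by (simp add: euler_identity[OF assms] algebra_simps)
qed

text \<open>
  The ansatz \<open>q = (g - |x|\<^sup>2 r) / c\<close> reduces degree \<open>k\<close> to degree \<open>k - 2\<close>, with a larger constant.
\<close>

lemma shifted_lap_solvable:
  assumes "hom_poly k (g :: 'a::euclidean_space \<Rightarrow> real)" "c > 0"
  shows "\<exists>q. hom_poly k q \<and> (\<forall>x. (x \<bullet> x) * lap q x + c * q x = g x)"
  using assms
proof (induction k arbitrary: g c rule: less_induct)
  case (less k)
  show ?case
  proof (cases "k < 2")
    case True
    then have "lap g = (\<lambda>x. 0)" using less.prems lap_hom_poly_eq_0 by blast
    then show ?thesis
      using less.prems True
      by (intro exI[of _ "\<lambda>x. inverse c * g x"])
        (auto simp: lap_cmult hom_poly_poly intro!: hom_poly_cmult)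
  next
    case False
    \<comment> \<open>For q = (g - |x|^2 r) / c, the requirement that \<open>lap q = r\<close> reads
      |x|^2 lap r + c' r = lap g with exactly this constant, by the formula for the Laplacian of
      |x|^2 r in degree k - 2.\<close>
    define c' where "c' = c + 4 * real (k - 2) + 2 * real DIM('a)"
    have "c' > 0" using less.prems(2) by (simp add: c'_def add_pos_nonneg)
    from less.IH[OF _ hom_poly_lap[OF less.prems(1)] this] False
    obtain r where r: "hom_poly (k - 2) r" "\<And>x. (x \<bullet> x) * lap r x + c' * r x = lap g x" by auto
    define s where "s = (\<lambda>x. (x \<bullet> x) * r x)"
    have "2 + (k - 2) = k" using False by simp
    then have s: "hom_poly k s" unfolding s_def
      using hom_poly.mult[OF hom_poly_sqnorm r(1)] by metis
    have ls: "lap s x = (x \<bullet> x) * lap r x + (c' - c) * r x" for x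
      unfolding s_def using lap_sqnorm_mult[OF r(1)] by (simp add: c'_def)
    define q where "q = (\<lambda>x. inverse c * (g x - s x))"
    have q: "hom_poly k q" unfolding q_def
      by (intro hom_poly_cmult hom_poly_diff s less.prems)
    have lq: "lap q x = r x" for x
    proof -
      have "lap q x = inverse c * (lap g x - lap s x)" unfolding q_def
        by (subst lap_cmult) (auto simp: lap_diff hom_poly_poly[OF s] hom_poly_poly[OF less.prems(1)] poly_intros)
      also have "lap g x - lap s x = c * r x" unfolding ls using r(2)[of x] by (simp add: algebra_simps)
      finally show ?thesis using less.prems(2) by simp
    qed
    have "c * q x = g x - s x" for x
      using less.prems(2) by (simp add: q_def mult.assoc[symmetric])
    then have "(x \<bullet> x) * lap q x + c * q x = g x" for x
      by (simp add: lq s_def)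
    with q show ?thesis by blast
  qed
qed

text \<open>In degree k the Laplacian of (1 - |x|^2) q is lap q - (|x|^2 lap q + (4k + 2n) q). The
  bracket can be made equal to \<open>g\<close>; the error \<open>lap q\<close> has degree k - 2 and
  is absorbed by induction. The signs explain the solution \<open>q' - q\<close>.\<close>

lemma ball_lap_solvable_hom:
  assumes "hom_poly k (g :: 'a::euclidean_space \<Rightarrow> real)"
  shows "\<exists>q. real_polynomial_function q \<and> lap (\<lambda>x. (1 - x \<bullet> x) * q x) = g"
  using assms
proof (induction k arbitrary: g rule: less_induct)
  case (less k)
  have "4 * real k + 2 * real DIM('a) > 0" by (simp add: add_nonneg_pos)
  from shifted_lap_solvable[OF less.prems this]
  obtain q where q: "hom_poly k q"
    "\<And>x. (x \<bullet> x) * lap q x + (4 * real k + 2 * real DIM('a)) * q x = g x" by blast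
  have pq: "real_polynomial_function q" using q(1) by (rule hom_poly_poly)
  have 1: "lap (\<lambda>x. (1 - x \<bullet> x) * q x) x = lap q x - g x" for x
  proof -
    have "lap (\<lambda>x. (1 - x \<bullet> x) * q x) x = lap (\<lambda>x. q x - (x \<bullet> x) * q x) x"
      by (simp add: algebra_simps)
    also have "\<dots> = lap q x - g x"
      using q(2)[of x] by (simp add: lap_diff pq poly_intros lap_sqnorm_mult[OF q(1)])
    finally show ?thesis .
  qed
  obtain q' where q': "real_polynomial_function q'" "lap (\<lambda>x. (1 - x \<bullet> x) * q' x) = lap q"
  proof (cases "k < 2")
    case True
    then have "lap q = (\<lambda>x. 0)" using q(1) lap_hom_poly_eq_0 by blast
    then show ?thesis by (intro that[of "\<lambda>x. 0"]) (auto intro: poly_intros)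
  next
    case False
    then show ?thesis using less.IH[OF _ hom_poly_lap[OF q(1)]] that by auto
  qed
  have "lap (\<lambda>x. (1 - x \<bullet> x) * (q' x - q x)) = g"
  proof
    fix x
    have "lap (\<lambda>x. (1 - x \<bullet> x) * (q' x - q x)) x =
      lap (\<lambda>x. (1 - x \<bullet> x) * q' x - (1 - x \<bullet> x) * q x) x" by (simp add: algebra_simps)
    also have "\<dots> = lap q x - (lap q x - g x)"
      by (subst lap_diff) (auto simp: q' 1 pq intro!: poly_intros)
    finally show "lap (\<lambda>x. (1 - x \<bullet> x) * (q' x - q x)) x = g x" by simp
  qed
  then show ?case using q'(1) pq
    by (intro exI[of _ "\<lambda>x. q' x - q x"]) (auto intro: poly_intros)
qed

text \<open>Finite sums of homogeneous polynomials of mixed degrees. Closure under products is what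
  identifies them with all polynomials and lets a linear problem be solved degree by degree.\<close>

inductive hom_sum :: "('a::euclidean_space \<Rightarrow> real) \<Rightarrow> bool" where
  hom: "hom_poly k f \<Longrightarrow> hom_sum f"
| add: "hom_sum f \<Longrightarrow> hom_sum g \<Longrightarrow> hom_sum (\<lambda>x. f x + g x)"

lemma hom_sum_mult_hom: "hom_sum f \<Longrightarrow> hom_poly k g \<Longrightarrow> hom_sum (\<lambda>x. f x * g x)"
  by (induction rule: hom_sum.induct) (auto simp: distrib_right intro: hom_sum.intros hom_poly.mult)

lemma hom_sum_mult: "hom_sum g \<Longrightarrow> hom_sum f \<Longrightarrow> hom_sum (\<lambda>x. f x * g x)"
  by (induction rule: hom_sum.induct) (auto simp: distrib_left intro: hom_sum.intros hom_sum_mult_hom)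

lemma poly_hom_sum:
  "real_polynomial_function (f :: 'a::euclidean_space \<Rightarrow> real) \<Longrightarrow> hom_sum f"
proof (induction rule: real_polynomial_function.induct)
  case (linear f)
  interpret bounded_linear f by fact
  have "f = (\<lambda>x. \<Sum>e\<in>Basis. f e * (x \<bullet> e))"
  proof
    fix x
    have "f x = f (\<Sum>e\<in>Basis. (x \<bullet> e) *\<^sub>R e)" by (simp add: euclidean_representation)
    then show "f x = (\<Sum>e\<in>Basis. f e * (x \<bullet> e))" by (simp add: sum scaleR mult.commute)
  qed
  moreover have "hom_poly 1 (\<lambda>x. \<Sum>e\<in>Basis. f e * (x \<bullet> e))"
    by (intro hom_poly_sum hom_poly_cmult hom_poly.coord) auto
  ultimately show ?case by (metis hom_sum.hom)
qed (auto intro: hom_sum.intros hom_poly.intros hom_sum_mult)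

lemma ball_lap_solvable:
  assumes "real_polynomial_function (g :: 'a::euclidean_space \<Rightarrow> real)"
  shows "\<exists>q. real_polynomial_function q \<and> lap (\<lambda>x. (1 - x \<bullet> x) * q x) = g"
  using poly_hom_sum[OF assms]
proof (induction rule: hom_sum.induct)
  case (add f g)
  then obtain q1 q2 where q:
    "real_polynomial_function q1" "lap (\<lambda>x. (1 - x \<bullet> x) * q1 x) = f"
    "real_polynomial_function q2" "lap (\<lambda>x. (1 - x \<bullet> x) * q2 x) = g" by blast
  then have "lap (\<lambda>x. (1 - x \<bullet> x) * q1 x + (1 - x \<bullet> x) * q2 x) = (\<lambda>x. f x + g x)"
    by (subst lap_add) (auto intro!: poly_intros)
  then have "lap (\<lambda>x. (1 - x \<bullet> x) * (q1 x + q2 x)) = (\<lambda>x. f x + g x)"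
    by (simp add: distrib_left)
  then show ?case using q by (intro exI[of _ "\<lambda>x. q1 x + q2 x"]) (auto intro: poly_intros)
qed (rule ball_lap_solvable_hom)

text \<open>Subtracting a multiple of 1 - |x|^2 leaves the boundary values alone, and the multiple
  can be chosen to have the Laplacian of \<open>P\<close>.\<close>

lemma harmonic_extension:
  assumes "real_polynomial_function (P :: 'a::euclidean_space \<Rightarrow> real)"
  obtains h where "real_polynomial_function h" "lap h = (\<lambda>x. 0)" "\<And>x. norm x = 1 \<Longrightarrow> h x = P x"
proof -
  obtain q where q: "real_polynomial_function q" "lap (\<lambda>x. (1 - x \<bullet> x) * q x) = lap P"
    using ball_lap_solvable[OF poly_lap[OF assms]] by blast
  show ?thesis
  proof (rule that[of "\<lambda>x. P x - (1 - x \<bullet> x) * q x"])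
    show "lap (\<lambda>x. P x - (1 - x \<bullet> x) * q x) = (\<lambda>x. 0)"
      by (subst lap_diff) (auto simp: q assms intro!: poly_intros)
    show "real_polynomial_function (\<lambda>x. P x - (1 - x \<bullet> x) * q x)"
      by (intro poly_intros assms q)
  qed (auto simp: dot_square_norm)
qed

section \<open>Integrals over balls\<close>

lemma poly_continuous_on:
  "real_polynomial_function (f :: 'a::euclidean_space \<Rightarrow> real) \<Longrightarrow> continuous_on S f"
  by (simp add: continuous_on_polymonial_function real_polynomial_function_eq)

lemma set_integrable_compact:
  fixes f :: "'a::euclidean_space \<Rightarrow> real"
  assumes "compact S" "continuous_on S f"
  shows "set_integrable lborel S f"
  using borel_integrable_compact[OF assms] by (simp add: set_integrable_def)

abbreviation ball_int :: "('a::euclidean_space \<Rightarrow> real) \<Rightarrow> real" where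
  "ball_int f \<equiv> (LINT y:cball 0 1|lborel. f y)"

abbreviation ball_vol :: "'a::euclidean_space itself \<Rightarrow> real" where
  "ball_vol TYPE('a) \<equiv> measure lborel (cball (0::'a) 1)"

lemma set_integrable_cball:
  fixes f :: "'a::euclidean_space \<Rightarrow> real"
  shows "continuous_on (cball a r) f \<Longrightarrow> set_integrable lborel (cball a r) f"
  by (rule set_integrable_compact) auto

lemma poly_set_integrable:
  "real_polynomial_function (f :: 'a::euclidean_space \<Rightarrow> real) \<Longrightarrow> set_integrable lborel (cball a r) f"
  by (intro set_integrable_cball poly_continuous_on)

lemma ball_int_const: "ball_int (\<lambda>x::'a::euclidean_space. c) = c * measure lborel (cball (0::'a) 1)"
  using emeasure_compact_finite[of "cball (0::'a) 1"] by (subst set_integral_const) auto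

lemma pd_scaleR:
  assumes "real_polynomial_function (f :: 'a::euclidean_space \<Rightarrow> real)"
  shows "pd (t *\<^sub>R v) f x = t * pd v f x"
  by (subst (1 2) pd_basis[OF assms]) (simp add: sum_distrib_left mult.assoc)

lemma poly_lipschitz_cball:
  fixes g :: "'a::euclidean_space \<Rightarrow> real"
  assumes g: "real_polynomial_function g"
  obtains L where "L \<ge> 0" "\<And>x y. x \<in> cball a r \<Longrightarrow> y \<in> cball a r \<Longrightarrow> \<bar>g x - g y\<bar> \<le> L * norm (x - y)"
proof -
  have cont: "continuous_on (cball a r) (\<lambda>x. \<Sum>e\<in>Basis. \<bar>pd e g x\<bar>)"
    by (intro continuous_intros poly_continuous_on poly_pd g)
  then have "compact ((\<lambda>x. \<Sum>e\<in>Basis. \<bar>pd e g x\<bar>) ` cball a r)"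
    by (rule compact_continuous_image) simp
  then have "bounded ((\<lambda>x. \<Sum>e\<in>Basis. \<bar>pd e g x\<bar>) ` cball a r)"
    by (rule compact_imp_bounded)
  then obtain L where L0: "\<And>x. x \<in> cball a r \<Longrightarrow> \<bar>\<Sum>e\<in>Basis. \<bar>pd e g x\<bar>\<bar> \<le> L"
    unfolding bounded_iff real_norm_def by blast
  have lip: "norm (g x - g y) \<le> L * norm (x - y)" if xy: "x \<in> cball a r" "y \<in> cball a r" for x y
  proof (rule differentiable_bound[of "cball a r" g "\<lambda>x h. pd h g x"])
    fix x :: 'a assume x: "x \<in> cball a r"
    show "(g has_derivative (\<lambda>h. pd h g x)) (at x within cball a r)"
      using poly_has_derivative[OF g] has_derivative_at_withinI by blast
    show "onorm (\<lambda>h. pd h g x) \<le> L"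
    proof (rule onorm_le)
      fix h
      have "\<bar>pd h g x\<bar> \<le> (\<Sum>e\<in>Basis. \<bar>h \<bullet> e\<bar> * \<bar>pd e g x\<bar>)"
        unfolding pd_basis[OF g, of h] by (rule order_trans[OF sum_abs]) (simp add: abs_mult)
      also have "\<dots> \<le> (\<Sum>e\<in>Basis. norm h * \<bar>pd e g x\<bar>)"
        by (intro sum_mono mult_right_mono Basis_le_norm) auto
      also have "\<dots> = norm h * (\<Sum>e\<in>Basis. \<bar>pd e g x\<bar>)" by (simp add: sum_distrib_left)
      also have "\<dots> \<le> norm h * L"
        using L0[OF x] by (intro mult_left_mono) auto
      also have "\<dots> = L * norm h" by simp
      finally show "norm (pd h g x) \<le> L * norm h" by simp
    qed
  qed (use xy in auto)
  have "\<bar>g x - g y\<bar> \<le> max L 0 * norm (x - y)" if "x \<in> cball a r" "y \<in> cball a r" for x y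
    using lip[OF that] mult_right_mono[of L "max L 0" "norm (x - y)"] by (auto simp: max_def split: if_splits)
  then show ?thesis using that[of "max L 0"] by simp
qed

text \<open>A divergence theorem without boundary term. Extended by zero, \<open>g\<close> becomes a
  globally Lipschitz function \<open>G\<close>. Its difference quotients have integral zero by
  translation invariance, and dominated convergence passes this on to the derivative.\<close>

lemma ball_int_pd_eq_0:
  fixes g :: "'a::euclidean_space \<Rightarrow> real"
  assumes g: "real_polynomial_function g" and g0: "\<And>x. norm x = 1 \<Longrightarrow> g x = 0" and e: "e \<in> Basis"
  shows "ball_int (pd e g) = 0"
proof -
  define G where "G x = indicator (cball 0 1) x *\<^sub>R g x" for x
  \<comment> \<open>The shifts used below have length at most 1, so every difference quotient of
    \<open>G\<close> vanishes outside this ball; a multiple of its indicator is the dominating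
    function.\<close>
  define C where "C = cball (0::'a) 2"
  obtain L where L: "L \<ge> 0" "\<And>x y. x \<in> cball 0 1 \<Longrightarrow> y \<in> cball 0 1 \<Longrightarrow> \<bar>g x - g y\<bar> \<le> L * norm (x - y)"
    using poly_lipschitz_cball[OF g] by blast
  have key: "\<bar>G x\<bar> \<le> L * norm (x - y)" if x: "x \<in> cball 0 1" and y: "y \<notin> cball 0 1" for x y
  proof -
    \<comment> \<open>A segment that leaves the ball crosses the sphere, where \<open>g\<close> is
      zero. Replacing \<open>y\<close> by the crossing point only shortens the distance, so the
      Lipschitz bound inside the ball suffices.\<close>
    obtain z where z: "norm z = 1" "z \<in> closed_segment x y"
    proof -
      have "connected (closed_segment x y)" by simp
      moreover have "x \<in> cball 0 1 \<inter> closed_segment x y" "y \<in> closed_segment x y - cball 0 1"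
        using x y by auto
      ultimately have "closed_segment x y \<inter> frontier (cball 0 1) \<noteq> {}"
        by (intro connected_Int_frontier) auto
      then show ?thesis using that by auto
    qed
    have "\<bar>G x\<bar> = \<bar>g x - g z\<bar>" using x g0[OF z(1)] by (simp add: G_def)
    also have "\<dots> \<le> L * norm (x - z)" using x z by (intro L) auto
    also have "norm (x - z) \<le> norm (x - y)"
      using segment_bound[OF z(2)] by (simp add: norm_minus_commute)
    finally show ?thesis using L(1) by (simp add: mult_left_mono)
  qed
  have GL: "\<bar>G x - G y\<bar> \<le> L * norm (x - y)" for x y
  proof -
    consider "x \<in> cball 0 1" "y \<in> cball 0 1" | "x \<in> cball 0 1" "y \<notin> cball 0 1"
      | "x \<notin> cball 0 1" "y \<in> cball 0 1" | "x \<notin> cball 0 1" "y \<notin> cball 0 1" by blast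
    then show ?thesis
    proof cases
      case 1 then show ?thesis using L(2) by (simp add: G_def)
    next
      case 2
      then have "G y = 0" by (simp add: G_def)
      then show ?thesis using key[OF 2] by simp
    next
      case 3
      then have "G x = 0" by (simp add: G_def)
      then show ?thesis using key[OF 3(2,1)] by (simp add: norm_minus_commute)
    next
      case 4 then show ?thesis using L(1) by (simp add: G_def)
    qed
  qed
  have Gi: "integrable lborel G" unfolding G_def
    by (intro borel_integrable_compact poly_continuous_on g) simp
  have Gm [measurable]: "G \<in> borel_measurable borel" using Gi by (auto dest: borel_measurable_integrable)
  have shift: "integrable lborel (\<lambda>x. G (x + t *\<^sub>R e))"
    "(\<integral>x. G (x + t *\<^sub>R e) \<partial>lborel) = (\<integral>x. G x \<partial>lborel)" for t
  proof -
    have eq: "lborel = distr lborel borel (\<lambda>x. t *\<^sub>R e + x)" using lborel_distr_plus[of "t *\<^sub>R e"] by simp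
    have "integrable (distr lborel borel (\<lambda>x. t *\<^sub>R e + x)) G" using Gi eq by simp
    then show "integrable lborel (\<lambda>x. G (x + t *\<^sub>R e))"
      by (subst (asm) integrable_distr_eq) (auto simp: add.commute)
    have "(\<integral>x. G x \<partial>lborel) = (\<integral>x. G x \<partial>distr lborel borel (\<lambda>x. t *\<^sub>R e + x))" using eq by simp
    also have "\<dots> = (\<integral>x. G (x + t *\<^sub>R e) \<partial>lborel)"
      by (subst integral_distr) (auto simp: add.commute)
    finally show "(\<integral>x. G (x + t *\<^sub>R e) \<partial>lborel) = (\<integral>x. G x \<partial>lborel)" by simp
  qed
  define s where "s n x = real (Suc n) * (G (x + inverse (real (Suc n)) *\<^sub>R e) - G x)" for n x
  have s0: "(\<integral>x. s n x \<partial>lborel) = 0" for n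
    unfolding s_def using shift[of "inverse (real (Suc n))"] Gi by simp
  have "(\<lambda>n. \<integral>x. s n x \<partial>lborel) \<longlonglongrightarrow> (\<integral>x. indicator (cball 0 1) x *\<^sub>R pd e g x \<partial>lborel)"
  proof (rule integral_dominated_convergence[where w = "\<lambda>x. L * indicator C x"])
    show "(\<lambda>x. indicator (cball 0 1) x *\<^sub>R pd e g x) \<in> borel_measurable lborel"
      by (intro borel_measurable_integrable borel_integrable_compact poly_continuous_on poly_pd g) simp
    show "s n \<in> borel_measurable lborel" for n unfolding s_def[abs_def] by simp
    show "integrable lborel (\<lambda>x. L * indicator C x)"
      unfolding C_def using emeasure_compact_finite[of "cball (0::'a) 2"]
      by (intro integrable_mult_right) (auto simp: less_top[symmetric])
    show "AE x in lborel. norm (s n x) \<le> L * indicator C x" for n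
    proof (rule AE_I2)
      fix x
      show "norm (s n x) \<le> L * indicator C x"
      proof (cases "x \<in> C")
        case True
        have "norm (s n x) \<le> real (Suc n) * (L * norm (inverse (real (Suc n)) *\<^sub>R e))"
          using GL[of "x + inverse (real (Suc n)) *\<^sub>R e" x]
          unfolding s_def real_norm_def abs_mult by (intro mult_mono) auto
        also have "\<dots> = L" using e by (simp add: field_simps)
        finally show ?thesis using True by simp
      next
        case False
        then have n2: "norm x > 2" by (simp add: C_def)
        have "norm x \<le> norm (x + inverse (real (Suc n)) *\<^sub>R e) + norm (inverse (real (Suc n)) *\<^sub>R e)"
          using norm_triangle_ineq4[of "x + inverse (real (Suc n)) *\<^sub>R e" "inverse (real (Suc n)) *\<^sub>R e"] by simp
        moreover have "norm (inverse (real (Suc n)) *\<^sub>R e) \<le> 1" using e by (simp add: field_simps)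
        ultimately have "norm (x + inverse (real (Suc n)) *\<^sub>R e) > 1" using n2 by linarith
        then show ?thesis using n2 by (simp add: s_def G_def C_def)
      qed
    qed
    \<comment> \<open>The extension by zero may have a kink on the sphere, so pointwise convergence
      is claimed only off this null set.\<close>
    have "AE x in lborel. x \<notin> sphere (0::'a) 1"
      using negligible_sphere[of "0::'a" 1]
      by (intro AE_not_in) (auto simp: null_sets_completion_iff negligible_iff_null_sets)
    then show "AE x in lborel. (\<lambda>n. s n x) \<longlonglongrightarrow> indicator (cball 0 1) x *\<^sub>R pd e g x"
    proof eventually_elim
      case (elim x)
      have inv: "(\<lambda>n. x + inverse (real (Suc n)) *\<^sub>R e) \<longlonglongrightarrow> x"
        using tendsto_add[OF tendsto_const tendsto_scaleR[OF LIMSEQ_inverse_real_of_nat tendsto_const], of x e] by simp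
      show ?case
      proof (cases "norm x < 1")
        case True
        then have "eventually (\<lambda>n. x + inverse (real (Suc n)) *\<^sub>R e \<in> ball 0 1) sequentially"
          using inv by (intro topological_tendstoD) auto
        then have ev: "eventually (\<lambda>n. s n x = (g (x + inverse (real (Suc n)) *\<^sub>R e) - g x) / inverse (real (Suc n))) sequentially"
          by eventually_elim (use True in \<open>simp add: s_def G_def field_simps\<close>)
        have "((\<lambda>t. g (x + t *\<^sub>R e)) has_real_derivative pd e g x) (at 0)"
        proof -
          have "((\<lambda>t. g (x + t *\<^sub>R e)) has_derivative (\<lambda>t. pd (t *\<^sub>R e) g (x + 0 *\<^sub>R e))) (at 0)"
            by (rule has_derivative_compose[OF _ poly_has_derivative[OF g]]) (auto intro!: derivative_eq_intros)
          moreover have "pd (t *\<^sub>R e) g x = t * pd e g x" for t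
            by (rule pd_scaleR[OF g])
          ultimately show ?thesis by (simp add: has_field_derivative_def mult_commute_abs)
        qed
        then have "((\<lambda>t. (g (x + t *\<^sub>R e) - g x) / t) \<longlongrightarrow> pd e g x) (at 0)"
          by (simp add: has_field_derivative_iff)
        moreover have "filterlim (\<lambda>n. inverse (real (Suc n))) (at 0) sequentially"
          using LIMSEQ_inverse_real_of_nat by (simp add: filterlim_at)
        ultimately have "(\<lambda>n. (g (x + inverse (real (Suc n)) *\<^sub>R e) - g x) / inverse (real (Suc n))) \<longlonglongrightarrow> pd e g x"
          by (rule filterlim_compose)
        then have "(\<lambda>n. s n x) \<longlonglongrightarrow> pd e g x"
          using ev by (subst filterlim_cong[OF refl refl ev])
        then show ?thesis using True by simp
      next
        case False
        with elim have "x \<in> - cball 0 1" by simp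
        then have "eventually (\<lambda>n. x + inverse (real (Suc n)) *\<^sub>R e \<in> - cball 0 1) sequentially"
          using inv by (intro topological_tendstoD) auto
        then have "eventually (\<lambda>n. s n x = 0) sequentially"
          by eventually_elim (use \<open>x \<in> - cball 0 1\<close> in \<open>simp add: s_def G_def\<close>)
        then have "(\<lambda>n. s n x) \<longlonglongrightarrow> 0" by (rule tendsto_eventually)
        then show ?thesis using \<open>x \<in> - cball 0 1\<close> by simp
      qed
    qed
  qed
  then show ?thesis unfolding s0 set_lebesgue_integral_def using LIMSEQ_unique tendsto_const by metis
qed

lemma ball_int_sum:
  fixes f :: "'i \<Rightarrow> 'a::euclidean_space \<Rightarrow> real"
  assumes "finite I" "\<And>i. i \<in> I \<Longrightarrow> real_polynomial_function (f i)"
  shows "ball_int (\<lambda>x. \<Sum>i\<in>I. f i x) = (\<Sum>i\<in>I. ball_int (f i))"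
  using assms
proof (induction rule: finite_induct)
  case (insert i I)
  then have "set_integrable lborel (cball 0 1) (f i)" "set_integrable lborel (cball 0 1) (\<lambda>x. \<Sum>i\<in>I. f i x)"
    by (auto intro!: poly_set_integrable)
  then show ?case using insert by (simp add: set_integral_add)
qed (simp add: set_lebesgue_integral_def)

lemma ball_int_mult: "ball_int (\<lambda>x. c * f x) = c * ball_int f"
  by simp

text \<open>Divergence theorem for the field \<open>(1 - |x|\<^sup>2) \<nabla>g / 2\<close>, which vanishes on the sphere.\<close>

lemma ball_int_radial_derivative:
  fixes g :: "'a::euclidean_space \<Rightarrow> real"
  assumes g: "real_polynomial_function g"
  shows "ball_int (\<lambda>x. pd x g x) = ball_int (\<lambda>x. (1 - x \<bullet> x) / 2 * lap g x)"
proof -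
  define X where "X e x = (1 - x \<bullet> x) / 2 * pd e g x" for e x
  have X: "real_polynomial_function (X e)" for e unfolding X_def[abs_def]
    using g by (intro poly_intros real_polynomial_function_divide)
  have half: "real_polynomial_function (\<lambda>x::'a. (1 - x \<bullet> x) / 2)"
    by (intro poly_intros real_polynomial_function_divide)
  have pdhalf: "pd e (\<lambda>x::'a. (1 - x \<bullet> x) / 2) = (\<lambda>x. - (x \<bullet> e))" for e
    by (rule ext, rule pd_eqI[THEN trans]) (auto intro!: derivative_eq_intros simp: inner_commute)
  have "ball_int (pd e (X e)) = 0" if "e \<in> Basis" for e
    using that by (intro ball_int_pd_eq_0 X) (auto simp: X_def dot_square_norm)
  then have "0 = ball_int (\<lambda>x. \<Sum>e\<in>Basis. pd e (X e) x)"
    by (subst ball_int_sum) (auto intro: X)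
  also have "(\<lambda>x. \<Sum>e\<in>Basis. pd e (X e) x) = (\<lambda>x. (1 - x \<bullet> x) / 2 * lap g x - pd x g x)"
  proof
    fix x
    have "pd e (X e) x = (1 - x \<bullet> x) / 2 * pd e (pd e g) x - (x \<bullet> e) * pd e g x" for e
      unfolding X_def[abs_def] pd_mult[OF half poly_pd[OF g]] pdhalf by simp
    then show "(\<Sum>e\<in>Basis. pd e (X e) x) = (1 - x \<bullet> x) / 2 * lap g x - pd x g x"
      by (simp add: sum_subtractf lap_def sum_distrib_left pd_basis[OF g, of x])
  qed
  also have "ball_int \<dots> = ball_int (\<lambda>x. (1 - x \<bullet> x) / 2 * lap g x) - ball_int (\<lambda>x. pd x g x)"
  proof (rule set_integral_diff)
    show "set_integrable lborel (cball 0 1) (\<lambda>x. (1 - x \<bullet> x) / 2 * lap g x)"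
      using g by (intro poly_set_integrable poly_intros half)
    show "set_integrable lborel (cball 0 1) (\<lambda>x. pd x g x)"
      by (subst pd_basis[OF g]) (use g in \<open>intro poly_set_integrable poly_intros real_polynomial_function_sum finite_Basis\<close>)
  qed
  finally show ?thesis by simp
qed


text \<open>The fundamental theorem of calculus along \<rho> and Fubini write the integral of the
  increment as the integral over \<rho> of the ball integrals of \<open>\<Psi> \<rho>\<close>. The
  sign is asked for only when \<rho> > 0 because the applications rescale by \<rho>.\<close>

lemma ball_int_increment_nonpos:
  fixes \<Phi> \<Psi> :: "real \<Rightarrow> 'a::euclidean_space \<Rightarrow> real"
  assumes deriv: "\<And>\<rho> y. \<rho> \<in> {0..1} \<Longrightarrow> norm y \<le> 1 \<Longrightarrow> ((\<lambda>\<rho>. \<Phi> \<rho> y) has_real_derivative \<Psi> \<rho> y) (at \<rho>)"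
    and cont: "continuous_on ({0..1} \<times> cball 0 1) (\<lambda>(\<rho>, y). \<Psi> \<rho> y)"
    and nonpos: "\<And>\<rho>. 0 < \<rho> \<Longrightarrow> \<rho> \<le> 1 \<Longrightarrow> ball_int (\<Psi> \<rho>) \<le> 0"
  shows "ball_int (\<lambda>y. \<Phi> 1 y - \<Phi> 0 y) \<le> 0"
proof -
  define k where "k \<rho> y = indicator ({0..1} \<times> cball 0 1) (\<rho>, y) *\<^sub>R \<Psi> \<rho> y" for \<rho> y
  have "integrable lborel (\<lambda>z. indicator ({0..1} \<times> cball (0::'a) 1) z *\<^sub>R (\<lambda>(\<rho>, y). \<Psi> \<rho> y) z)"
    by (intro borel_integrable_compact compact_Times cont) auto
  also have "(\<lambda>z. indicator ({0..1} \<times> cball (0::'a) 1) z *\<^sub>R (\<lambda>(\<rho>, y). \<Psi> \<rho> y) z) = case_prod k"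
    by (auto simp: k_def)
  finally have "integrable (lborel \<Otimes>\<^sub>M lborel) (case_prod k)" by (simp add: lborel_prod)
  then have fub: "(\<integral>y. (\<integral>\<rho>. k \<rho> y \<partial>lborel) \<partial>lborel) = (\<integral>\<rho>. (\<integral>y. k \<rho> y \<partial>lborel) \<partial>lborel)"
    by (rule lborel_pair.Fubini_integral)
  have inner1: "(\<integral>\<rho>. k \<rho> y \<partial>lborel) = indicator (cball 0 1) y *\<^sub>R (\<Phi> 1 y - \<Phi> 0 y)" for y
  proof (cases "norm y \<le> 1")
    case True
    have "(\<integral>\<rho>. indicator {0..1} \<rho> *\<^sub>R \<Psi> \<rho> y \<partial>lborel) = \<Phi> 1 y - \<Phi> 0 y"
    proof (rule integral_FTC_Icc)
      show "((\<lambda>\<rho>. \<Phi> \<rho> y) has_vector_derivative \<Psi> \<rho> y) (at \<rho> within {0..1})" if "0 \<le> \<rho>" "\<rho> \<le> 1" for \<rho>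
        using deriv[of \<rho> y] that True
        by (auto simp: has_real_derivative_iff_has_vector_derivative intro: has_vector_derivative_at_within)
      show "continuous_on {0..1} (\<lambda>\<rho>. \<Psi> \<rho> y)"
        by (rule continuous_on_compose2[OF cont, of _ "\<lambda>\<rho>. (\<rho>, y)", simplified])
          (use True in \<open>auto intro!: continuous_intros\<close>)
    qed simp
    moreover have "k \<rho> y = indicator {0..1} \<rho> *\<^sub>R \<Psi> \<rho> y" for \<rho>
      using True by (simp add: k_def indicator_times)
    ultimately show ?thesis using True by simp
  qed (simp add: k_def indicator_times)
  have inner2: "(\<integral>y. k \<rho> y \<partial>lborel) = indicator {0..1} \<rho> * ball_int (\<Psi> \<rho>)" for \<rho>
    by (cases "\<rho> \<in> {0..1}") (simp_all add: k_def indicator_times set_lebesgue_integral_def)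
  \<comment> \<open>\<open>nonpos\<close> is silent at \<rho> = 0, which is a null set.\<close>
  have "AE \<rho> in lborel. \<rho> \<noteq> (0::real)" by (rule AE_lborel_singleton)
  then have "AE \<rho> in lborel. 0 \<le> - (\<integral>y. k \<rho> y \<partial>lborel)"
    by eventually_elim (auto simp: inner2 indicator_def nonpos)
  then have "0 \<le> (\<integral>\<rho>. - (\<integral>y. k \<rho> y \<partial>lborel) \<partial>lborel)" by (rule integral_nonneg_AE)
  then have "(\<integral>\<rho>. (\<integral>y. k \<rho> y \<partial>lborel) \<partial>lborel) \<le> 0" by simp
  then show ?thesis unfolding fub[symmetric] inner1 by (simp add: set_lebesgue_integral_def)
qed

lemma poly_continuous_on_scaled:
  fixes f :: "'a::euclidean_space \<Rightarrow> real"
  assumes "real_polynomial_function f"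
  shows "continuous_on S (\<lambda>z. f (fst z *\<^sub>R snd z))"
  by (rule continuous_on_compose2[OF poly_continuous_on[OF assms, of UNIV]]) (auto intro!: continuous_intros)

lemma poly_continuous_on_radial:
  fixes f :: "'a::euclidean_space \<Rightarrow> real"
  assumes "real_polynomial_function f"
  shows "continuous_on S (\<lambda>z. pd (snd z) f (fst z *\<^sub>R snd z))"
  by (subst pd_basis[OF assms])
    (intro continuous_intros poly_continuous_on_scaled poly_pd assms)

lemma poly_ray_has_derivative:
  fixes f :: "'a::euclidean_space \<Rightarrow> real"
  assumes "real_polynomial_function f"
  shows "((\<lambda>\<rho>. f (\<rho> *\<^sub>R y)) has_real_derivative pd y f (\<rho> *\<^sub>R y)) (at \<rho>)"
proof -
  have "((\<lambda>\<rho>. f (\<rho> *\<^sub>R y)) has_derivative (\<lambda>t. pd (t *\<^sub>R y) f (\<rho> *\<^sub>R y))) (at \<rho>)"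
    by (rule has_derivative_compose[OF _ poly_has_derivative[OF assms]]) (auto intro!: derivative_eq_intros)
  moreover have "pd (t *\<^sub>R y) f x = t * pd y f x" for t x
    by (rule pd_scaleR[OF assms])
  ultimately show ?thesis by (simp add: has_field_derivative_def mult_commute_abs)
qed

text \<open>The increment of \<open>g\<close> from the centre is an integral of radial derivatives.
  At each scale \<rho>, the ball integral of the radial derivative is that of the Laplacian against
  a nonnegative weight, hence nonpositive.\<close>

lemma superharmonic_poly_mean:
  fixes g :: "'a::euclidean_space \<Rightarrow> real"
  assumes g: "real_polynomial_function g" and lap: "\<And>x. norm x \<le> 1 \<Longrightarrow> lap g x \<le> 0"
  shows "ball_int g \<le> g 0 * ball_vol TYPE('a)"
proof -
  have "ball_int (\<lambda>y. g (1 *\<^sub>R y) - g (0 *\<^sub>R y)) \<le> 0"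
  proof (rule ball_int_increment_nonpos)
    show "((\<lambda>\<rho>. g (\<rho> *\<^sub>R y)) has_real_derivative pd y g (\<rho> *\<^sub>R y)) (at \<rho>)" for \<rho> y
      by (rule poly_ray_has_derivative[OF g])
    show "continuous_on ({0..1} \<times> cball 0 1) (\<lambda>(\<rho>, y). pd y g (\<rho> *\<^sub>R y))"
      unfolding split_beta by (intro poly_continuous_on_radial g)
    show "ball_int (\<lambda>y. pd y g (\<rho> *\<^sub>R y)) \<le> 0" if \<rho>: "0 < \<rho>" "\<rho> \<le> 1" for \<rho>
    proof -
      define f where "f = (\<lambda>y. g (0 + \<rho> *\<^sub>R y))"
      have f: "real_polynomial_function f" unfolding f_def by (intro poly_scale g)
      have "\<rho> * ball_int (\<lambda>y. pd y g (\<rho> *\<^sub>R y)) = ball_int (\<lambda>y. pd y f y)"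
        unfolding f_def pd_scale[OF g] by simp
      also have "\<dots> = ball_int (\<lambda>x. (1 - x \<bullet> x) / 2 * lap f x)" by (rule ball_int_radial_derivative[OF f])
      also have "\<dots> \<le> 0"
      proof -
        have "0 \<le> (\<integral>x. - (indicator (cball 0 1) x *\<^sub>R ((1 - x \<bullet> x) / 2 * lap f x)) \<partial>lborel)"
        proof (rule Bochner_Integration.integral_nonneg)
          fix x :: 'a
          have "(1 - x \<bullet> x) / 2 * lap f x \<le> 0" if x: "norm x \<le> 1"
          proof (rule mult_nonneg_nonpos)
            show "0 \<le> (1 - x \<bullet> x) / 2" using x by (simp add: dot_square_norm power_le_one)
            have "\<rho> * norm x \<le> 1" using \<rho> x by (meson less_imp_le mult_le_one norm_ge_zero)
            then show "lap f x \<le> 0"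
              unfolding f_def lap_scale[OF g] using \<rho>
              by (intro mult_nonneg_nonpos lap) auto
          qed
          then show "0 \<le> - (indicator (cball 0 1) x *\<^sub>R ((1 - x \<bullet> x) / 2 * lap f x))"
            by (auto simp: indicator_def)
        qed
        then show ?thesis by (simp add: set_lebesgue_integral_def)
      qed
      finally show ?thesis using \<rho>(1) by (simp add: mult_le_0_iff)
    qed
  qed
  also have "ball_int (\<lambda>y. g (1 *\<^sub>R y) - g (0 *\<^sub>R y)) = ball_int g - g 0 * ball_vol TYPE('a)"
    using set_integral_diff(2)[OF poly_set_integrable[OF g] poly_set_integrable[OF real_polynomial_function.intros(2)[of "g 0"]], of 0 1]
    by (simp add: ball_int_const)
  finally show ?thesis by simp
qed

lemma ball_int_uminus: "ball_int (\<lambda>x. - f x) = - ball_int f"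
  using ball_int_mult[of "-1" f] by simp

lemma harmonic_poly_mean:
  fixes g :: "'a::euclidean_space \<Rightarrow> real"
  assumes g: "real_polynomial_function g" and lap: "lap g = (\<lambda>x. 0)"
  shows "ball_int g = g 0 * ball_vol TYPE('a)"
proof (rule antisym)
  show "ball_int g \<le> g 0 * ball_vol TYPE('a)" using superharmonic_poly_mean[OF g] lap by simp
  have "lap (\<lambda>x. - g x) = (\<lambda>x. 0)" using lap_cmult[OF g, of "-1"] lap by simp
  moreover have "real_polynomial_function (\<lambda>x. - g x)" using g by blast
  ultimately have "ball_int (\<lambda>x. - g x) \<le> - g 0 * ball_vol TYPE('a)"
    using superharmonic_poly_mean[of "\<lambda>x. - g x"] by simp
  then show "g 0 * ball_vol TYPE('a) \<le> ball_int g" by (simp add: ball_int_uminus)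
qed

text \<open>The integrand is the divergence of the field x f(x), which vanishes on the
  sphere.\<close>

lemma ball_int_divergence_radial:
  fixes f :: "'a::euclidean_space \<Rightarrow> real"
  assumes f: "real_polynomial_function f" and f0: "\<And>x. norm x = 1 \<Longrightarrow> f x = 0"
  shows "ball_int (\<lambda>x. real DIM('a) * f x + pd x f x) = 0"
proof -
  have X: "real_polynomial_function (\<lambda>x. (x \<bullet> e) * f x)" for e by (intro poly_intros f)
  have "ball_int (pd e (\<lambda>x. (x \<bullet> e) * f x)) = 0" if "e \<in> Basis" for e
    using that f0 by (intro ball_int_pd_eq_0 X) auto
  then have "0 = ball_int (\<lambda>x. \<Sum>e\<in>Basis. pd e (\<lambda>x. (x \<bullet> e) * f x) x)"
    by (subst ball_int_sum) (auto intro: X)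
  also have "(\<lambda>x. \<Sum>e\<in>Basis. pd e (\<lambda>x. (x \<bullet> e) * f x) x) = (\<lambda>x. real DIM('a) * f x + pd x f x)"
  proof
    fix x
    show "(\<Sum>e\<in>Basis. pd e (\<lambda>x. (x \<bullet> e) * f x) x) = real DIM('a) * f x + pd x f x"
      by (simp add: pd_mult poly_inner f sum.distrib pd_basis[OF f, of x] inner_same_Basis)
  qed
  finally show ?thesis by simp
qed

lemma poly_pd_self:
  assumes "real_polynomial_function (f :: 'a::euclidean_space \<Rightarrow> real)"
  shows "real_polynomial_function (\<lambda>x. pd x f x)"
  by (subst pd_basis[OF assms]) (intro real_polynomial_function_sum finite_Basis poly_intros assms)

text \<open>
  The number \<open>h 0\<close> is the mean of \<open>P\<close> over the unit sphere; the divergence of \<open>x P(x)\<close> is a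
  substitute for the surface integral.
\<close>

lemma ball_int_divergence_extension:
  fixes P :: "'a::euclidean_space \<Rightarrow> real"
  assumes P: "real_polynomial_function P" and h: "real_polynomial_function h" "lap h = (\<lambda>x. 0)"
    and eq: "\<And>x. norm x = 1 \<Longrightarrow> h x = P x"
  shows "ball_int (\<lambda>x. real DIM('a) * P x + pd x P x) = real DIM('a) * h 0 * ball_vol TYPE('a)"
proof -
  have h': "ball_int (\<lambda>x. pd x h x) = 0"
    using ball_int_radial_derivative[OF h(1)] h(2) by (simp add: set_lebesgue_integral_def)
  have "0 = ball_int (\<lambda>x. real DIM('a) * (P x - h x) + pd x (\<lambda>x. P x - h x) x)"
    using eq by (subst ball_int_divergence_radial) (auto intro!: poly_intros P h)
  also have "\<dots> = ball_int (\<lambda>x. (real DIM('a) * P x + pd x P x) - (real DIM('a) * h x + pd x h x))"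
    by (simp add: pd_diff P h algebra_simps)
  also have "\<dots> = ball_int (\<lambda>x. real DIM('a) * P x + pd x P x) - ball_int (\<lambda>x. real DIM('a) * h x + pd x h x)"
    by (intro set_integral_diff poly_set_integrable poly_intros poly_pd_self P h)
  also have "ball_int (\<lambda>x. real DIM('a) * h x + pd x h x) = ball_int (\<lambda>x. real DIM('a) * h x) + ball_int (\<lambda>x. pd x h x)"
    by (intro set_integral_add poly_set_integrable poly_intros poly_pd_self h)
  finally show ?thesis by (simp add: h' harmonic_poly_mean[OF h])
qed

text \<open>Integration in polar coordinates in disguise: the \<rho>-derivative of \<rho>^n (v -
  P(\<rho> y)), integrated over the unit ball, is n \<rho>^(n-1) (v - h 0) times the volume of the
  ball, where \<open>h 0\<close> plays the role of the mean over the sphere of radius \<rho>. A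
  lower bound for all spherical means thus becomes one for the solid mean.\<close>

lemma poly_mean_ge:
  fixes P :: "'a::euclidean_space \<Rightarrow> real"
  assumes P: "real_polynomial_function P"
    and le: "\<And>\<rho> h. 0 < \<rho> \<Longrightarrow> \<rho> \<le> 1 \<Longrightarrow> real_polynomial_function h \<Longrightarrow> lap h = (\<lambda>x. 0) \<Longrightarrow>
      (\<And>x. norm x = 1 \<Longrightarrow> h x = P (\<rho> *\<^sub>R x)) \<Longrightarrow> v \<le> h 0"
  shows "v * ball_vol TYPE('a) \<le> ball_int P"
proof -
  define n where "n = DIM('a)"
  obtain m where m: "n = Suc m" unfolding n_def using DIM_positive[where 'a='a] gr0_conv_Suc by blast
  have "ball_int (\<lambda>y. 1 ^ n * (v - P (1 *\<^sub>R y)) - 0 ^ n * (v - P (0 *\<^sub>R y))) \<le> 0"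
  proof (rule ball_int_increment_nonpos)
    show "((\<lambda>\<rho>. \<rho> ^ n * (v - P (\<rho> *\<^sub>R y))) has_real_derivative
      (real n * \<rho> ^ m * (v - P (\<rho> *\<^sub>R y)) - \<rho> ^ n * pd y P (\<rho> *\<^sub>R y))) (at \<rho>)" for \<rho> y
      by (rule DERIV_cong, (rule derivative_intros poly_ray_has_derivative[OF P])+)
        (simp add: m algebra_simps)
    show "continuous_on ({0..1} \<times> cball 0 1) (\<lambda>(\<rho>, y). real n * \<rho> ^ m * (v - P (\<rho> *\<^sub>R y)) - \<rho> ^ n * pd y P (\<rho> *\<^sub>R y))"
      unfolding split_beta
      by (intro continuous_intros poly_continuous_on_scaled poly_continuous_on_radial P)
    show "ball_int (\<lambda>y. real n * \<rho> ^ m * (v - P (\<rho> *\<^sub>R y)) - \<rho> ^ n * pd y P (\<rho> *\<^sub>R y)) \<le> 0" if \<rho>: "0 < \<rho>" "\<rho> \<le> 1" for \<rho>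
    proof -
      define Q where "Q = (\<lambda>y. P (0 + \<rho> *\<^sub>R y))"
      have Q: "real_polynomial_function Q" unfolding Q_def by (intro poly_scale P)
      obtain h where h: "real_polynomial_function h" "lap h = (\<lambda>x. 0)" "\<And>x. norm x = 1 \<Longrightarrow> h x = Q x"
        using harmonic_extension[OF Q] by blast
      have "v \<le> h 0" using le[OF \<rho> h(1,2)] h(3) by (simp add: Q_def)
      have 1: "(\<lambda>y. real n * \<rho> ^ m * (v - P (\<rho> *\<^sub>R y)) - \<rho> ^ n * pd y P (\<rho> *\<^sub>R y)) =
        (\<lambda>y. \<rho> ^ m * (real n * v - (real n * Q y + pd y Q y)))"
        unfolding Q_def pd_scale[OF P] by (simp add: m algebra_simps)
      have "ball_int (\<lambda>y. real n * v - (real n * Q y + pd y Q y)) =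
        ball_int (\<lambda>y::'a. real n * v) - ball_int (\<lambda>y. real n * Q y + pd y Q y)"
        by (rule set_integral_diff(2)) (intro poly_set_integrable poly_intros poly_pd_self Q)+
      also have "\<dots> = real n * (v - h 0) * ball_vol TYPE('a)"
        unfolding n_def by (subst ball_int_divergence_extension[OF Q h]) (auto simp: ball_int_const algebra_simps)
      also have "\<dots> \<le> 0" using \<open>v \<le> h 0\<close> by (simp add: mult_nonneg_nonpos mult_nonpos_nonneg)
      finally show ?thesis unfolding 1 using \<rho> by (simp add: mult_nonneg_nonpos)
    qed
  qed
  also have "ball_int (\<lambda>y. 1 ^ n * (v - P (1 *\<^sub>R y)) - 0 ^ n * (v - P (0 *\<^sub>R y))) = ball_int (\<lambda>y. v - P y)"
    by (simp add: m)
  also have "\<dots> = v * ball_vol TYPE('a) - ball_int P"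
    using set_integral_diff(2)[OF poly_set_integrable[OF real_polynomial_function.intros(2)[of v]] poly_set_integrable[OF P], of 0 1]
    by (simp add: ball_int_const)
  finally show ?thesis by simp
qed

lemma set_integral_cball_scale:
  fixes f :: "'a::euclidean_space \<Rightarrow> real"
  assumes "r > 0" "continuous_on (cball a r) f"
  shows "(LINT y:cball a r|lborel. f y) = r ^ DIM('a) * ball_int (\<lambda>y. f (a + r *\<^sub>R y))"
proof -
  define F where "F = (\<lambda>y. indicator (cball a r) y *\<^sub>R f y)"
  have "integrable lborel F" unfolding F_def by (intro borel_integrable_compact assms) simp
  then have [measurable]: "F \<in> borel_measurable borel" by (auto dest: borel_measurable_integrable)
  have "(LINT y:cball a r|lborel. f y) = (\<integral>y. F y \<partial>lborel)" by (simp add: F_def set_lebesgue_integral_def)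
  also have "\<dots> = (\<integral>y. F y \<partial>density (distr lborel borel (\<lambda>x. a + r *\<^sub>R x)) (\<lambda>_. ennreal (\<bar>r\<bar>^DIM('a))))"
    using lborel_affine[of r a] assms(1) by (simp flip: ennreal_power)
  also have "\<dots> = (\<integral>y. \<bar>r\<bar>^DIM('a) *\<^sub>R F y \<partial>distr lborel borel (\<lambda>x. a + r *\<^sub>R x))"
    by (subst integral_density) auto
  also have "\<dots> = (\<integral>y. \<bar>r\<bar>^DIM('a) *\<^sub>R F (a + r *\<^sub>R y) \<partial>lborel)"
    by (subst integral_distr) auto
  also have "\<dots> = r ^ DIM('a) * (\<integral>y. F (a + r *\<^sub>R y) \<partial>lborel)"
    using assms(1) by simp
  also have "(\<lambda>y. F (a + r *\<^sub>R y)) = (\<lambda>y. indicator (cball 0 1) y *\<^sub>R f (a + r *\<^sub>R y))"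
    using assms(1) by (auto simp: F_def indicator_def dist_norm fun_eq_iff)
  finally show ?thesis by (simp add: set_lebesgue_integral_def)
qed

lemma ball_vol_pos: "ball_vol TYPE('a::euclidean_space) > 0"
  by simp

lemma mean_cball_scale:
  fixes f :: "'a::euclidean_space \<Rightarrow> real"
  assumes "r > 0" "continuous_on (cball a r) f"
  shows "(LINT y:cball a r|lborel. f y) / measure lborel (cball a r) =
    ball_int (\<lambda>y. f (a + r *\<^sub>R y)) / ball_vol TYPE('a)"
proof -
  have "measure lborel (cball a r) = r ^ DIM('a) * ball_vol TYPE('a)"
    using assms(1) by (simp add: content_cball)
  then show ?thesis unfolding set_integral_cball_scale[OF assms] using assms(1) by simp
qed

section \<open>Touching by strictly superharmonic polynomials\<close>

definition grad :: "('a::euclidean_space \<Rightarrow> real) \<Rightarrow> 'a \<Rightarrow> 'a" where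
  "grad f x = (\<Sum>e\<in>Basis. pd e f x *\<^sub>R e)"

lemma grad_inner_Basis: "e \<in> Basis \<Longrightarrow> grad f x \<bullet> e = pd e f x"
  by (simp add: grad_def inner_sum_left_Basis)

lemma differentiable_has_grad:
  assumes "f differentiable (at x)"
  shows "(f has_derivative (\<lambda>h. grad f x \<bullet> h)) (at x)"
proof -
  have d: "(f has_derivative frechet_derivative f (at x)) (at x)"
    using assms by (simp add: frechet_derivative_works)
  then interpret bounded_linear "frechet_derivative f (at x)" by (rule has_derivative_bounded_linear)
  have "frechet_derivative f (at x) = (\<lambda>h. grad f x \<bullet> h)"
  proof
    fix h
    have "frechet_derivative f (at x) h = frechet_derivative f (at x) (\<Sum>e\<in>Basis. (h \<bullet> e) *\<^sub>R e)"
      by (simp add: euclidean_representation)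
    also have "\<dots> = (\<Sum>e\<in>Basis. (h \<bullet> e) * pd e f x)" by (simp add: sum scaleR pd_def)
    also have "\<dots> = grad f x \<bullet> h"
      by (simp add: grad_def inner_sum_left inner_commute[of h] mult.commute)
    finally show "frechet_derivative f (at x) h = grad f x \<bullet> h" .
  qed
  with d show ?thesis by simp
qed

lemma C1_on_has_grad: "C1_on \<Omega> u \<Longrightarrow> x \<in> \<Omega> \<Longrightarrow> (u has_derivative (\<lambda>h. grad u x \<bullet> h)) (at x)"
  by (auto simp: C1_on_def intro: differentiable_has_grad)

lemma C1_on_continuous_on: "C1_on \<Omega> u \<Longrightarrow> continuous_on \<Omega> u"
  by (meson C1_on_has_grad continuous_at_imp_continuous_on has_derivative_continuous)

lemma poly_has_grad:
  "real_polynomial_function f \<Longrightarrow> (f has_derivative (\<lambda>h. grad f x \<bullet> h)) (at x)"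
  by (intro differentiable_has_grad poly_differentiable)

lemma poly_grad_continuous_on: "real_polynomial_function f \<Longrightarrow> continuous_on S (grad f)"
  unfolding grad_def[abs_def] by (intro continuous_intros poly_continuous_on poly_pd)

lemma poly_grad_cmult: "real_polynomial_function f \<Longrightarrow> grad (\<lambda>x. c * f x) x = c *\<^sub>R grad f x"
  by (simp add: grad_def pd_cmult scaleR_sum_right)

lemma lap_sqdist [simp]: "lap (\<lambda>y::'a::euclidean_space. (y - x) \<bullet> (y - x)) = (\<lambda>y. 2 * real DIM('a))"
  using lap_scale[OF poly_sqnorm, of "- x" 1] by simp

lemma poly_sqdist: "real_polynomial_function (\<lambda>y::'a::euclidean_space. (y - x) \<bullet> (y - x))"
  using poly_scale[OF poly_sqnorm, of "- x" 1] by simp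

text \<open>
  The viscosity notion of a subsolution of \<open>\<Delta>u \<ge> 0\<close>, with polynomials as test functions, says that
  no strictly superharmonic polynomial touches \<open>u\<close> from above.
\<close>

definition touches :: "('a::euclidean_space \<Rightarrow> real) \<Rightarrow> ('a \<Rightarrow> real) \<Rightarrow> 'a \<Rightarrow> bool" where
  "touches u \<phi> x \<longleftrightarrow> real_polynomial_function \<phi> \<and> lap \<phi> x < 0 \<and>
     (\<exists>r>0. \<forall>y\<in>ball x r. u y - \<phi> y \<le> u x - \<phi> x)"

text \<open>The radial derivative identity for |x|^2 evaluates the integral: (n + 2) I = n vol, with
  vol the volume of the unit ball. Positivity makes the inequality in
  \<open>subharmonic_not_touches\<close> strict.\<close>

lemma ball_int_sqnorm_pos: "ball_int (\<lambda>x::'a::euclidean_space. x \<bullet> x) > 0"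
proof -
  define I where "I = ball_int (\<lambda>x::'a. x \<bullet> x)"
  have "2 * I = ball_int (\<lambda>x::'a. 2 * (x \<bullet> x))" by (simp add: I_def)
  also have "\<dots> = ball_int (\<lambda>x::'a. real DIM('a) * (1 - x \<bullet> x))"
    using ball_int_radial_derivative[OF poly_sqnorm, where 'a='a] by (simp add: mult.commute)
  also have "\<dots> = real DIM('a) * ball_int (\<lambda>x::'a. 1 - x \<bullet> x)" by simp
  also have "ball_int (\<lambda>x::'a. 1 - x \<bullet> x) = ball_int (\<lambda>x::'a. 1) - I" unfolding I_def
    by (rule set_integral_diff(2)) (intro poly_set_integrable poly_intros)+
  finally have "(2 + real DIM('a)) * I = real DIM('a) * ball_vol TYPE('a)"
    by (simp add: ball_int_const algebra_simps)
  moreover have "real DIM('a) * ball_vol TYPE('a) > 0" by simp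
  ultimately have "(2 + real DIM('a)) * I > 0" by linarith
  then show ?thesis unfolding I_def by (simp add: zero_less_mult_iff)
qed

text \<open>Because the Laplacian is strictly negative, a small multiple of |y - x|^2 can be added
  to the test function. This makes the contact strict with a quadratic gap, and continuity keeps the
  Laplacian negative nearby.\<close>

lemma touches_strict:
  fixes u :: "'a::euclidean_space \<Rightarrow> real"
  assumes "touches u \<phi> x"
  obtains \<psi> \<eta> r where "real_polynomial_function \<psi>" "0 < \<eta>" "0 < r"
    "\<And>y. y \<in> ball x r \<Longrightarrow> lap \<psi> y < 0"
    "\<And>y. y \<in> ball x r \<Longrightarrow> u y - \<psi> y \<le> u x - \<psi> x - \<eta> * (norm (y - x))\<^sup>2"
proof -
  from assms obtain r where r: "real_polynomial_function \<phi>" "lap \<phi> x < 0" "r > 0"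
    "\<And>y. y \<in> ball x r \<Longrightarrow> u y - \<phi> y \<le> u x - \<phi> x" by (auto simp: touches_def)
  \<comment> \<open>The Laplacian of |y - x|^2 is 2n, so this choice spends half of
    \<open>lap \<phi> x\<close> and leaves the other half.\<close>
  define \<eta> where "\<eta> = - lap \<phi> x / (4 * real DIM('a))"
  have \<eta>: "\<eta> > 0" using r(2) by (simp add: \<eta>_def divide_neg_pos)
  define \<psi> where "\<psi> = (\<lambda>y. \<phi> y + \<eta> * ((y - x) \<bullet> (y - x)))"
  have \<psi>: "real_polynomial_function \<psi>" unfolding \<psi>_def by (intro poly_intros poly_sqdist r)
  have "lap \<psi> y = lap \<phi> y + 2 * real DIM('a) * \<eta>" for y
    unfolding \<psi>_def by (subst lap_add) (auto simp: lap_cmult poly_sqdist intro!: poly_intros poly_sqdist r)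
  then have "lap \<psi> x = lap \<phi> x / 2" by (simp add: \<eta>_def)
  then have neg: "lap \<psi> x < 0" using r(2) by simp
  have "isCont (lap \<psi>) x"
    using poly_continuous_on[OF poly_lap[OF \<psi>], of UNIV] by (simp add: continuous_on_eq_continuous_at)
  then have "eventually (\<lambda>y. lap \<psi> y < 0) (nhds x)"
    using neg by (simp add: continuous_at tendsto_at_iff_tendsto_nhds order_tendstoD(2))
  then obtain d where d: "d > 0" "\<And>y. dist y x < d \<Longrightarrow> lap \<psi> y < 0"
    unfolding eventually_nhds_metric by blast
  show ?thesis
  proof (rule that[of \<psi> \<eta> "min r d"])
    fix y assume y: "y \<in> ball x (min r d)"
    show "lap \<psi> y < 0" using y d by (simp add: dist_commute)
    show "u y - \<psi> y \<le> u x - \<psi> x - \<eta> * (norm (y - x))\<^sup>2"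
      using r(4)[of y] y by (simp add: \<psi>_def dot_square_norm)
  qed (use \<psi> \<eta> r d in auto)
qed

text \<open>On a small ball \<open>u\<close> lies below the superharmonic polynomial
  \<open>g\<close> (after rescaling) by a quadratic gap, and \<open>g 0 = u x\<close>. The mean of
  \<open>u\<close> would then be strictly smaller than \<open>u x\<close>.\<close>

lemma subharmonic_not_touches:
  fixes u :: "'a::euclidean_space \<Rightarrow> real"
  assumes u: "subharmonic_on V u" "continuous_on V u" and V: "open V" "x \<in> V"
  shows "\<not> touches u \<phi> x"
proof
  assume "touches u \<phi> x"
  then obtain \<psi> \<eta> r where \<psi>: "real_polynomial_function \<psi>" "0 < \<eta>" "0 < r"
    "\<And>y. y \<in> ball x r \<Longrightarrow> lap \<psi> y < 0"
    "\<And>y. y \<in> ball x r \<Longrightarrow> u y - \<psi> y \<le> u x - \<psi> x - \<eta> * (norm (y - x))\<^sup>2"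
    using touches_strict by blast
  obtain s where s: "s > 0" "cball x s \<subseteq> V" using V open_contains_cball by blast
  define \<rho> where "\<rho> = min s (r / 2)"
  have \<rho>: "\<rho> > 0" "cball x \<rho> \<subseteq> V" "cball x \<rho> \<subseteq> ball x r"
    using s \<psi>(3) by (auto simp: \<rho>_def)
  have mem: "x + \<rho> *\<^sub>R y \<in> cball x \<rho>" if "norm y \<le> 1" for y
    using that \<rho>(1) by (simp add: dist_norm mult_left_le)
  have cu: "continuous_on (cball x \<rho>) u" using u(2) \<rho>(2) by (rule continuous_on_subset)
  define g where "g = (\<lambda>y. (u x - \<psi> x) + \<psi> (x + \<rho> *\<^sub>R y))"
  have g: "real_polynomial_function g" unfolding g_def by (intro poly_intros \<psi>)
  have "u x \<le> (LINT y:cball x \<rho>|lborel. u y) / measure lborel (cball x \<rho>)"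
    using u(1) \<rho> by (auto simp: subharmonic_on_def)
  also have "\<dots> = ball_int (\<lambda>y. u (x + \<rho> *\<^sub>R y)) / ball_vol TYPE('a)"
    by (rule mean_cball_scale[OF \<rho>(1) cu])
  finally have "u x * ball_vol TYPE('a) \<le> ball_int (\<lambda>y. u (x + \<rho> *\<^sub>R y))"
    by (simp add: pos_le_divide_eq)
  also have "\<dots> \<le> ball_int (\<lambda>y. g y - \<eta> * \<rho>\<^sup>2 * (y \<bullet> y))"
  proof (rule set_integral_mono)
    have "continuous_on (cball 0 1) (\<lambda>y. u (x + \<rho> *\<^sub>R y))"
      by (rule continuous_on_compose2[OF cu]) (auto intro!: continuous_intros mem)
    then show "set_integrable lborel (cball 0 1) (\<lambda>y. u (x + \<rho> *\<^sub>R y))" by (rule set_integrable_cball)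
    show "set_integrable lborel (cball 0 1) (\<lambda>y. g y - \<eta> * \<rho>\<^sup>2 * (y \<bullet> y))"
      by (intro poly_set_integrable poly_intros g)
    fix y :: 'a assume "y \<in> cball 0 1"
    then have "x + \<rho> *\<^sub>R y \<in> ball x r" using mem \<rho>(3) by (simp add: subset_iff)
    from \<psi>(5)[OF this] show "u (x + \<rho> *\<^sub>R y) \<le> g y - \<eta> * \<rho>\<^sup>2 * (y \<bullet> y)"
      by (simp add: g_def power_mult_distrib dot_square_norm mult.assoc)
  qed
  also have "\<dots> = ball_int g - ball_int (\<lambda>y::'a. \<eta> * \<rho>\<^sup>2 * (y \<bullet> y))"
    by (rule set_integral_diff(2)) (intro poly_set_integrable poly_intros g)+
  also have "\<dots> < ball_int g" using ball_int_sqnorm_pos[where 'a='a] \<psi>(2) \<rho>(1) by simp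
  also have "\<dots> \<le> g 0 * ball_vol TYPE('a)"
  proof (rule superharmonic_poly_mean[OF g])
    fix y :: 'a assume "norm y \<le> 1"
    then have "x + \<rho> *\<^sub>R y \<in> ball x r" using mem \<rho>(3) by (simp add: subset_iff)
    from \<psi>(4)[OF this] show "lap g y \<le> 0"
      unfolding g_def by (subst lap_add) (auto simp: lap_scale \<psi>(1) mult_nonneg_nonpos intro!: poly_intros \<psi>)
  qed
  finally show False by (simp add: g_def)
qed

lemma local_max_grad:
  fixes u \<phi> :: "'a::euclidean_space \<Rightarrow> real"
  assumes u: "(u has_derivative (\<lambda>h. grad u x \<bullet> h)) (at x)" and \<phi>: "real_polynomial_function \<phi>"
    and r: "r > 0" and max: "\<And>y. y \<in> ball x r \<Longrightarrow> u y - \<phi> y \<le> u x - \<phi> x"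
  shows "grad u x = grad \<phi> x"
proof -
  have "((\<lambda>y. u y - \<phi> y) has_derivative (\<lambda>h. grad u x \<bullet> h - grad \<phi> x \<bullet> h)) (at x)"
    by (intro has_derivative_diff u poly_has_grad \<phi>)
  then have "(\<lambda>h. grad u x \<bullet> h - grad \<phi> x \<bullet> h) = (\<lambda>v. 0)"
    by (rule differential_zero_maxmin[of x "ball x r", rotated 2]) (use r max in auto)
  then have "(grad u x - grad \<phi> x) \<bullet> (grad u x - grad \<phi> x) = 0"
    by (simp add: inner_diff_left fun_eq_iff)
  then show ?thesis by simp
qed

text \<open>
  The scalar family \<open>(1 + t) \<psi>\<close> of test functions is chosen because the maximum \<open>m t\<close> of
  \<open>u - (1 + t) \<psi>\<close> is convex with slope \<open>- \<psi> (X t)\<close>, so that \<open>u (X t) = m t - (1 + t) m' t\<close> is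
  monotone in \<open>t\<close>.
\<close>

lemma touching_family:
  fixes u :: "'a::euclidean_space \<Rightarrow> real"
  assumes u: "\<And>x. x \<in> \<Omega> \<Longrightarrow> (u has_derivative (\<lambda>h. grad u x \<bullet> h)) (at x)"
    and R: "0 < R" "cball x0 R \<subseteq> \<Omega>" and touch: "touches u \<phi> x0" and ne: "grad u x0 \<noteq> 0"
  obtains r \<delta> g0 \<psi> X where "0 < r" "r \<le> R" "0 < \<delta>" "\<delta> \<le> 1" "0 < g0" "real_polynomial_function \<psi>"
    "\<And>y. y \<in> cball x0 r \<Longrightarrow> g0 \<le> norm (grad \<psi> y)"
    "\<And>t. t \<in> {0..\<delta>} \<Longrightarrow> X t \<in> cball x0 (r / 2)"
    "\<And>t. t \<in> {0..\<delta>} \<Longrightarrow> touches u (\<lambda>y. (1 + t) * \<psi> y) (X t)"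
    "\<And>t. t \<in> {0..\<delta>} \<Longrightarrow> grad u (X t) = (1 + t) *\<^sub>R grad \<psi> (X t)"
    "\<And>t t'. t \<in> {0..\<delta>} \<Longrightarrow> t' \<in> {0..\<delta>} \<Longrightarrow> t < t' \<Longrightarrow> u (X t') \<le> u (X t)"
    "\<And>t t' y. t \<in> {0..\<delta>} \<Longrightarrow> t' \<in> {0..\<delta>} \<Longrightarrow> t < t' \<Longrightarrow> y \<in> cball x0 r \<Longrightarrow>
      u y - (1 + t') * \<psi> y \<le> u (X t) - (1 + t') * \<psi> (X t) + (t' - t) * (u (X t) - u (X t'))"
proof -
  from touch obtain \<psi> \<eta> s where \<psi>: "real_polynomial_function \<psi>" "0 < \<eta>" "0 < s"
    "\<And>y. y \<in> ball x0 s \<Longrightarrow> lap \<psi> y < 0"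
    "\<And>y. y \<in> ball x0 s \<Longrightarrow> u y - \<psi> y \<le> u x0 - \<psi> x0 - \<eta> * (norm (y - x0))\<^sup>2"
    using touches_strict by blast
  have x0: "x0 \<in> \<Omega>" using R by auto
  have "grad u x0 = grad \<psi> x0"
  proof (rule local_max_grad[OF u[OF x0] \<psi>(1,3)])
    fix y assume "y \<in> ball x0 s"
    from \<psi>(5)[OF this] show "u y - \<psi> y \<le> u x0 - \<psi> x0"
      using \<psi>(2) by (smt (verit) mult_nonneg_nonneg zero_le_power2)
  qed
  then have ne': "grad \<psi> x0 \<noteq> 0" using ne by simp
  define g0 where "g0 = norm (grad \<psi> x0) / 2"
  have g0: "g0 > 0" using ne' by (simp add: g0_def)
  have "isCont (\<lambda>y. norm (grad \<psi> y)) x0"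
    using poly_grad_continuous_on[OF \<psi>(1), of UNIV]
    by (intro continuous_norm) (simp add: continuous_on_eq_continuous_at)
  then have "((\<lambda>y. norm (grad \<psi> y)) \<longlongrightarrow> norm (grad \<psi> x0)) (nhds x0)"
    unfolding continuous_at by (subst (asm) tendsto_at_iff_tendsto_nhds)
  then have "eventually (\<lambda>y. g0 < norm (grad \<psi> y)) (nhds x0)"
    by (rule order_tendstoD(1)) (use g0 in \<open>simp add: g0_def\<close>)
  then obtain d where d: "d > 0" "\<And>y. dist y x0 < d \<Longrightarrow> g0 < norm (grad \<psi> y)"
    unfolding eventually_nhds_metric by blast
  define r where "r = min R (min (s / 2) (d / 2))"
  have r: "r > 0" "r \<le> R" "r < s" "r < d" using R \<psi> d by (auto simp: r_def)
  have cu: "continuous_on (cball x0 r) u"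
    using r R u by (meson continuous_at_imp_continuous_on cball_subset_cball_iff has_derivative_continuous
        order_trans subset_cball subset_eq)
  have c\<psi>: "continuous_on (cball x0 r) \<psi>" by (rule poly_continuous_on[OF \<psi>(1)])
  have "bounded (\<psi> ` cball x0 r)"
    by (intro compact_imp_bounded compact_continuous_image c\<psi>) simp
  then obtain M where M: "M > 0" "\<And>y. y \<in> cball x0 r \<Longrightarrow> \<bar>\<psi> y\<bar> \<le> M"
    unfolding bounded_pos by auto
  \<comment> \<open>Scaling the test function changes the comparison between \<open>x0\<close> and
    \<open>X t\<close> by at most 2 M \<delta>. This must stay below the quadratic gap at distance
    r/2, so that the maximisers cannot escape to the boundary of the ball.\<close>
  define \<delta> where "\<delta> = min 1 (\<eta> * r\<^sup>2 / (16 * M))"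
  have \<delta>: "0 < \<delta>" "\<delta> \<le> 1" "\<delta> * (2 * M) < \<eta> * (r / 2)\<^sup>2"
  proof -
    have "\<delta> * (2 * M) \<le> \<eta> * r\<^sup>2 / (16 * M) * (2 * M)" using M by (intro mult_right_mono) (auto simp: \<delta>_def)
    also have "\<dots> = \<eta> * r\<^sup>2 / 8" using M by simp
    also have "\<dots> < \<eta> * (r / 2)\<^sup>2" using r \<psi> by (simp add: power_divide)
    finally show "\<delta> * (2 * M) < \<eta> * (r / 2)\<^sup>2" .
  qed (use M r \<psi> in \<open>auto simp: \<delta>_def\<close>)
  have "\<exists>x\<in>cball x0 r. \<forall>y\<in>cball x0 r. u y - (1 + t) * \<psi> y \<le> u x - (1 + t) * \<psi> x" for t
    using r(1) by (intro continuous_attains_sup continuous_intros cu c\<psi>) auto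
  then obtain X where X: "\<And>t. X t \<in> cball x0 r"
    "\<And>t y. y \<in> cball x0 r \<Longrightarrow> u y - (1 + t) * \<psi> y \<le> u (X t) - (1 + t) * \<psi> (X t)" by metis
  have Xhalf: "X t \<in> ball x0 (r / 2)" if t: "t \<in> {0..\<delta>}" for t
  proof (rule ccontr)
    assume "X t \<notin> ball x0 (r / 2)"
    then have "r / 2 \<le> norm (X t - x0)" by (simp add: dist_norm norm_minus_commute)
    then have "\<eta> * (r / 2)\<^sup>2 \<le> \<eta> * (norm (X t - x0))\<^sup>2"
      using \<psi>(2) r(1) by (intro mult_left_mono power_mono) auto
    moreover have "u (X t) - \<psi> (X t) \<le> u x0 - \<psi> x0 - \<eta> * (norm (X t - x0))\<^sup>2"
      using X(1)[of t] r by (intro \<psi>(5)) auto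
    moreover have "u x0 - (1 + t) * \<psi> x0 \<le> u (X t) - (1 + t) * \<psi> (X t)" using r(1) by (intro X(2)) auto
    moreover have "t * (\<psi> x0 - \<psi> (X t)) \<le> \<delta> * (2 * M)"
    proof -
      have "\<bar>\<psi> x0\<bar> \<le> M" "\<bar>\<psi> (X t)\<bar> \<le> M" using M(2)[OF X(1)] M(2)[of x0] r(1) by auto
      then have "\<psi> x0 - \<psi> (X t) \<le> 2 * M" by linarith
      then have "t * (\<psi> x0 - \<psi> (X t)) \<le> t * (2 * M)" using t by (intro mult_left_mono) auto
      also have "\<dots> \<le> \<delta> * (2 * M)" using t M by (intro mult_right_mono) auto
      finally show ?thesis .
    qed
    ultimately show False using \<delta>(3) by (simp add: algebra_simps)
  qed
  have Xmax: "u y - (1 + t) * \<psi> y \<le> u (X t) - (1 + t) * \<psi> (X t)"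
    if "t \<in> {0..\<delta>}" "y \<in> ball (X t) (r / 2)" for t y
  proof (rule X(2))
    have "dist x0 y \<le> dist x0 (X t) + dist (X t) y" by (rule dist_triangle)
    then show "y \<in> cball x0 r" using Xhalf[OF that(1)] that(2) by simp
  qed
  show ?thesis
  proof (rule that[of r \<delta> g0 \<psi> X])
    show "g0 \<le> norm (grad \<psi> y)" if "y \<in> cball x0 r" for y
      using d(2)[of y] that r by (simp add: dist_commute)
    show "X t \<in> cball x0 (r / 2)" if "t \<in> {0..\<delta>}" for t using Xhalf[OF that] by auto
    show touch: "touches u (\<lambda>y. (1 + t) * \<psi> y) (X t)" if t: "t \<in> {0..\<delta>}" for t
      unfolding touches_def
    proof (intro conjI exI[of _ "r / 2"] ballI)
      show "real_polynomial_function (\<lambda>y. (1 + t) * \<psi> y)" by (intro poly_intros \<psi>)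
      show "lap (\<lambda>y. (1 + t) * \<psi> y) (X t) < 0"
        using \<psi>(4)[of "X t"] X(1)[of t] r t by (simp add: lap_cmult[OF \<psi>(1)] mult_pos_neg)
    qed (use r Xmax t in auto)
    show "grad u (X t) = (1 + t) *\<^sub>R grad \<psi> (X t)" if t: "t \<in> {0..\<delta>}" for t
    proof -
      have "X t \<in> \<Omega>" using X(1)[of t] r R by auto
      then have "grad u (X t) = grad (\<lambda>y. (1 + t) * \<psi> y) (X t)"
        using Xmax[OF t] r(1) by (intro local_max_grad[of u "X t" _ "r / 2"] u poly_intros \<psi>) auto
      then show ?thesis by (simp add: poly_grad_cmult[OF \<psi>(1)])
    qed
    fix t t' assume t: "t \<in> {0..\<delta>}" "t' \<in> {0..\<delta>}" "t < t'"
    define a where "a = \<psi> (X t) - \<psi> (X t')"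
    define d where "d = u (X t) - u (X t')"
    \<comment> \<open>Each maximiser is tested against the other: (1 + t) a \<le> d \<le> (1 + t')
      a. Hence a \<ge> 0 and a \<le> d, and \<open>X t\<close> misses the maximum for
      \<open>t'\<close> by (1 + t') a - d, which is at most (t' - t) d.\<close>
    have 1: "(1 + t) * a \<le> d"
      using X(2)[OF X(1)[of t'], of t] by (simp add: a_def d_def algebra_simps)
    have 2: "d \<le> (1 + t') * a"
      using X(2)[OF X(1)[of t], of t'] by (simp add: a_def d_def algebra_simps)
    have "0 \<le> (t' - t) * a" using 1 2 by (simp add: algebra_simps)
    then have a: "0 \<le> a" using t by (simp add: zero_le_mult_iff)
    have "a \<le> (1 + t) * a" using a t by (simp add: algebra_simps)
    then have ad: "a \<le> d" using 1 by linarith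
    then show "u (X t') \<le> u (X t)" using a by (simp add: d_def)
    fix y assume y: "y \<in> cball x0 r"
    have "(t' - t) * a \<le> (t' - t) * d" using t ad by (intro mult_left_mono) auto
    moreover have "(1 + t') * a - d \<le> (t' - t) * a" using 1 by (simp add: algebra_simps)
    moreover have "u y - (1 + t') * \<psi> y \<le> u (X t) - (1 + t') * \<psi> (X t) + ((1 + t') * a - d)"
      using X(2)[OF y, of t'] by (simp add: a_def d_def algebra_simps)
    ultimately show "u y - (1 + t') * \<psi> y \<le> u (X t) - (1 + t') * \<psi> (X t) + (t' - t) * (u (X t) - u (X t'))"
      unfolding d_def by linarith
  qed (use r \<delta> g0 \<psi> in auto)
qed

section \<open>Lower bounds for the set of contact values\<close>

text \<open>The optimisation over the step length l: a linear gain \<open>\<tau> * g * l\<close>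
  minus the Hoelder loss is at most \<open>\<tau> * d\<close>. The assumption \<open>small\<close>
  keeps the chosen l within the range r/2.\<close>

lemma powr_le_contact:
  fixes \<tau> g D d p r :: real
  assumes pos: "0 < p" "0 < g" "0 < D" "0 < \<tau>" and small: "\<tau> \<le> 2 * D * (r / 2) powr p / g" "0 < r"
    and ineq: "\<And>l. 0 < l \<Longrightarrow> l \<le> r / 2 \<Longrightarrow> \<tau> * g * l - D * l powr p * l \<le> \<tau> * d"
  shows "\<tau> \<le> 2 * D / (g * (g / 2) powr p) * d powr p"
proof -
  \<comment> \<open>The value of \<open>l powr p\<close> at which the loss is exactly half of the
    gain.\<close>
  define q where "q = \<tau> * g / (2 * D)"
  have q: "q > 0" using pos by (simp add: q_def)
  define l where "l = q powr (1 / p)"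
  have l: "l > 0" "l powr p = q" using q pos by (simp_all add: l_def powr_powr)
  have "q \<le> (r / 2) powr p" using small pos by (simp add: q_def field_simps)
  then have "q powr (1 / p) \<le> ((r / 2) powr p) powr (1 / p)" using q pos by (intro powr_mono2) auto
  then have "l \<le> r / 2" using pos small by (simp add: l_def powr_powr)
  from ineq[OF l(1) this] have "\<tau> * g * l / 2 \<le> \<tau> * d" using pos by (simp add: l(2) q_def field_simps)
  then have "\<tau> * (g * l / 2) \<le> \<tau> * d" by simp
  then have "g * l / 2 \<le> d" using pos by simp
  then have "(g / 2 * l) powr p \<le> d powr p" using pos l by (intro powr_mono2) auto
  then have "(g / 2) powr p * (\<tau> * g / (2 * D)) \<le> d powr p"
    using powr_mult[of "g / 2" l p] pos l by (simp add: q_def)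
  moreover have "(g / 2) powr p > 0" using pos by simp
  ultimately show ?thesis using pos by (simp add: field_simps)
qed

text \<open>The inverse of \<open>f\<close> is Hoelder with exponent \<open>p\<close>, so a covering
  set of diameter d pulls back into an interval of length comparable to d^p. A cheap cover of
  \<open>K\<close> would therefore cover an interval of positive length by intervals of smaller
  total length.\<close>

lemma hoelder_image_null:
  fixes f :: "real \<Rightarrow> real"
  assumes p: "0 < p" and null: "hausdorff_measure p K = 0"
    and K: "\<And>t. t \<in> {0..\<delta>} \<Longrightarrow> f t \<in> K"
    and hol: "\<And>t t'. t \<in> {0..\<delta>} \<Longrightarrow> t' \<in> {0..\<delta>} \<Longrightarrow> \<bar>t - t'\<bar> \<le> B * \<bar>f t - f t'\<bar> powr p"
  shows "\<delta> \<le> 0"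
proof (rule ccontr)
  assume "\<not> \<delta> \<le> 0"
  then have \<delta>: "\<delta> > 0" by simp
  define B' where "B' = max B 1"
  have B': "B' > 0" by (simp add: B'_def)
  \<comment> \<open>The intervals below have total length at most 2 B' \<epsilon> = \<delta>/2,
    which is less than \<delta>.\<close>
  define \<epsilon> where "\<epsilon> = \<delta> / (4 * B')"
  have \<epsilon>: "\<epsilon> > 0" using \<delta> B' by (simp add: \<epsilon>_def)
  have "hausdorff_premeasure p 1 K \<le> hausdorff_measure p K"
    unfolding hausdorff_measure_def by (rule SUP_upper) simp
  then have "hausdorff_premeasure p 1 K < ennreal \<epsilon>" using null \<epsilon> by simp
  then obtain C where C: "K \<subseteq> (\<Union>i. C i)" "\<And>i. bounded (C i)" "(\<Sum>i. ennreal (diameter (C i) powr p)) < ennreal \<epsilon>"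
    unfolding hausdorff_premeasure_def INF_less_iff by auto
  define w where "w i = B' * diameter (C i) powr p" for i
  have w0: "w i \<ge> 0" for i using B' by (simp add: w_def)
  define \<tau> where "\<tau> i = (SOME t. t \<in> {0..\<delta>} \<and> f t \<in> C i)" for i :: nat
  have cover: "{0..\<delta>} \<subseteq> (\<Union>i. {\<tau> i - w i..\<tau> i + w i})"
  proof
    fix t assume t: "t \<in> {0..\<delta>}"
    then obtain i where i: "f t \<in> C i" using K C(1) by blast
    have \<tau>: "\<tau> i \<in> {0..\<delta>} \<and> f (\<tau> i) \<in> C i" unfolding \<tau>_def
      by (rule someI[where x = t and P = "\<lambda>t. t \<in> {0..\<delta>} \<and> f t \<in> C i"]) (use t i in auto)
    have "\<bar>f t - f (\<tau> i)\<bar> \<le> diameter (C i)"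
      using diameter_bounded_bound[OF C(2) i, of "f (\<tau> i)"] \<tau> by (simp add: dist_real_def)
    then have "\<bar>f t - f (\<tau> i)\<bar> powr p \<le> diameter (C i) powr p" using p by (intro powr_mono2) auto
    then have "B' * \<bar>f t - f (\<tau> i)\<bar> powr p \<le> w i" unfolding w_def using B' by simp
    moreover have "B * \<bar>f t - f (\<tau> i)\<bar> powr p \<le> B' * \<bar>f t - f (\<tau> i)\<bar> powr p"
      by (intro mult_right_mono) (auto simp: B'_def)
    ultimately have "\<bar>t - \<tau> i\<bar> \<le> w i" using hol[OF t, of "\<tau> i"] \<tau> by linarith
    then show "t \<in> (\<Union>i. {\<tau> i - w i..\<tau> i + w i})" by (intro UN_I[of i]) auto
  qed
  have "ennreal \<delta> = emeasure lborel {0..\<delta>}" using \<delta> by simp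
  also have "\<dots> \<le> emeasure lborel (\<Union>i. {\<tau> i - w i..\<tau> i + w i})" by (intro emeasure_mono cover) auto
  also have "\<dots> \<le> (\<Sum>i. emeasure lborel {\<tau> i - w i..\<tau> i + w i})"
    by (intro emeasure_subadditive_countably) auto
  also have "\<dots> = (\<Sum>i. ennreal (2 * B') * ennreal (diameter (C i) powr p))"
    using w0 B' by (intro suminf_cong) (simp add: w_def flip: ennreal_mult)
  also have "\<dots> = ennreal (2 * B') * (\<Sum>i. ennreal (diameter (C i) powr p))" by simp
  also have "\<dots> \<le> ennreal (2 * B') * ennreal \<epsilon>" using C(3) by (intro mult_left_mono) auto
  also have "\<dots> = ennreal (\<delta> / 2)" using B' \<epsilon> by (simp add: \<epsilon>_def flip: ennreal_mult)
  finally show False using \<delta> by simp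
qed

lemma poly_grad_lipschitz_cball:
  fixes g :: "'a::euclidean_space \<Rightarrow> real"
  assumes g: "real_polynomial_function g"
  obtains L where "L \<ge> 0" "\<And>x y. x \<in> cball a r \<Longrightarrow> y \<in> cball a r \<Longrightarrow> norm (grad g x - grad g y) \<le> L * norm (x - y)"
proof -
  have "\<exists>L\<ge>0. \<forall>x\<in>cball a r. \<forall>y\<in>cball a r. \<bar>pd e g x - pd e g y\<bar> \<le> L * norm (x - y)" for e
    using poly_lipschitz_cball[OF poly_pd[OF g]] by metis
  then obtain L where L: "\<And>e. L e \<ge> 0"
    "\<And>e x y. x \<in> cball a r \<Longrightarrow> y \<in> cball a r \<Longrightarrow> \<bar>pd e g x - pd e g y\<bar> \<le> L e * norm (x - y)"
    by metis
  show ?thesis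
  proof (rule that[of "\<Sum>e\<in>Basis. L e"])
    fix x y assume xy: "x \<in> cball a r" "y \<in> cball a r"
    have "norm (grad g x - grad g y) \<le> (\<Sum>e\<in>Basis. \<bar>(grad g x - grad g y) \<bullet> e\<bar>)" by (rule norm_le_l1)
    also have "\<dots> \<le> (\<Sum>e\<in>Basis. L e * norm (x - y))"
      by (intro sum_mono) (simp add: inner_diff_left grad_inner_Basis L(2)[OF xy])
    finally show "norm (grad g x - grad g y) \<le> (\<Sum>e\<in>Basis. L e) * norm (x - y)" by (simp add: sum_distrib_right)
  qed (simp add: L sum_nonneg)
qed

text \<open>If the contact values at t < t' agreed, the error term would vanish and
  \<open>X t\<close> would be a local maximum for both parameters. The gradient of \<open>u\<close>
  there would be both (1 + t) and (1 + t') times that of \<psi>, which is nonzero. So an interval of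
  parameters injects into \<open>K\<close>.\<close>

lemma touches_imp_grad_eq_0_countable:
  fixes u :: "'a::euclidean_space \<Rightarrow> real"
  assumes \<Omega>: "open \<Omega>" "x0 \<in> \<Omega>" and u: "\<And>x. x \<in> \<Omega> \<Longrightarrow> (u has_derivative (\<lambda>h. grad u x \<bullet> h)) (at x)"
    and touch: "touches u \<phi> x0"
    and K: "\<And>x \<phi>. x \<in> \<Omega> \<Longrightarrow> touches u \<phi> x \<Longrightarrow> u x \<in> K" "countable K"
  shows "grad u x0 = 0"
proof (rule ccontr)
  assume ne: "grad u x0 \<noteq> 0"
  obtain R where R: "R > 0" "cball x0 R \<subseteq> \<Omega>" using \<Omega> open_contains_cball by blast
  from touching_family[OF u R touch ne] obtain r \<delta> g0 \<psi> X where F: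
    "0 < r" "r \<le> R" "0 < \<delta>" "\<delta> \<le> 1" "0 < g0" "real_polynomial_function \<psi>"
    "\<And>y. y \<in> cball x0 r \<Longrightarrow> g0 \<le> norm (grad \<psi> y)"
    "\<And>t. t \<in> {0..\<delta>} \<Longrightarrow> X t \<in> cball x0 (r / 2)"
    "\<And>t. t \<in> {0..\<delta>} \<Longrightarrow> touches u (\<lambda>y. (1 + t) * \<psi> y) (X t)"
    "\<And>t. t \<in> {0..\<delta>} \<Longrightarrow> grad u (X t) = (1 + t) *\<^sub>R grad \<psi> (X t)"
    "\<And>t t'. t \<in> {0..\<delta>} \<Longrightarrow> t' \<in> {0..\<delta>} \<Longrightarrow> t < t' \<Longrightarrow> u (X t') \<le> u (X t)"
    "\<And>t t' y. t \<in> {0..\<delta>} \<Longrightarrow> t' \<in> {0..\<delta>} \<Longrightarrow> t < t' \<Longrightarrow> y \<in> cball x0 r \<Longrightarrow>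
      u y - (1 + t') * \<psi> y \<le> u (X t) - (1 + t') * \<psi> (X t) + (t' - t) * (u (X t) - u (X t'))"
    by blast
  have X: "X t \<in> cball x0 r" "X t \<in> \<Omega>" if "t \<in> {0..\<delta>}" for t
    using F(8)[OF that] F(1,2) R by auto
  have neq: "u (X t) \<noteq> u (X t')" if t: "t \<in> {0..\<delta>}" "t' \<in> {0..\<delta>}" "t < t'" for t t'
  proof
    assume eq: "u (X t) = u (X t')"
    have "grad u (X t) = grad (\<lambda>y. (1 + t') * \<psi> y) (X t)"
    proof (rule local_max_grad[of u "X t" _ "r / 2", OF u[OF X(2)[OF t(1)]]])
      fix y assume y: "y \<in> ball (X t) (r / 2)"
      have "dist x0 y \<le> dist x0 (X t) + dist (X t) y" by (rule dist_triangle)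
      then have "y \<in> cball x0 r" using F(8)[OF t(1)] y by simp
      from F(12)[OF t this] eq show "u y - (1 + t') * \<psi> y \<le> u (X t) - (1 + t') * \<psi> (X t)" by simp
    qed (use F in \<open>auto intro!: poly_intros\<close>)
    then have "(1 + t) *\<^sub>R grad \<psi> (X t) = (1 + t') *\<^sub>R grad \<psi> (X t)"
      using F(10)[OF t(1)] by (simp add: poly_grad_cmult F(6))
    then have "grad \<psi> (X t) = 0" using t(3) by simp
    then show False using F(7)[OF X(1)[OF t(1)]] F(5) by simp
  qed
  have "inj_on (\<lambda>t. u (X t)) {0..\<delta>}"
    by (rule inj_onI) (metis neq linorder_neq_iff)
  moreover have "(\<lambda>t. u (X t)) ` {0..\<delta>} \<subseteq> K" using K(1) X(2) F(9) by blast
  then have "countable ((\<lambda>t. u (X t)) ` {0..\<delta>})" using K(2) countable_subset by blast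
  ultimately have "countable {0..\<delta>}" by (rule countable_image_inj_on[rotated])
  then show False using uncountable_closed_interval[of 0 \<delta>] F(3) by simp
qed

text \<open>The countable argument made quantitative: an almost maximum with a gradient of size
  about t' - t contradicts a Hoelder gradient unless the error, and with it the gap between the
  contact values, is large enough.\<close>

lemma touches_imp_grad_eq_0_null:
  fixes u :: "'a::euclidean_space \<Rightarrow> real"
  assumes \<Omega>: "open \<Omega>" "x0 \<in> \<Omega>" and u: "\<And>x. x \<in> \<Omega> \<Longrightarrow> (u has_derivative (\<lambda>h. grad u x \<bullet> h)) (at x)"
    and p: "0 < p" "p \<le> 1"
    and hoelder: "\<And>x. x \<in> \<Omega> \<Longrightarrow> \<exists>r>0. \<exists>C. \<forall>y\<in>ball x r \<inter> \<Omega>. \<forall>z\<in>ball x r \<inter> \<Omega>.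
        norm (grad u y - grad u z) \<le> C * dist y z powr p"
    and touch: "touches u \<phi> x0"
    and K: "\<And>x \<phi>. x \<in> \<Omega> \<Longrightarrow> touches u \<phi> x \<Longrightarrow> u x \<in> K" "hausdorff_measure p K = 0"
  shows "grad u x0 = 0"
proof (rule ccontr)
  assume ne: "grad u x0 \<noteq> 0"
  obtain R1 where R1: "R1 > 0" "cball x0 R1 \<subseteq> \<Omega>" using \<Omega> open_contains_cball by blast
  from hoelder[OF \<Omega>(2)] obtain R2 C where R2: "R2 > 0"
    "\<And>y z. y \<in> ball x0 R2 \<inter> \<Omega> \<Longrightarrow> z \<in> ball x0 R2 \<inter> \<Omega> \<Longrightarrow> norm (grad u y - grad u z) \<le> C * dist y z powr p"
    by blast
  \<comment> \<open>The bound 1/2 keeps all distances in the ball at most 1, where |y - z| \<le> |y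
    - z|^p; the Lipschitz gradient of \<psi> is then also Hoelder with exponent
    \<open>p\<close>.\<close>
  define R where "R = min (min R1 (R2 / 2)) (1 / 2)"
  have R: "R > 0" "cball x0 R \<subseteq> \<Omega>" "R < R2" "R \<le> 1 / 2" using R1 R2 by (auto simp: R_def)
  from touching_family[OF u R(1,2) touch ne] obtain r \<delta> g0 \<psi> X where F:
    "0 < r" "r \<le> R" "0 < \<delta>" "\<delta> \<le> 1" "0 < g0" "real_polynomial_function \<psi>"
    "\<And>y. y \<in> cball x0 r \<Longrightarrow> g0 \<le> norm (grad \<psi> y)"
    "\<And>t. t \<in> {0..\<delta>} \<Longrightarrow> X t \<in> cball x0 (r / 2)"
    "\<And>t. t \<in> {0..\<delta>} \<Longrightarrow> touches u (\<lambda>y. (1 + t) * \<psi> y) (X t)"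
    "\<And>t. t \<in> {0..\<delta>} \<Longrightarrow> grad u (X t) = (1 + t) *\<^sub>R grad \<psi> (X t)"
    "\<And>t t'. t \<in> {0..\<delta>} \<Longrightarrow> t' \<in> {0..\<delta>} \<Longrightarrow> t < t' \<Longrightarrow> u (X t') \<le> u (X t)"
    "\<And>t t' y. t \<in> {0..\<delta>} \<Longrightarrow> t' \<in> {0..\<delta>} \<Longrightarrow> t < t' \<Longrightarrow> y \<in> cball x0 r \<Longrightarrow>
      u y - (1 + t') * \<psi> y \<le> u (X t) - (1 + t') * \<psi> (X t) + (t' - t) * (u (X t) - u (X t'))"
    by blast
  obtain L where L: "L \<ge> 0"
    "\<And>x y. x \<in> cball x0 r \<Longrightarrow> y \<in> cball x0 r \<Longrightarrow> norm (grad \<psi> x - grad \<psi> y) \<le> L * norm (x - y)"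
    using poly_grad_lipschitz_cball[OF F(6)] by blast
  \<comment> \<open>The Hoelder constant of the gradient of \<open>u\<close> plus that of (1 + t)
    times the gradient of \<psi>, where 1 + t \<le> 2. The summand 1 makes \<open>D\<close>
    positive.\<close>
  define D where "D = max C 0 + 2 * L + 1"
  have D: "D > 0" using L by (simp add: D_def)
  have sub: "y \<in> \<Omega>" "y \<in> ball x0 R2" if "y \<in> cball x0 r" for y using that F R by auto
  define W where "W t y = grad u y - (1 + t) *\<^sub>R grad \<psi> y" for t y
  have W: "norm (W t y - W t z) \<le> D * norm (y - z) powr p"
    if yz: "y \<in> cball x0 r" "z \<in> cball x0 r" and t: "t \<in> {0..\<delta>}" for t y z
  proof -
    have "norm (y - z) \<le> 1"
      using dist_triangle2[of y z x0] yz F(2) R(4) by (simp add: dist_norm norm_minus_commute)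
    then have "norm (y - z) powr 1 \<le> norm (y - z) powr p" using p by (intro powr_mono') auto
    then have le: "norm (y - z) \<le> norm (y - z) powr p" by simp
    have "W t y - W t z = (grad u y - grad u z) - (1 + t) *\<^sub>R (grad \<psi> y - grad \<psi> z)"
      by (simp add: W_def algebra_simps)
    then have "norm (W t y - W t z) \<le> norm (grad u y - grad u z) + norm ((1 + t) *\<^sub>R (grad \<psi> y - grad \<psi> z))"
      by (metis norm_triangle_ineq4)
    also have "norm ((1 + t) *\<^sub>R (grad \<psi> y - grad \<psi> z)) \<le> 2 * (L * norm (y - z))"
      unfolding norm_scaleR using t F(4) L(2)[OF yz] by (intro mult_mono) auto
    also have "\<dots> \<le> 2 * L * norm (y - z) powr p" using le L(1) by (simp add: mult_left_mono)
    also have "norm (grad u y - grad u z) \<le> C * norm (y - z) powr p"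
      using R2(2)[of y z] sub yz by (simp add: dist_norm)
    also have "\<dots> \<le> max C 0 * norm (y - z) powr p" by (intro mult_right_mono) auto
    finally have "norm (W t y - W t z) \<le> max C 0 * norm (y - z) powr p + 2 * L * norm (y - z) powr p" by simp
    also have "\<dots> \<le> D * norm (y - z) powr p" by (simp add: D_def distrib_right)
    finally show ?thesis .
  qed
  define \<delta>' where "\<delta>' = min \<delta> (2 * D * (r / 2) powr p / g0)"
  have \<delta>': "\<delta>' > 0" "\<delta>' \<le> \<delta>" using F D by (auto simp: \<delta>'_def)
  define B where "B = 2 * D / (g0 * (g0 / 2) powr p)"
  have main: "t' - t \<le> B * (u (X t) - u (X t')) powr p"
    if t: "t \<in> {0..\<delta>'}" "t' \<in> {0..\<delta>'}" "t < t'" for t t'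
    unfolding B_def
  proof (rule powr_le_contact[OF p(1) F(5) D _ _ F(1)])
    show "0 < t' - t" using t by simp
    show "t' - t \<le> 2 * D * (r / 2) powr p / g0" using t by (auto simp: \<delta>'_def)
    fix l :: real assume l: "0 < l" "l \<le> r / 2"
    have t\<delta>: "t \<in> {0..\<delta>}" "t' \<in> {0..\<delta>}" using t \<delta>' by auto
    define x where "x = X t"
    define v where "v = grad \<psi> x"
    have x: "x \<in> cball x0 (r / 2)" using F(8)[OF t\<delta>(1)] by (simp add: x_def)
    have v: "g0 \<le> norm v" "norm v > 0" using F(7)[of x] x F(1,5) by (auto simp: v_def)
    \<comment> \<open>A step of length \<open>l\<close> against the gradient of \<psi>. Since
      \<open>W t' x = - ((t' - t) *\<^sub>R v)\<close>, this is the direction of steepest ascent for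
      u - (1 + t') \<psi>.\<close>
    define h where "h = - ((l / norm v) *\<^sub>R v)"
    have nh: "norm h = l" using v l by (simp add: h_def)
    have seg: "x + s *\<^sub>R h \<in> cball x0 r" if "s \<in> {0..1}" for s
    proof -
      have "dist x0 (x + s *\<^sub>R h) \<le> dist x0 x + dist x (x + s *\<^sub>R h)" by (rule dist_triangle)
      also have "dist x (x + s *\<^sub>R h) = \<bar>s\<bar> * l" by (simp add: dist_norm nh)
      also have "\<dots> \<le> 1 * l" using that l by (intro mult_right_mono) auto
      also have "\<dots> \<le> r / 2" using l by simp
      finally show ?thesis using x by simp
    qed
    define w where "w s = u (x + s *\<^sub>R h) - (1 + t') * \<psi> (x + s *\<^sub>R h)" for s
    have dw: "(w has_derivative (\<lambda>k. W t' (x + s *\<^sub>R h) \<bullet> (k *\<^sub>R h))) (at s within {0..1})"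
      if s: "0 \<le> s" "s \<le> 1" for s
    proof -
      define z where "z = x + s *\<^sub>R h"
      have "z \<in> \<Omega>" using seg[of s] s sub by (simp add: z_def)
      then have "((\<lambda>y. u y - (1 + t') * \<psi> y) has_derivative (\<lambda>h. grad u z \<bullet> h - (1 + t') * (grad \<psi> z \<bullet> h))) (at z)"
        by (intro has_derivative_diff has_derivative_mult_right u poly_has_grad F(6))
      then have d: "((\<lambda>y. u y - (1 + t') * \<psi> y) has_derivative (\<lambda>h. W t' z \<bullet> h)) (at z)"
        by (simp add: W_def inner_diff_left)
      have "((\<lambda>s. x + s *\<^sub>R h) has_derivative (\<lambda>k. k *\<^sub>R h)) (at s)"
        by (auto intro!: derivative_eq_intros)
      from has_derivative_compose[OF this d[unfolded z_def]] show ?thesis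
        unfolding w_def[abs_def] by (rule has_derivative_at_withinI)
    qed
    obtain s where s: "s \<in> {0<..<1}" "w 1 - w 0 = W t' (x + s *\<^sub>R h) \<bullet> ((1 - 0) *\<^sub>R h)"
      using mvt_simple[of 0 1 w, OF _ dw] by auto
    have Wx: "W t' x = - ((t' - t) *\<^sub>R v)"
      using F(10)[OF t\<delta>(1)] by (simp add: W_def x_def v_def algebra_simps)
    have "W t' x \<bullet> h = (t' - t) * l * norm v"
      using v(2) by (simp add: Wx h_def dot_square_norm power2_eq_square)
    then have 1: "(t' - t) * g0 * l \<le> W t' x \<bullet> h"
      using v(1) l t(3) by (simp add: mult.assoc mult.commute[of l] mult_left_mono mult_right_mono)
    have "norm (W t' (x + s *\<^sub>R h) - W t' x) \<le> D * norm (s *\<^sub>R h) powr p"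
      using W[OF seg[of s] seg[of 0] t\<delta>(2)] s(1) by simp
    also have "\<dots> \<le> D * l powr p"
      using D l s(1) p nh by (intro mult_left_mono powr_mono2) (auto simp: mult_left_le_one_le)
    finally have "norm (W t' (x + s *\<^sub>R h) - W t' x) * norm h \<le> D * l powr p * l"
      using l nh by (simp add: mult_right_mono)
    then have 2: "\<bar>(W t' (x + s *\<^sub>R h) - W t' x) \<bullet> h\<bar> \<le> D * l powr p * l"
      using Cauchy_Schwarz_ineq2 order_trans by blast
    have "w 1 - w 0 \<le> (t' - t) * (u (X t) - u (X t'))"
      using F(12)[OF t\<delta> t(3) seg[of 1]] by (simp add: w_def x_def)
    moreover have "w 1 - w 0 = W t' x \<bullet> h + (W t' (x + s *\<^sub>R h) - W t' x) \<bullet> h"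
      using s(2) by (simp add: inner_diff_left)
    ultimately show "(t' - t) * g0 * l - D * l powr p * l \<le> (t' - t) * (u (X t) - u (X t'))"
      using 1 2 by linarith
  qed
  have B: "B \<ge> 0" using D F(5) by (simp add: B_def)
  have mono: "0 \<le> u (X t) - u (X t')" if t: "t \<in> {0..\<delta>'}" "t' \<in> {0..\<delta>'}" "t < t'" for t t'
    using F(11)[of t t'] t \<delta>'(2) by auto
  have "\<delta>' \<le> 0"
  proof (rule hoelder_image_null[OF p(1) K(2), of \<delta>' "\<lambda>t. u (X t)" B])
    show "u (X t) \<in> K" if "t \<in> {0..\<delta>'}" for t
    proof -
      have t: "t \<in> {0..\<delta>}" using that \<delta>' by auto
      then have "X t \<in> \<Omega>" using F(8)[OF t] F(1) by (intro sub) auto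
      then show ?thesis using F(9)[OF t] by (rule K(1))
    qed
    show "\<bar>t - t'\<bar> \<le> B * \<bar>u (X t) - u (X t')\<bar> powr p" if "t \<in> {0..\<delta>'}" "t' \<in> {0..\<delta>'}" for t t'
      using main[OF that] main[OF that(2,1)] mono[OF that] mono[OF that(2,1)] B
      by (cases t t' rule: linorder_cases) (auto simp: abs_minus_commute)
  qed
  with \<delta>' show False by simp
qed

text \<open>
  Tilting the test function by \<open>- t a\<close>, where \<open>a\<close> is the gradient of the partial derivative \<open>pd e \<psi>\<close>
  and \<open>pd e (pd e \<psi>) x0 < 0\<close>, moves the contact point in a direction in which \<open>pd e \<psi>\<close> does not
  decrease to first order, whereas a vanishing gradient of \<open>u\<close> forces it to decrease.
\<close>

lemma not_touches_if_grad_eq_0: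
  fixes u :: "'a::euclidean_space \<Rightarrow> real"
  assumes \<Omega>: "open \<Omega>" "x0 \<in> \<Omega>" and u: "\<And>x. x \<in> \<Omega> \<Longrightarrow> (u has_derivative (\<lambda>h. grad u x \<bullet> h)) (at x)"
    and zero: "\<And>x \<phi>. x \<in> \<Omega> \<Longrightarrow> touches u \<phi> x \<Longrightarrow> grad u x = 0"
  shows "\<not> touches u \<phi> x0"
proof
  assume touch: "touches u \<phi> x0"
  then obtain \<psi> \<eta> r where \<psi>: "real_polynomial_function \<psi>" "0 < \<eta>" "0 < r"
    "\<And>y. y \<in> ball x0 r \<Longrightarrow> lap \<psi> y < 0"
    "\<And>y. y \<in> ball x0 r \<Longrightarrow> u y - \<psi> y \<le> u x0 - \<psi> x0 - \<eta> * (norm (y - x0))\<^sup>2"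
    using touches_strict by blast
  have "grad u x0 = grad \<psi> x0"
  proof (rule local_max_grad[OF u[OF \<Omega>(2)] \<psi>(1,3)])
    fix y assume "y \<in> ball x0 r"
    from \<psi>(5)[OF this] show "u y - \<psi> y \<le> u x0 - \<psi> x0"
      using \<psi>(2) by (smt (verit) mult_nonneg_nonneg zero_le_power2)
  qed
  then have g0: "grad \<psi> x0 = 0" using zero[OF \<Omega>(2) touch] by simp
  have "lap \<psi> x0 < 0" using \<psi> by simp
  then obtain e where e: "e \<in> Basis" "pd e (pd e \<psi>) x0 < 0"
    unfolding lap_def by (meson not_less sum_nonneg)
  define f where "f = pd e \<psi>"
  have f: "real_polynomial_function f" unfolding f_def by (intro poly_pd \<psi>)
  have f0: "f x0 = 0" using g0 grad_inner_Basis[OF e(1), of \<psi> x0] by (simp add: f_def)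
  define a where "a = grad f x0"
  define c where "c = - pd e f x0"
  have c: "c > 0" using e(2) by (simp add: c_def f_def)
  have ae: "a \<bullet> e = - c" using grad_inner_Basis[OF e(1)] by (simp add: a_def c_def)
  have a: "norm a > 0" using ae c by auto
  \<comment> \<open>Chosen so that the linearisation error of \<open>f\<close>, over the
    displacement t |a| / \<eta> of the contact point, is t c / 2: half of the drop t c that a
    vanishing gradient of \<open>u\<close> enforces.\<close>
  define \<epsilon> where "\<epsilon> = c * \<eta> / (2 * norm a)"
  have \<epsilon>: "\<epsilon> > 0" using c a \<psi> by (simp add: \<epsilon>_def)
  obtain d where d: "d > 0" "\<And>y. norm (y - x0) < d \<Longrightarrow> \<bar>f y - a \<bullet> (y - x0)\<bar> \<le> \<epsilon> * norm (y - x0)"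
    using poly_has_grad[OF f, of x0] \<epsilon> f0 unfolding has_derivative_at_alt a_def by (metis diff_zero real_norm_def)
  obtain s where s: "s > 0" "cball x0 s \<subseteq> \<Omega>" using \<Omega> open_contains_cball by blast
  define \<rho> where "\<rho> = min s (r / 2)"
  have \<rho>: "\<rho> > 0" "cball x0 \<rho> \<subseteq> \<Omega>" "\<rho> < r" using s \<psi> by (auto simp: \<rho>_def)
  \<comment> \<open>The contact point moves by at most t |a| / \<eta>, which this choice makes half
    of min \<rho> d: inside the ball of maximisation and inside the range of the
    linearisation.\<close>
  define t where "t = min \<rho> d * \<eta> / (2 * norm a)"
  have t: "t > 0" "t * norm a / \<eta> < \<rho>" "t * norm a / \<eta> < d"
    using \<rho> d a \<psi>(2) by (auto simp: t_def)
  define \<phi>t where "\<phi>t = (\<lambda>y. \<psi> y - t * (a \<bullet> y))"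
  have \<phi>t: "real_polynomial_function \<phi>t" unfolding \<phi>t_def by (intro poly_intros \<psi>)
  have cu: "continuous_on (cball x0 \<rho>) u"
    using \<rho>(2) u by (meson continuous_at_imp_continuous_on has_derivative_continuous subsetD)
  have "\<exists>X\<in>cball x0 \<rho>. \<forall>y\<in>cball x0 \<rho>. u y - \<phi>t y \<le> u X - \<phi>t X"
    using \<rho>(1) by (intro continuous_attains_sup continuous_on_diff cu poly_continuous_on[OF \<phi>t]) auto
  then obtain X where X: "X \<in> cball x0 \<rho>" "\<And>y. y \<in> cball x0 \<rho> \<Longrightarrow> u y - \<phi>t y \<le> u X - \<phi>t X" by blast
  have XX: "X \<in> ball x0 r" "X \<in> \<Omega>" using X \<rho> by auto
  have ineq: "\<eta> * (norm (X - x0))\<^sup>2 \<le> t * (a \<bullet> (X - x0))"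
    using X(2)[of x0] \<psi>(5)[OF XX(1)] \<rho>(1) by (simp add: \<phi>t_def inner_diff_right algebra_simps)
  note ineq
  also have "t * (a \<bullet> (X - x0)) \<le> t * (norm a * norm (X - x0))"
    using t(1) by (intro mult_left_mono norm_cauchy_schwarz) auto
  finally have "\<eta> * norm (X - x0) * norm (X - x0) \<le> t * norm a * norm (X - x0)"
    by (simp only: power2_eq_square mult.assoc)
  then have "\<eta> * norm (X - x0) \<le> t * norm a"
    using t(1) a by (cases "norm (X - x0) = 0") (auto simp: mult_le_cancel_right)
  then have small: "norm (X - x0) \<le> t * norm a / \<eta>" using \<psi>(2) by (simp add: field_simps)
  have "a \<bullet> (X - x0) \<ge> 0"
    using ineq \<psi>(2) t(1) by (smt (verit) mult_nonneg_nonneg zero_le_mult_iff zero_le_power2)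
  moreover have "\<bar>f X - a \<bullet> (X - x0)\<bar> \<le> \<epsilon> * norm (X - x0)" using small t by (intro d) auto
  moreover have "\<epsilon> * norm (X - x0) \<le> \<epsilon> * (t * norm a / \<eta>)" using \<epsilon> small by (intro mult_left_mono) auto
  moreover have "\<epsilon> * (t * norm a / \<eta>) = t * c / 2" using a \<psi>(2) by (simp add: \<epsilon>_def)
  ultimately have fX: "f X \<ge> - (t * c / 2)" by linarith
  have max: "u y - \<phi>t y \<le> u X - \<phi>t X" if "y \<in> ball X (\<rho> - norm (X - x0))" for y
  proof (rule X(2))
    have "dist x0 y \<le> dist x0 X + dist X y" by (rule dist_triangle)
    then show "y \<in> cball x0 \<rho>" using that by (simp add: dist_norm norm_minus_commute)
  qed
  have pos: "\<rho> - norm (X - x0) > 0" using small t by simp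
  have "touches u \<phi>t X"
    unfolding touches_def
  proof (intro conjI exI[of _ "\<rho> - norm (X - x0)"] ballI)
    show "lap \<phi>t X < 0"
      unfolding \<phi>t_def using \<psi>(4)[OF XX(1)]
      by (subst lap_diff) (auto simp: lap_cmult poly_inner' intro!: poly_intros \<psi>)
  qed (use \<phi>t pos max in auto)
  then have "grad \<phi>t X = 0"
    using zero[OF XX(2)] local_max_grad[OF u[OF XX(2)] \<phi>t pos max] by simp
  then have "pd e \<phi>t X = 0" using grad_inner_Basis[OF e(1), of \<phi>t X] by simp
  \<comment> \<open>Here a \<bullet> e = - c, so the value is - t c, below the lower bound - t c / 2
    found above.\<close>
  then have "f X = t * (a \<bullet> e)"
    unfolding \<phi>t_def f_def by (subst (asm) pd_diff) (auto simp: pd_cmult poly_inner' intro!: poly_intros \<psi>)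
  with fX ae c t(1) show False by simp
qed

section \<open>Removability\<close>

text \<open>The comparison is made on every concentric ball of radius R \<rho>, since each spherical
  mean must be bounded below before \<open>poly_mean_ge\<close> can combine them.\<close>

lemma not_touches_mean_ge:
  fixes u :: "'a::euclidean_space \<Rightarrow> real"
  assumes R: "R > 0" and u: "continuous_on (cball x0 R) u"
    and nt: "\<And>x \<phi>. x \<in> ball x0 R \<Longrightarrow> \<not> touches u \<phi> x"
  shows "u x0 \<le> (LINT y:cball x0 R|lborel. u y) / measure lborel (cball x0 R)"
proof -
  define v where "v = (\<lambda>y. u (x0 + R *\<^sub>R y))"
  have mem: "x0 + R *\<^sub>R y \<in> cball x0 R" if "norm y \<le> 1" for y
    using that R by (simp add: dist_norm mult_left_le)
  have v: "continuous_on (cball 0 1) v" unfolding v_def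
    by (rule continuous_on_compose2[OF u]) (use mem in \<open>auto intro!: continuous_intros\<close>)
  have "v 0 * ball_vol TYPE('a) \<le> ball_int v + \<epsilon>" if \<epsilon>': "\<epsilon> > 0" for \<epsilon>
  proof -
    \<comment> \<open>The approximation by \<open>P\<close> is paid for twice, once on the spheres
      and once in the solid mean, each time multiplied by the volume of the ball.\<close>
    define \<epsilon>' where "\<epsilon>' = \<epsilon> / (2 * ball_vol TYPE('a))"
    have \<epsilon>: "\<epsilon>' > 0" using \<epsilon>' by (simp add: \<epsilon>'_def)
    obtain P where P: "real_polynomial_function P" "\<And>y. y \<in> cball 0 1 \<Longrightarrow> \<bar>v y - P y\<bar> < \<epsilon>'"
      using Stone_Weierstrass_real_polynomial_function[OF _ v \<epsilon>] by (metis compact_cball)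
    have "(v 0 - \<epsilon>') * ball_vol TYPE('a) \<le> ball_int P"
    proof (rule poly_mean_ge[OF P(1)])
      fix \<rho> h assume \<rho>: "0 < \<rho>" "\<rho> \<le> 1" and h: "real_polynomial_function h" "lap h = (\<lambda>x. 0)"
        and hP: "\<And>x. norm x = 1 \<Longrightarrow> h x = P (\<rho> *\<^sub>R x)"
      have scaled: "norm (\<rho> *\<^sub>R y) \<le> 1" if "norm y \<le> 1" for y :: 'a
        using that \<rho> by (simp add: mult_le_one)
      have "v 0 - h 0 \<le> \<epsilon>' + \<kappa>" if \<kappa>: "\<kappa> > 0" for \<kappa>
      proof -
        \<comment> \<open>The harmonic extension is made strictly superharmonic, so that it counts
          as a test function and an interior maximum is excluded. On the sphere the cost is exactly
          \<kappa>, which then tends to 0.\<close>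
        define g where "g = (\<lambda>y. h y - \<kappa> * (y \<bullet> y))"
        have g: "real_polynomial_function g" unfolding g_def by (intro poly_intros h)
        have lg: "lap g y = - (2 * real DIM('a) * \<kappa>)" for y unfolding g_def
          by (subst lap_diff) (auto simp: lap_cmult poly_sqnorm h intro!: poly_intros h)
        have cv: "continuous_on (cball 0 1) (\<lambda>y. v (\<rho> *\<^sub>R y))"
          by (rule continuous_on_compose2[OF v]) (use scaled in \<open>auto intro!: continuous_intros\<close>)
        have "\<exists>z\<in>cball 0 1. \<forall>y\<in>cball 0 1. v (\<rho> *\<^sub>R y) - g y \<le> v (\<rho> *\<^sub>R z) - g z"
          by (intro continuous_attains_sup continuous_on_diff cv poly_continuous_on[OF g]) auto
        then obtain z where z: "norm z \<le> 1" "\<And>y. norm y \<le> 1 \<Longrightarrow> v (\<rho> *\<^sub>R y) - g y \<le> v (\<rho> *\<^sub>R z) - g z" by auto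
        have z1: "norm z = 1"
        proof (rule ccontr)
          assume "norm z \<noteq> 1"
          then have z': "norm z < 1" using z(1) by simp
          define c where "c = inverse (R * \<rho>)"
          have c: "c > 0" using R \<rho> by (simp add: c_def)
          \<comment> \<open>\<open>g\<close> transported back by the inverse of the scaling y
            \<mapsto> x0 + R \<rho> y; the positive factor c^2 preserves the sign of the
            Laplacian.\<close>
          define \<phi> where "\<phi> = (\<lambda>x. g (- (c *\<^sub>R x0) + c *\<^sub>R x))"
          define x where "x = x0 + (R * \<rho>) *\<^sub>R z"
          have x: "- (c *\<^sub>R x0) + c *\<^sub>R x = z" using R \<rho> by (simp add: x_def c_def algebra_simps)
          have "touches u \<phi> x" unfolding touches_def
          proof (intro conjI exI[of _ "(1 - norm z) / c"] ballI)
            show "real_polynomial_function \<phi>" unfolding \<phi>_def by (intro poly_scale g)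
            show "lap \<phi> x < 0" unfolding \<phi>_def lap_scale[OF g] lg using c \<kappa>
              by (simp add: mult_pos_neg)
            show "0 < (1 - norm z) / c" using z' c by simp
            fix y assume y: "y \<in> ball x ((1 - norm z) / c)"
            define y' where "y' = - (c *\<^sub>R x0) + c *\<^sub>R y"
            have "y' - z = c *\<^sub>R (y - x)" unfolding y'_def x[symmetric] by (simp add: algebra_simps)
            then have "norm (y' - z) = c * norm (y - x)" using c by simp
            also have "\<dots> < 1 - norm z" using y c by (simp add: dist_norm norm_minus_commute field_simps)
            finally have "norm y' \<le> 1" using norm_triangle_ineq2[of y' z] by linarith
            from z(2)[OF this] have "v (\<rho> *\<^sub>R y') - g y' \<le> v (\<rho> *\<^sub>R z) - g z" .
            moreover have "x0 + (R * \<rho>) *\<^sub>R y' = y" using R \<rho> by (simp add: y'_def c_def algebra_simps)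
            ultimately show "u y - \<phi> y \<le> u x - \<phi> x"
              unfolding \<phi>_def x by (simp add: v_def x_def y'_def)
          qed
          moreover have "x \<in> ball x0 R"
          proof -
            have "norm ((R * \<rho>) *\<^sub>R z) = R * (\<rho> * norm z)" using R \<rho> by simp
            also have "\<rho> * norm z \<le> norm z" using \<rho> by (simp add: mult_left_le_one_le)
            finally have "norm ((R * \<rho>) *\<^sub>R z) \<le> R * norm z" using R by simp
            also have "\<dots> < R" using z' R by simp
            finally show ?thesis by (simp add: x_def dist_norm)
          qed
          ultimately show False using nt by blast
        qed
        have "v 0 - h 0 \<le> v (\<rho> *\<^sub>R z) - g z" using z(2)[of 0] by (simp add: g_def)
        also have "\<dots> = v (\<rho> *\<^sub>R z) - P (\<rho> *\<^sub>R z) + \<kappa>" using z1 hP[OF z1] by (simp add: g_def dot_square_norm)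
        also have "v (\<rho> *\<^sub>R z) - P (\<rho> *\<^sub>R z) \<le> \<epsilon>'" using P(2)[of "\<rho> *\<^sub>R z"] scaled[OF z(1)] by simp
        finally show ?thesis by simp
      qed
      then have "v 0 - h 0 \<le> \<epsilon>'" by (rule field_le_epsilon)
      then show "v 0 - \<epsilon>' \<le> h 0" by simp
    qed
    also have "ball_int P \<le> ball_int (\<lambda>y. v y + \<epsilon>')"
    proof (rule set_integral_mono)
      show "set_integrable lborel (cball 0 1) P" by (intro poly_set_integrable P)
      show "set_integrable lborel (cball 0 1) (\<lambda>y. v y + \<epsilon>')"
        by (intro set_integrable_cball continuous_intros v)
      show "P y \<le> v y + \<epsilon>'" if "y \<in> cball 0 1" for y using P(2)[OF that] by simp
    qed
    also have "\<dots> = ball_int v + ball_int (\<lambda>y::'a. \<epsilon>')"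
      by (rule set_integral_add(2)) (intro set_integrable_cball continuous_intros v)+
    also have "\<dots> = ball_int v + \<epsilon>' * ball_vol TYPE('a)" by (simp add: ball_int_const)
    finally have "v 0 * ball_vol TYPE('a) \<le> ball_int v + 2 * \<epsilon>' * ball_vol TYPE('a)"
      by (simp add: algebra_simps)
    then show ?thesis by (simp add: \<epsilon>'_def)
  qed
  then have "v 0 * ball_vol TYPE('a) \<le> ball_int v" by (rule field_le_epsilon)
  then have "v 0 \<le> ball_int v / ball_vol TYPE('a)" by (simp add: pos_le_divide_eq)
  then show ?thesis unfolding mean_cball_scale[OF R u] by (simp add: v_def)
qed

lemma continuous_on_upper_semicontinuous_on:
  "continuous_on U u \<Longrightarrow> upper_semicontinuous_on U u"
  unfolding continuous_on_def upper_semicontinuous_on_def by (metis order_tendstoD(2))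

lemma subharmonic_on_extension:
  fixes u :: "'a::euclidean_space \<Rightarrow> real"
  assumes \<Omega>: "open \<Omega>" and u: "C1_on \<Omega> u"
    and zero: "\<And>x \<phi>. x \<in> \<Omega> \<Longrightarrow> touches u \<phi> x \<Longrightarrow> grad u x = 0"
  shows "subharmonic_on \<Omega> u"
  unfolding subharmonic_on_def
proof (intro conjI allI impI)
  have cu: "continuous_on \<Omega> u" by (rule C1_on_continuous_on[OF u])
  then show "upper_semicontinuous_on \<Omega> u" by (rule continuous_on_upper_semicontinuous_on)
  fix x and r :: real assume r: "0 < r" "cball x r \<subseteq> \<Omega>"
  have cr: "continuous_on (cball x r) u" using cu r(2) by (rule continuous_on_subset)
  then show "set_integrable lborel (cball x r) u" by (rule set_integrable_cball)
  show "u x \<le> (LINT y:cball x r|lborel. u y) / measure lborel (cball x r)"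
  proof (rule not_touches_mean_ge[OF r(1) cr])
    fix y \<phi> assume "y \<in> ball x r"
    then have "y \<in> \<Omega>" using r(2) by auto
    show "\<not> touches u \<phi> y"
      by (rule not_touches_if_grad_eq_0[OF \<Omega> \<open>y \<in> \<Omega>\<close>]) (fact C1_on_has_grad[OF u] zero)+
  qed
qed

lemma contact_value_in_image:
  assumes u: "C1_on \<Omega> u" and V: "open V" "\<Omega> - E \<subseteq> V" "V \<subseteq> \<Omega>" "subharmonic_on V u"
    and x: "x \<in> \<Omega>" "touches u \<phi> x"
  shows "u x \<in> u ` E"
proof -
  have "continuous_on V u" using C1_on_continuous_on[OF u] V(3) by (rule continuous_on_subset)
  then have "x \<notin> V" using subharmonic_not_touches[OF V(4) _ V(1)] x(2) by blast
  then show ?thesis using V(2) x(1) by blast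
qed

text \<open>Stated for the sum of absolute increments because this dominates both the norm of a
  gradient increment and the increment of a sum.\<close>

lemma locally_Hoelder_on_sum_abs:
  assumes "finite B" "\<And>e. e \<in> B \<Longrightarrow> locally_Hoelder_on p \<Omega> (g e)" "x \<in> \<Omega>"
  shows "\<exists>r>0. \<exists>C. \<forall>y\<in>ball x r \<inter> \<Omega>. \<forall>z\<in>ball x r \<inter> \<Omega>. (\<Sum>e\<in>B. \<bar>g e y - g e z\<bar>) \<le> C * dist y z powr p"
  using assms(1,2)
proof (induction rule: finite_induct)
  case empty
  then show ?case by (intro exI[of _ 1] conjI exI[of _ 0]) auto
next
  case (insert e B)
  have "\<exists>r>0. \<exists>C. \<forall>y\<in>ball x r \<inter> \<Omega>. \<forall>z\<in>ball x r \<inter> \<Omega>. (\<Sum>e\<in>B. \<bar>g e y - g e z\<bar>) \<le> C * dist y z powr p"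
    by (rule insert.IH) (simp add: insert.prems)
  then obtain r C where r: "r > 0" "\<And>y z. y \<in> ball x r \<inter> \<Omega> \<Longrightarrow> z \<in> ball x r \<inter> \<Omega> \<Longrightarrow>
      (\<Sum>e\<in>B. \<bar>g e y - g e z\<bar>) \<le> C * dist y z powr p" by metis
  from insert.prems[of e] assms(3) obtain r' C' where r': "r' > 0"
    "\<And>y z. y \<in> ball x r' \<inter> \<Omega> \<Longrightarrow> z \<in> ball x r' \<inter> \<Omega> \<Longrightarrow> \<bar>g e y - g e z\<bar> \<le> C' * dist y z powr p"
    unfolding locally_Hoelder_on_def by (metis insertI1)
  show ?case
  proof (rule exI[of _ "min r r'"], intro conjI exI[of _ "C' + C"] ballI)
    fix y z assume "y \<in> ball x (min r r') \<inter> \<Omega>" "z \<in> ball x (min r r') \<inter> \<Omega>"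
    then show "(\<Sum>e\<in>insert e B. \<bar>g e y - g e z\<bar>) \<le> (C' + C) * dist y z powr p"
      using r(2)[of y z] r'(2)[of y z] insert.hyps by (simp add: distrib_right)
  qed (use r r' in auto)
qed

lemma C1p_on_grad_hoelder:
  assumes "C1p_on p \<Omega> u" "x \<in> \<Omega>"
  shows "\<exists>r>0. \<exists>C. \<forall>y\<in>ball x r \<inter> \<Omega>. \<forall>z\<in>ball x r \<inter> \<Omega>. norm (grad u y - grad u z) \<le> C * dist y z powr p"
proof -
  have "norm (grad u y - grad u z) \<le> (\<Sum>e\<in>Basis. \<bar>pd e u y - pd e u z\<bar>)" for y z
    by (rule order_trans[OF norm_le_l1]) (simp add: inner_diff_left grad_inner_Basis)
  moreover have "\<exists>r>0. \<exists>C. \<forall>y\<in>ball x r \<inter> \<Omega>. \<forall>z\<in>ball x r \<inter> \<Omega>.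
      (\<Sum>e\<in>Basis. \<bar>pd e u y - pd e u z\<bar>) \<le> C * dist y z powr p"
    using assms by (intro locally_Hoelder_on_sum_abs) (auto simp: C1p_on_def pd_def[abs_def])
  ultimately show ?thesis by (meson order_trans)
qed

lemma subharmonic_on_extension_null:
  fixes u :: "'a::euclidean_space \<Rightarrow> real"
  assumes p: "0 < p" "p \<le> 1" and \<Omega>: "open \<Omega>" and u: "C1p_on p \<Omega> u"
    and V: "open V" "\<Omega> - E \<subseteq> V" "V \<subseteq> \<Omega>" "subharmonic_on V u"
    and E: "hausdorff_measure p (u ` E) = 0"
  shows "subharmonic_on \<Omega> u"
proof -
  have C1: "C1_on \<Omega> u" using u by (simp add: C1p_on_def)
  show ?thesis
  proof (rule subharmonic_on_extension[OF \<Omega> C1])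
    fix x \<phi> assume x: "x \<in> \<Omega>" "touches u \<phi> x"
    show "grad u x = 0"
      by (rule touches_imp_grad_eq_0_null[OF \<Omega> x(1) _ p _ x(2) _ E])
        (rule C1_on_has_grad[OF C1] C1p_on_grad_hoelder[OF u] contact_value_in_image[OF C1 V]; assumption)+
  qed
qed

lemma subharmonic_on_extension_countable:
  fixes u :: "'a::euclidean_space \<Rightarrow> real"
  assumes \<Omega>: "open \<Omega>" and u: "C1_on \<Omega> u"
    and V: "open V" "\<Omega> - E \<subseteq> V" "V \<subseteq> \<Omega>" "subharmonic_on V u" and E: "countable (u ` E)"
  shows "subharmonic_on \<Omega> u"
proof (rule subharmonic_on_extension[OF \<Omega> u])
  fix x \<phi> assume x: "x \<in> \<Omega>" "touches u \<phi> x"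
  show "grad u x = 0"
    by (rule touches_imp_grad_eq_0_countable[OF \<Omega> x(1) _ x(2) _ E])
      (rule C1_on_has_grad[OF u] contact_value_in_image[OF u V]; assumption)+
qed

section \<open>Restriction along affine maps and the plurisubharmonic case\<close>

lemma has_grad_affine:
  fixes T :: "'b::euclidean_space \<Rightarrow> 'a::euclidean_space"
  assumes "(u has_derivative (\<lambda>h. grad u (a + T z) \<bullet> h)) (at (a + T z))" and T: "bounded_linear T"
  shows "((\<lambda>z. u (a + T z)) has_derivative (\<lambda>h. grad u (a + T z) \<bullet> T h)) (at z)"
proof -
  have "((\<lambda>z. a + T z) has_derivative T) (at z)"
    using bounded_linear_imp_has_derivative[OF T] by (auto intro!: derivative_eq_intros)
  from has_derivative_compose[OF this assms(1)] show ?thesis .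
qed

lemma frechet_derivative_affine:
  fixes T :: "'b::euclidean_space \<Rightarrow> 'a::euclidean_space"
  assumes "C1_on \<Omega> u" "bounded_linear T" "a + T z \<in> \<Omega>"
  shows "frechet_derivative (\<lambda>z. u (a + T z)) (at z) e =
    (\<Sum>b\<in>Basis. (T e \<bullet> b) * frechet_derivative u (at (a + T z)) b)"
proof -
  have "pd e (\<lambda>z. u (a + T z)) z = grad u (a + T z) \<bullet> T e"
    by (rule pd_eqI[OF has_grad_affine[OF C1_on_has_grad[OF assms(1,3)] assms(2)]])
  also have "\<dots> = (\<Sum>b\<in>Basis. (T e \<bullet> b) * pd b u (a + T z))"
    by (subst inner_commute) (simp add: grad_def inner_sum_right mult.commute)
  finally show ?thesis by (simp add: pd_def)
qed

text \<open>The case in view is the complex line through \<open>a\<close> in direction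
  \<open>b\<close>, including the degenerate line b = 0. Partial derivatives of the restriction are
  constant combinations of those of \<open>u\<close>.\<close>

lemma C1_on_affine:
  fixes T :: "'b::euclidean_space \<Rightarrow> 'a::euclidean_space"
  assumes u: "C1_on \<Omega> u" and T: "bounded_linear T"
  shows "C1_on {z. a + T z \<in> \<Omega>} (\<lambda>z. u (a + T z))"
  unfolding C1_on_def
proof (intro conjI ballI)
  show "(\<lambda>z. u (a + T z)) differentiable (at z)" if "z \<in> {z. a + T z \<in> \<Omega>}" for z
    using has_grad_affine[OF C1_on_has_grad[OF u] T] that by (auto simp: differentiable_def)
  fix e :: 'b assume "e \<in> Basis"
  have aff: "continuous_on {z. a + T z \<in> \<Omega>} (\<lambda>z. a + T z)"
    by (intro continuous_intros linear_continuous_on T)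
  have "continuous_on {z. a + T z \<in> \<Omega>} (\<lambda>z. frechet_derivative u (at (a + T z)) b)" if "b \<in> Basis" for b
  proof (rule continuous_on_compose2[OF _ aff])
    show "continuous_on \<Omega> (\<lambda>x. frechet_derivative u (at x) b)" using u that by (simp add: C1_on_def)
  qed auto
  then have "continuous_on {z. a + T z \<in> \<Omega>}
      (\<lambda>z. \<Sum>b\<in>Basis. (T e \<bullet> b) * frechet_derivative u (at (a + T z)) b)"
    by (intro continuous_intros)
  then show "continuous_on {z. a + T z \<in> \<Omega>} (\<lambda>z. frechet_derivative (\<lambda>z. u (a + T z)) (at z) e)"
    by (rule continuous_on_eq) (simp add: frechet_derivative_affine[OF u T])
qed

lemma locally_Hoelder_on_affine:
  fixes T :: "'b::euclidean_space \<Rightarrow> 'a::euclidean_space"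
  assumes g: "locally_Hoelder_on p \<Omega> g" and T: "bounded_linear T" and p: "0 < p"
  shows "locally_Hoelder_on p {z. a + T z \<in> \<Omega>} (\<lambda>z. c * g (a + T z))"
  unfolding locally_Hoelder_on_def
proof
  fix x assume "x \<in> {z. a + T z \<in> \<Omega>}"
  then obtain r C where r: "r > 0" "\<And>y z. y \<in> ball (a + T x) r \<inter> \<Omega> \<Longrightarrow> z \<in> ball (a + T x) r \<inter> \<Omega> \<Longrightarrow>
      \<bar>g y - g z\<bar> \<le> C * dist y z powr p"
    using g unfolding locally_Hoelder_on_def by blast
  obtain K where K: "K > 0" "\<And>z. norm (T z) \<le> norm z * K" using bounded_linear.pos_bounded[OF T] by blast
  have dT: "dist (a + T y) (a + T z) \<le> K * dist y z" for y z
    using K(2)[of "y - z"] linear_diff[OF bounded_linear.linear[OF T], of y z]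
    by (simp add: dist_norm mult.commute)
  show "\<exists>r>0. \<exists>C. \<forall>y\<in>ball x r \<inter> {z. a + T z \<in> \<Omega>}. \<forall>z\<in>ball x r \<inter> {z. a + T z \<in> \<Omega>}.
          \<bar>c * g (a + T y) - c * g (a + T z)\<bar> \<le> C * dist y z powr p"
  proof (rule exI[of _ "r / K"], intro conjI exI[of _ "\<bar>c\<bar> * (max C 0 * K powr p)"] ballI)
    show "0 < r / K" using r K by simp
    fix y z assume yz: "y \<in> ball x (r / K) \<inter> {z. a + T z \<in> \<Omega>}" "z \<in> ball x (r / K) \<inter> {z. a + T z \<in> \<Omega>}"
    have in_ball: "a + T w \<in> ball (a + T x) r" if "w \<in> ball x (r / K)" for w
    proof -
      have "dist (a + T x) (a + T w) \<le> K * dist x w" by (rule dT)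
      also have "\<dots> < r" using that K by (simp add: field_simps)
      finally show ?thesis by simp
    qed
    have "\<bar>g (a + T y) - g (a + T z)\<bar> \<le> C * dist (a + T y) (a + T z) powr p"
      using yz in_ball by (intro r(2)) auto
    also have "\<dots> \<le> max C 0 * dist (a + T y) (a + T z) powr p" by (intro mult_right_mono) auto
    also have "\<dots> \<le> max C 0 * (K * dist y z) powr p"
      using p dT by (intro mult_left_mono powr_mono2) auto
    also have "\<dots> = max C 0 * K powr p * dist y z powr p" using K by (simp add: powr_mult)
    finally have "\<bar>c\<bar> * \<bar>g (a + T y) - g (a + T z)\<bar> \<le> \<bar>c\<bar> * (max C 0 * K powr p * dist y z powr p)"
      by (intro mult_left_mono) auto
    then show "\<bar>c * g (a + T y) - c * g (a + T z)\<bar> \<le> \<bar>c\<bar> * (max C 0 * K powr p) * dist y z powr p"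
      by (simp add: abs_mult mult.assoc flip: right_diff_distrib)
  qed
qed

lemma locally_Hoelder_on_sum:
  assumes "finite B" "\<And>e. e \<in> B \<Longrightarrow> locally_Hoelder_on p \<Omega> (g e)"
  shows "locally_Hoelder_on p \<Omega> (\<lambda>x. \<Sum>e\<in>B. g e x)"
  unfolding locally_Hoelder_on_def
proof
  fix x assume "x \<in> \<Omega>"
  with assms have "\<exists>r>0. \<exists>C. \<forall>y\<in>ball x r \<inter> \<Omega>. \<forall>z\<in>ball x r \<inter> \<Omega>. (\<Sum>e\<in>B. \<bar>g e y - g e z\<bar>) \<le> C * dist y z powr p"
    by (intro locally_Hoelder_on_sum_abs) auto
  then obtain r C where r: "r > 0"
    "\<And>y z. y \<in> ball x r \<inter> \<Omega> \<Longrightarrow> z \<in> ball x r \<inter> \<Omega> \<Longrightarrow> (\<Sum>e\<in>B. \<bar>g e y - g e z\<bar>) \<le> C * dist y z powr p"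
    by blast
  show "\<exists>r>0. \<exists>C. \<forall>y\<in>ball x r \<inter> \<Omega>. \<forall>z\<in>ball x r \<inter> \<Omega>. \<bar>(\<Sum>e\<in>B. g e y) - (\<Sum>e\<in>B. g e z)\<bar> \<le> C * dist y z powr p"
    unfolding sum_subtractf[symmetric]
    by (rule exI[of _ r], intro conjI exI[of _ C] ballI r(1) order_trans[OF sum_abs r(2)])
qed

lemma C1p_on_affine:
  fixes T :: "'b::euclidean_space \<Rightarrow> 'a::euclidean_space"
  assumes u: "C1p_on p \<Omega> u" and T: "bounded_linear T" and p: "0 < p"
  shows "C1p_on p {z. a + T z \<in> \<Omega>} (\<lambda>z. u (a + T z))"
  unfolding C1p_on_def
proof (intro conjI ballI)
  have C1: "C1_on \<Omega> u" using u by (simp add: C1p_on_def)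
  then show "C1_on {z. a + T z \<in> \<Omega>} (\<lambda>z. u (a + T z))" using T by (rule C1_on_affine)
  fix e :: 'b assume "e \<in> Basis"
  have "locally_Hoelder_on p {z. a + T z \<in> \<Omega>}
      (\<lambda>z. \<Sum>b\<in>Basis. (T e \<bullet> b) * frechet_derivative u (at (a + T z)) b)"
    using u by (intro locally_Hoelder_on_sum locally_Hoelder_on_affine T p) (auto simp: C1p_on_def)
  then show "locally_Hoelder_on p {z. a + T z \<in> \<Omega>} (\<lambda>z. frechet_derivative (\<lambda>z. u (a + T z)) (at z) e)"
    unfolding locally_Hoelder_on_def by (simp add: frechet_derivative_affine[OF C1 T])
qed

lemma bounded_linear_scalar_mult: "bounded_linear (\<lambda>\<zeta>. \<zeta> *s (b :: complex ^ 'n))"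
proof -
  have "linear (\<lambda>\<zeta>. \<zeta> *s b)"
    by (rule linearI) (simp_all add: vec_eq_iff distrib_right)
  then show ?thesis by (simp add: linear_conv_bounded_linear)
qed

lemma open_affine_preimage:
  assumes "open \<Omega>" "bounded_linear T"
  shows "open {z. a + T z \<in> \<Omega>}"
proof -
  have "continuous_on UNIV (\<lambda>z. a + T z)" by (intro continuous_intros linear_continuous_on assms)
  from open_vimage[OF assms(1) this] show ?thesis by (simp add: vimage_def)
qed

lemma hausdorff_premeasure_mono:
  "A \<subseteq> B \<Longrightarrow> hausdorff_premeasure p \<delta> A \<le> hausdorff_premeasure p \<delta> B"
  unfolding hausdorff_premeasure_def by (intro INF_superset_mono) auto

lemma hausdorff_measure_mono: "A \<subseteq> B \<Longrightarrow> hausdorff_measure p A \<le> hausdorff_measure p B"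
  unfolding hausdorff_measure_def by (intro SUP_mono') (rule hausdorff_premeasure_mono)

lemma plurisubharmonic_on_extension:
  fixes u :: "complex ^ 'n \<Rightarrow> real"
  assumes u: "C1_on \<Omega> u" and V: "open V" "\<Omega> - E \<subseteq> V" "V \<subseteq> \<Omega>" "plurisubharmonic_on V u"
    and slice: "\<And>a b F W. open W \<Longrightarrow> {\<zeta>. a + \<zeta> *s b \<in> \<Omega>} - F \<subseteq> W \<Longrightarrow> W \<subseteq> {\<zeta>. a + \<zeta> *s b \<in> \<Omega>} \<Longrightarrow>
      subharmonic_on W (\<lambda>\<zeta>. u (a + \<zeta> *s b)) \<Longrightarrow> (\<lambda>\<zeta>. u (a + \<zeta> *s b)) ` F \<subseteq> u ` E \<Longrightarrow>
      subharmonic_on {\<zeta>. a + \<zeta> *s b \<in> \<Omega>} (\<lambda>\<zeta>. u (a + \<zeta> *s b))"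
  shows "plurisubharmonic_on \<Omega> u"
  unfolding plurisubharmonic_on_def
proof (intro conjI allI)
  show "upper_semicontinuous_on \<Omega> u"
    by (intro continuous_on_upper_semicontinuous_on C1_on_continuous_on u)
  fix a b :: "complex ^ 'n"
  show "subharmonic_on {\<zeta>. a + \<zeta> *s b \<in> \<Omega>} (\<lambda>\<zeta>. u (a + \<zeta> *s b))"
  proof (rule slice[of "{\<zeta>. a + \<zeta> *s b \<in> V}" a b "{\<zeta>. a + \<zeta> *s b \<in> E}"])
    show "open {\<zeta>. a + \<zeta> *s b \<in> V}" by (rule open_affine_preimage[OF V(1) bounded_linear_scalar_mult])
    show "subharmonic_on {\<zeta>. a + \<zeta> *s b \<in> V} (\<lambda>\<zeta>. u (a + \<zeta> *s b))"
      using V(4) by (simp add: plurisubharmonic_on_def)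
  qed (use V in auto)
qed

lemma plurisubharmonic_on_extension_null:
  fixes u :: "complex ^ 'n \<Rightarrow> real"
  assumes p: "0 < p" "p \<le> 1" and \<Omega>: "open \<Omega>" and u: "C1p_on p \<Omega> u"
    and V: "open V" "\<Omega> - E \<subseteq> V" "V \<subseteq> \<Omega>" "plurisubharmonic_on V u"
    and E: "hausdorff_measure p (u ` E) = 0"
  shows "plurisubharmonic_on \<Omega> u"
proof (rule plurisubharmonic_on_extension[OF _ V])
  show "C1_on \<Omega> u" using u by (simp add: C1p_on_def)
  fix a b :: "complex ^ 'n" and F W
  assume W: "open W" "{\<zeta>. a + \<zeta> *s b \<in> \<Omega>} - F \<subseteq> W" "W \<subseteq> {\<zeta>. a + \<zeta> *s b \<in> \<Omega>}"
    "subharmonic_on W (\<lambda>\<zeta>. u (a + \<zeta> *s b))" and F: "(\<lambda>\<zeta>. u (a + \<zeta> *s b)) ` F \<subseteq> u ` E"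
  have "hausdorff_measure p ((\<lambda>\<zeta>. u (a + \<zeta> *s b)) ` F) = 0"
    using hausdorff_measure_mono[OF F, of p] E by simp
  then show "subharmonic_on {\<zeta>. a + \<zeta> *s b \<in> \<Omega>} (\<lambda>\<zeta>. u (a + \<zeta> *s b))"
    by (rule subharmonic_on_extension_null[OF p open_affine_preimage[OF \<Omega> bounded_linear_scalar_mult]
          C1p_on_affine[OF u bounded_linear_scalar_mult p(1)] W])
qed

lemma plurisubharmonic_on_extension_countable:
  fixes u :: "complex ^ 'n \<Rightarrow> real"
  assumes \<Omega>: "open \<Omega>" and u: "C1_on \<Omega> u"
    and V: "open V" "\<Omega> - E \<subseteq> V" "V \<subseteq> \<Omega>" "plurisubharmonic_on V u" and E: "countable (u ` E)"
  shows "plurisubharmonic_on \<Omega> u"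
proof (rule plurisubharmonic_on_extension[OF u V])
  fix a b :: "complex ^ 'n" and F W
  assume W: "open W" "{\<zeta>. a + \<zeta> *s b \<in> \<Omega>} - F \<subseteq> W" "W \<subseteq> {\<zeta>. a + \<zeta> *s b \<in> \<Omega>}"
    "subharmonic_on W (\<lambda>\<zeta>. u (a + \<zeta> *s b))" and F: "(\<lambda>\<zeta>. u (a + \<zeta> *s b)) ` F \<subseteq> u ` E"
  have "countable ((\<lambda>\<zeta>. u (a + \<zeta> *s b)) ` F)" using F E by (rule countable_subset)
  then show "subharmonic_on {\<zeta>. a + \<zeta> *s b \<in> \<Omega>} (\<lambda>\<zeta>. u (a + \<zeta> *s b))"
    by (rule subharmonic_on_extension_countable[OF open_affine_preimage[OF \<Omega> bounded_linear_scalar_mult]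
          C1_on_affine[OF u bounded_linear_scalar_mult] W])
qed

section \<open>Sharpness\<close>

text \<open>Affine functions are harmonic polynomials, so the mean value property evaluates the
  integral.\<close>

lemma affine_mean_cball:
  fixes T :: "'a::euclidean_space \<Rightarrow> real"
  assumes T: "bounded_linear T" and r: "r > 0"
  shows "(LINT z:cball x r|lborel. c + T z) = (c + T x) * measure lborel (cball x r)"
proof -
  define h where "h = (\<lambda>y. c + T (x + r *\<^sub>R y))"
  have pT: "real_polynomial_function T" using T by (rule real_polynomial_function.intros(1))
  have pf: "real_polynomial_function (\<lambda>z. c + T z)" by (intro poly_intros pT)
  have "lap T = (\<lambda>z. 0)" by (rule ext) (simp add: lap_def pd_linear[OF T])
  then have lh: "lap (\<lambda>z. c + T z) = (\<lambda>z. 0)"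
    by (subst lap_add) (auto intro: pT poly_intros)
  have h: "real_polynomial_function h" "lap h = (\<lambda>x. 0)" unfolding h_def
    using poly_scale[OF pf] lap_scale[OF pf, of x r] lh by auto
  have "(LINT z:cball x r|lborel. c + T z) / measure lborel (cball x r) = ball_int h / ball_vol TYPE('a)"
    unfolding h_def by (rule mean_cball_scale[OF r]) (rule poly_continuous_on[OF pf])
  also have "\<dots> = h 0" using harmonic_poly_mean[OF h] ball_vol_pos[where 'a='a] by simp
  finally show ?thesis using r by (simp add: h_def field_simps)
qed

lemma set_integral_cball_pos:
  fixes k :: "'a::euclidean_space \<Rightarrow> real"
  assumes k: "continuous_on (cball x R) k" and nonneg: "\<And>z. z \<in> cball x R \<Longrightarrow> 0 \<le> k z"
    and z1: "z1 \<in> ball x R" "k z1 > 0"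
  shows "(LINT z:cball x R|lborel. k z) > 0"
proof -
  have "continuous_on (ball x R) k" using k by (rule continuous_on_subset) auto
  then have "isCont k z1" using z1(1) by (simp add: continuous_on_eq_continuous_at)
  then have "(k \<longlongrightarrow> k z1) (nhds z1)" unfolding continuous_at by (subst (asm) tendsto_at_iff_tendsto_nhds)
  then have "eventually (\<lambda>z. k z1 / 2 < k z) (nhds z1)"
    by (rule order_tendstoD(1)) (use z1 in simp)
  moreover have "eventually (\<lambda>z. z \<in> ball x R) (nhds z1)" using z1(1) by (intro eventually_nhds_in_open) auto
  ultimately have "eventually (\<lambda>z. k z1 / 2 < k z \<and> z \<in> ball x R) (nhds z1)" by (rule eventually_conj)
  then obtain d where d: "d > 0" "\<And>z. dist z z1 < d \<Longrightarrow> k z1 / 2 < k z \<and> z \<in> ball x R"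
    unfolding eventually_nhds_metric by blast
  have sub: "k z1 / 2 < k z \<and> z \<in> ball x R" if "z \<in> cball z1 (d / 2)" for z
    using d(2)[of z] that d(1) by (simp add: dist_commute)
  have "0 < k z1 / 2 * measure lborel (cball z1 (d / 2))" using z1 d by simp
  also have "\<dots> = (\<integral>z. indicator (cball z1 (d / 2)) z *\<^sub>R (k z1 / 2) \<partial>lborel)"
    by simp
  also have "\<dots> \<le> (\<integral>z. indicator (cball x R) z *\<^sub>R k z \<partial>lborel)"
  proof (rule integral_mono)
    show "integrable lborel (\<lambda>z. indicator (cball z1 (d / 2)) z *\<^sub>R (k z1 / 2))"
      by (intro borel_integrable_compact) auto
    show "integrable lborel (\<lambda>z. indicator (cball x R) z *\<^sub>R k z)"
      by (intro borel_integrable_compact k) auto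
    show "indicator (cball z1 (d / 2)) z *\<^sub>R (k z1 / 2) \<le> indicator (cball x R) z *\<^sub>R k z" for z
      using sub[of z] nonneg[of z] by (auto simp: indicator_def split: if_splits)
  qed
  finally show ?thesis by (simp add: set_lebesgue_integral_def)
qed

text \<open>
  The inverse \<open>\<psi>\<close> of an antiderivative of \<open>1 + F\<close> is concave, and affine wherever its values avoid
  the set on which \<open>F\<close> grows.
\<close>

locale concave_profile =
  fixes F :: "real \<Rightarrow> real" and K :: "real set" and \<psi> :: "real \<Rightarrow> real"
  assumes F_mono: "x \<le> y \<Longrightarrow> F x \<le> F y" and F_nonneg: "0 \<le> F x"
    and F_cont: "continuous_on UNIV F"
    and F_const: "x \<le> y \<Longrightarrow> {x..y} \<inter> K = {} \<Longrightarrow> F x = F y"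
    and \<psi>_deriv: "(\<psi> has_real_derivative inverse (1 + F (\<psi> s))) (at s)"
    and \<psi>_surj: "surj \<psi>"
begin

lemma deriv_pos: "0 < inverse (1 + F x)"
  using F_nonneg[of x] by simp

lemma \<psi>_mono: "s \<le> t \<Longrightarrow> \<psi> s \<le> \<psi> t"
  by (erule DERIV_nonneg_imp_nondecreasing)
    (intro exI conjI, rule \<psi>_deriv, rule less_imp_le, rule deriv_pos)

lemma \<psi>_cont: "continuous_on S \<psi>"
  by (intro continuous_at_imp_continuous_on ballI DERIV_isCont[OF \<psi>_deriv])

lemma \<psi>_lipschitz: "\<bar>\<psi> s - \<psi> t\<bar> \<le> \<bar>s - t\<bar>"
proof -
  have "norm (\<psi> s - \<psi> t) \<le> 1 * norm (s - t)"
  proof (rule field_differentiable_bound[of UNIV])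
    show "(\<psi> has_field_derivative inverse (1 + F (\<psi> z))) (at z within UNIV)" for z
      using \<psi>_deriv by simp
    show "norm (inverse (1 + F (\<psi> z))) \<le> 1" for z
      using F_nonneg[of "\<psi> z"] by (simp add: inverse_le_1_iff)
  qed auto
  then show ?thesis by simp
qed

lemma \<psi>_frechet: "frechet_derivative \<psi> (at s) e = e * inverse (1 + F (\<psi> s))"
  using frechet_derivative_at[OF \<psi>_deriv[unfolded has_field_derivative_def, of s]]
  by (metis mult.commute)

lemma \<psi>_C1: "C1_on UNIV \<psi>"
  unfolding C1_on_def
proof (intro conjI ballI)
  show "\<psi> differentiable (at s)" for s
    using \<psi>_deriv[of s] unfolding differentiable_def has_field_derivative_def by blast
  have c: "continuous_on UNIV (\<lambda>s. inverse (1 + F (\<psi> s)))"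
    using F_nonneg by (intro continuous_intros continuous_on_compose2[OF F_cont] \<psi>_cont)
      (auto simp: add_nonneg_eq_0_iff)
  show "continuous_on UNIV (\<lambda>s. frechet_derivative \<psi> (at s) e)" for e
    unfolding \<psi>_frechet by (intro continuous_on_mult continuous_on_const c)
qed

text \<open>Inversion is 1-Lipschitz on [1, \<infinity>) and \<psi> is 1-Lipschitz, so the
  derivative of \<psi> inherits the local Hoelder bound of \<open>F\<close> with the same radius and
  constant.\<close>

lemma \<psi>_C1p:
  assumes p: "0 < p" and F: "locally_Hoelder_on p UNIV F"
  shows "C1p_on p UNIV \<psi>"
  unfolding C1p_on_def
proof (intro conjI ballI \<psi>_C1)
  fix e :: real assume "e \<in> Basis"
  then have e: "e = 1" by simp
  show "locally_Hoelder_on p UNIV (\<lambda>s. frechet_derivative \<psi> (at s) e)"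
    unfolding locally_Hoelder_on_def \<psi>_frechet e
  proof
    fix s :: real
    from F obtain r C where r: "r > 0"
      "\<And>y z. y \<in> ball (\<psi> s) r \<inter> UNIV \<Longrightarrow> z \<in> ball (\<psi> s) r \<inter> UNIV \<Longrightarrow> \<bar>F y - F z\<bar> \<le> C * dist y z powr p"
      unfolding locally_Hoelder_on_def by blast
    show "\<exists>r>0. \<exists>C. \<forall>y\<in>ball s r \<inter> UNIV. \<forall>z\<in>ball s r \<inter> UNIV.
      \<bar>1 * inverse (1 + F (\<psi> y)) - 1 * inverse (1 + F (\<psi> z))\<bar> \<le> C * dist y z powr p"
    proof (rule exI[of _ r], intro conjI exI[of _ "max C 0"] ballI r(1))
      fix y z assume yz: "y \<in> ball s r \<inter> UNIV" "z \<in> ball s r \<inter> UNIV"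
      have pos: "1 \<le> 1 + F x" for x using F_nonneg[of x] by simp
      have 1: "1 \<le> (1 + F (\<psi> y)) * (1 + F (\<psi> z))"
        using mult_mono[OF pos pos, of "\<psi> y" "\<psi> z"] F_nonneg by simp
      have "\<bar>inverse (1 + F (\<psi> y)) - inverse (1 + F (\<psi> z))\<bar> =
          \<bar>F (\<psi> z) - F (\<psi> y)\<bar> / ((1 + F (\<psi> y)) * (1 + F (\<psi> z)))"
        using pos[of "\<psi> y"] pos[of "\<psi> z"] by (simp add: field_simps abs_div_pos)
      also have "\<dots> \<le> \<bar>F (\<psi> z) - F (\<psi> y)\<bar>"
        using 1 by (simp add: divide_le_eq mult_right_le_one_le[of "\<bar>_\<bar>"] mult_le_cancel_left1)
      also have "\<dots> \<le> C * dist (\<psi> z) (\<psi> y) powr p"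
        using \<psi>_lipschitz[of s y] \<psi>_lipschitz[of s z] yz
        by (intro r(2)) (auto simp: dist_real_def)
      also have "\<dots> \<le> max C 0 * dist (\<psi> z) (\<psi> y) powr p" by (intro mult_right_mono) auto
      also have "\<dots> \<le> max C 0 * dist y z powr p"
        using p \<psi>_lipschitz[of z y] by (intro mult_left_mono powr_mono2) (auto simp: dist_real_def)
      finally show "\<bar>1 * inverse (1 + F (\<psi> y)) - 1 * inverse (1 + F (\<psi> z))\<bar> \<le> max C 0 * dist y z powr p"
        by simp
    qed
  qed
qed

lemma \<psi>_affine:
  assumes st: "s \<le> t" and avoid: "\<And>m. m \<in> {s..t} \<Longrightarrow> \<psi> m \<notin> K"
  shows "\<psi> t - \<psi> s = inverse (1 + F (\<psi> s)) * (t - s)" "F (\<psi> t) = F (\<psi> s)"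
proof -
  have F: "F (\<psi> m) = F (\<psi> s)" if m: "m \<in> {s..t}" for m
  proof (rule F_const[symmetric])
    show "\<psi> s \<le> \<psi> m" using m by (intro \<psi>_mono) auto
    show "{\<psi> s..\<psi> m} \<inter> K = {}"
    proof (intro equals0I)
      fix k assume k: "k \<in> {\<psi> s..\<psi> m} \<inter> K"
      \<comment> \<open>By the intermediate value theorem a point of \<open>K\<close> between two
        values of \<psi> is itself a value taken in between, which \<open>avoid\<close>
        excludes.\<close>
      then obtain w where "s \<le> w" "w \<le> m" "\<psi> w = k"
        using IVT'[of \<psi> s k m] m \<psi>_cont by auto
      then show False using avoid[of w] k m by auto
    qed
  qed
  show "F (\<psi> t) = F (\<psi> s)" by (rule F) (use st in simp)
  show "\<psi> t - \<psi> s = inverse (1 + F (\<psi> s)) * (t - s)"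
  proof (cases "s = t")
    case False
    then obtain z where "s < z" "z < t" "\<psi> t - \<psi> s = (t - s) * inverse (1 + F (\<psi> z))"
      using MVT2[of s t \<psi> "\<lambda>s. inverse (1 + F (\<psi> s))"] \<psi>_deriv st by auto
    then show ?thesis using F[of z] by simp
  qed simp
qed

lemma \<psi>_tangent: "\<psi> s \<le> \<psi> m + inverse (1 + F (\<psi> m)) * (s - m)"
proof -
  have anti: "inverse (1 + F (\<psi> t)) \<le> inverse (1 + F (\<psi> s))" if "s \<le> t" for s t
    using F_mono[OF \<psi>_mono[OF that]] F_nonneg[of "\<psi> s"] by (intro le_imp_inverse_le) auto
  consider "s < m" | "s = m" | "m < s" by linarith
  then show ?thesis
  proof cases
    case 1
    then obtain z where z: "s < z" "z < m" "\<psi> m - \<psi> s = (m - s) * inverse (1 + F (\<psi> z))"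
      using MVT2[of s m \<psi> "\<lambda>s. inverse (1 + F (\<psi> s))"] \<psi>_deriv by auto
    have "(m - s) * inverse (1 + F (\<psi> m)) \<le> (m - s) * inverse (1 + F (\<psi> z))"
      using 1 z by (intro mult_left_mono anti) auto
    then show ?thesis using z(3) by (simp add: algebra_simps)
  next
    case 3
    then obtain z where z: "m < z" "z < s" "\<psi> s - \<psi> m = (s - m) * inverse (1 + F (\<psi> z))"
      using MVT2[of m s \<psi> "\<lambda>s. inverse (1 + F (\<psi> s))"] \<psi>_deriv by auto
    have "(s - m) * inverse (1 + F (\<psi> z)) \<le> (s - m) * inverse (1 + F (\<psi> m))"
      using 3 z by (intro mult_left_mono anti) auto
    then show ?thesis using z(3) by (simp add: algebra_simps)
  qed simp
qed

text \<open>Segments from the centre of a ball stay in the ball, so \<psi> is affine along each with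
  the one slope \<open>q\<close> found at the centre. The composite is affine on the whole ball, and
  the mean value property holds with equality.\<close>

lemma \<psi>_subharmonic_on:
  fixes T :: "'a::euclidean_space \<Rightarrow> real"
  assumes T: "bounded_linear T" and avoid: "\<And>z. z \<in> U \<Longrightarrow> \<psi> (c + T z) \<notin> K"
  shows "subharmonic_on U (\<lambda>z. \<psi> (c + T z))"
  unfolding subharmonic_on_def
proof (intro conjI allI impI)
  have cont: "continuous_on S (\<lambda>z. \<psi> (c + T z))" for S
    by (intro continuous_on_compose2[OF \<psi>_cont[of UNIV]] continuous_intros linear_continuous_on T) auto
  show "upper_semicontinuous_on U (\<lambda>z. \<psi> (c + T z))"
    by (intro continuous_on_upper_semicontinuous_on cont)
  fix x and r :: real assume r: "0 < r" "cball x r \<subseteq> U"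
  show "set_integrable lborel (cball x r) (\<lambda>z. \<psi> (c + T z))" by (intro set_integrable_cball cont)
  define q where "q = inverse (1 + F (\<psi> (c + T x)))"
  have lin: "linear T" using T by (rule bounded_linear.linear)
  have aff: "\<psi> (c + T z) = (\<psi> (c + T x) - q * T x) + q * T z" if z: "z \<in> cball x r" for z
  proof -
    have seg: "\<psi> m \<notin> K" if m: "m \<in> closed_segment (c + T x) (c + T z)" for m
    proof -
      have "m \<in> (\<lambda>y. c + y) ` closed_segment (T x) (T z)" using m closed_segment_translation[of c "T x" "T z"] by simp
      then obtain y where y: "y \<in> closed_segment (T x) (T z)" "m = c + y" by auto
      then obtain w where "w \<in> closed_segment x z" "y = T w"
        using closed_segment_linear_image[OF lin, of x z] by auto
      moreover have "closed_segment x z \<subseteq> cball x r" using z r(1) by (intro closed_segment_subset) auto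
      ultimately show ?thesis using y(2) avoid r(2) by blast
    qed
    consider "c + T x \<le> c + T z" | "c + T z \<le> c + T x" by linarith
    then show ?thesis
    proof cases
      case 1
      then have "\<psi> (c + T z) - \<psi> (c + T x) = q * ((c + T z) - (c + T x))"
        unfolding q_def by (rule \<psi>_affine) (use 1 seg in \<open>simp add: closed_segment_eq_real_ivl\<close>)
      then show ?thesis by (simp add: algebra_simps)
    next
      case 2
      have A: "\<psi> m \<notin> K" if "m \<in> {c + T z..c + T x}" for m
        using seg[of m] 2 that by (simp add: closed_segment_eq_real_ivl)
      show ?thesis using \<psi>_affine[OF 2 A] by (simp add: q_def algebra_simps)
    qed
  qed
  have "(LINT z:cball x r|lborel. \<psi> (c + T z)) =
      (LINT z:cball x r|lborel. (\<psi> (c + T x) - q * T x) + q * T z)"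
    using aff by (intro set_lebesgue_integral_cong) auto
  also have "\<dots> = (\<psi> (c + T x) - q * T x + q * T x) * measure lborel (cball x r)"
    by (intro affine_mean_cball bounded_linear_const_mult T r)
  finally show "\<psi> (c + T x) \<le> (LINT z:cball x r|lborel. \<psi> (c + T z)) / measure lborel (cball x r)"
    using r(1) by simp
qed

text \<open>The tangent of \<psi> at \<open>m\<close> lies above \<psi>, strictly at some point
  because the slope of \<psi> changes. On a ball centred over \<open>m\<close> that reaches this
  point, the mean is strictly below that of the affine tangent, which is the value at the
  centre.\<close>

lemma \<psi>_not_subharmonic:
  fixes T :: "'a::euclidean_space \<Rightarrow> real"
  assumes T: "bounded_linear T" and e: "T e = 1" and F_less: "F a < F b"
  shows "\<not> subharmonic_on UNIV (\<lambda>z. \<psi> (T z))"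
proof
  assume sub: "subharmonic_on UNIV (\<lambda>z. \<psi> (T z))"
  obtain s m where s: "\<psi> s = a" and m: "\<psi> m = b" using \<psi>_surj by (metis surj_def)
  have sm: "s < m"
  proof (rule ccontr)
    assume "\<not> s < m"
    then have "b \<le> a" using \<psi>_mono[of m s] s m by simp
    then show False using F_mono[of b a] F_less by simp
  qed
  define q where "q = inverse (1 + F b)"
  have q: "q < inverse (1 + F a)" unfolding q_def
    using F_less F_nonneg[of a] by (intro less_imp_inverse_less) auto
  have lin: "T (t *\<^sub>R e) = t" for t
    using linear_scale[OF bounded_linear.linear[OF T], of t e] e by simp
  define x where "x = m *\<^sub>R e"
  \<comment> \<open>To the left of \<open>s\<close> the slope of \<psi> is at least 1/(1 + F a) >
    \<open>q\<close>, so one unit further left the gap to the tangent at \<open>m\<close> is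
    positive, even if it vanishes at \<open>s\<close>.\<close>
  define z1 where "z1 = (s - 1) *\<^sub>R e"
  define R where "R = dist x z1 + 1"
  define k where "k z = (\<psi> m - q * m + q * T z) - \<psi> (T z)" for z
  have cont: "continuous_on S (\<lambda>z. \<psi> (T z))" for S
    by (intro continuous_on_compose2[OF \<psi>_cont[of UNIV]] linear_continuous_on T) auto
  have ck: "continuous_on S k" for S unfolding k_def[abs_def]
    by (intro continuous_intros cont linear_continuous_on T)
  have k0: "0 \<le> k z" for z using \<psi>_tangent[of "T z" m] by (simp add: k_def q_def m algebra_simps)
  have "\<psi> (s - 1) \<le> \<psi> s - inverse (1 + F a)" using \<psi>_tangent[of "s - 1" s] by (simp add: s)
  moreover have "\<psi> s \<le> \<psi> m + q * (s - m)" using \<psi>_tangent[of s m] by (simp add: q_def m)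
  ultimately have "\<psi> (s - 1) < \<psi> m + q * (s - m) - q" using q by linarith
  then have k1: "k z1 > 0" unfolding k_def z1_def lin by (simp add: algebra_simps)
  have R: "R > 0" "z1 \<in> ball x R" by (auto simp: R_def add_nonneg_pos)
  have "0 < (LINT z:cball x R|lborel. k z)"
    by (rule set_integral_cball_pos[OF ck k0 R(2) k1])
  also have "\<dots> = (LINT z:cball x R|lborel. \<psi> m - q * m + q * T z) - (LINT z:cball x R|lborel. \<psi> (T z))"
    unfolding k_def by (rule set_integral_diff(2))
      (intro set_integrable_cball continuous_intros cont linear_continuous_on T)+
  also have "(LINT z:cball x R|lborel. \<psi> m - q * m + q * T z) = (\<psi> m - q * m + q * T x) * measure lborel (cball x R)"
    by (intro affine_mean_cball bounded_linear_const_mult T R)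
  also have "\<psi> m - q * m + q * T x = \<psi> (T x)" by (simp add: x_def lin)
  finally have "(LINT z:cball x R|lborel. \<psi> (T z)) / measure lborel (cball x R) < \<psi> (T x)"
    using R(1) by (simp add: divide_less_eq)
  moreover have "\<psi> (T x) \<le> (LINT z:cball x R|lborel. \<psi> (T z)) / measure lborel (cball x R)"
    using sub R(1) by (auto simp: subharmonic_on_def)
  ultimately show False by simp
qed

end

text \<open>The antiderivative \<theta> has slope at least 1. This one growth bound yields
  injectivity, surjectivity (by intermediate values) and a 1-Lipschitz inverse, whose continuity is
  what the inverse function rule asks for.\<close>

lemma concave_profile_exists:
  fixes F :: "real \<Rightarrow> real"
  assumes mono: "\<And>x y. x \<le> y \<Longrightarrow> F x \<le> F y" and nonneg: "\<And>x. 0 \<le> F x" and cont: "continuous_on UNIV F"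
    and const: "\<And>x y. x \<le> y \<Longrightarrow> {x..y} \<inter> K = {} \<Longrightarrow> F x = F y"
  obtains \<psi> where "concave_profile F K \<psi>"
proof -
  have "\<exists>\<theta>. \<forall>x :: real. -\<infinity> < ereal x \<longrightarrow> ereal x < \<infinity> \<longrightarrow> (\<theta> has_vector_derivative (1 + F x)) (at x)"
    using cont by (intro einterval_antiderivative)
      (auto simp: continuous_on_eq_continuous_at intro!: continuous_intros)
  then obtain \<theta> where \<theta>: "\<And>x. (\<theta> has_real_derivative (1 + F x)) (at x)"
    by (auto simp: has_real_derivative_iff_has_vector_derivative)
  have grow: "t - s \<le> \<theta> t - \<theta> s" if st: "s \<le> t" for s t
  proof (cases "s = t")
    case False
    then obtain z where "\<theta> t - \<theta> s = (t - s) * (1 + F z)"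
      using MVT2[of s t \<theta> "\<lambda>x. 1 + F x"] \<theta> st by auto
    moreover have "(t - s) * 1 \<le> (t - s) * (1 + F z)"
      using nonneg[of z] st by (intro mult_left_mono) auto
    ultimately show ?thesis by simp
  qed simp
  have inj: "inj \<theta>"
  proof (rule injI)
    fix s t assume "\<theta> s = \<theta> t"
    then show "s = t" using grow[of s t] grow[of t s] by linarith
  qed
  have c\<theta>: "continuous_on S \<theta>" for S
    by (intro continuous_at_imp_continuous_on ballI DERIV_isCont[OF \<theta>])
  have surj: "\<exists>x. \<theta> x = y" for y
  proof -
    define N where "N = \<bar>y - \<theta> 0\<bar>"
    have "\<theta> (- N) \<le> y" "y \<le> \<theta> N" using grow[of "- N" 0] grow[of 0 N] by (auto simp: N_def)
    then show ?thesis using IVT'[of \<theta> "- N" y N] c\<theta> by (auto simp: N_def)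
  qed
  define \<psi> where "\<psi> = inv \<theta>"
  have \<theta>\<psi>: "\<theta> (\<psi> y) = y" for y using surj[of y] unfolding \<psi>_def by (metis f_inv_into_f rangeI)
  have \<psi>\<theta>: "\<psi> (\<theta> x) = x" for x using inj by (simp add: \<psi>_def)
  have lip: "\<bar>\<psi> s - \<psi> t\<bar> \<le> \<bar>s - t\<bar>" for s t
    using grow[of "\<psi> s" "\<psi> t"] grow[of "\<psi> t" "\<psi> s"] unfolding \<theta>\<psi> by linarith
  have iso: "isCont \<psi> s" for s
    unfolding continuous_at_eps_delta
  proof (intro allI impI)
    fix e :: real assume "e > 0"
    then show "\<exists>d>0. \<forall>x'. dist x' s < d \<longrightarrow> dist (\<psi> x') (\<psi> s) < e"
      by (intro exI[of _ e] conjI allI impI) (auto simp: dist_real_def intro: le_less_trans[OF lip])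
  qed
  show ?thesis
  proof (rule that, unfold_locales)
    show "(\<psi> has_real_derivative inverse (1 + F (\<psi> s))) (at s)" for s
    proof (rule DERIV_inverse_function[where f = \<theta> and a = "s - 1" and b = "s + 1"])
      show "1 + F (\<psi> s) \<noteq> 0" using nonneg[of "\<psi> s"] by simp
    qed (use \<theta> \<theta>\<psi> iso in auto)
    show "surj \<psi>" using \<psi>\<theta> by (rule surjI)
  qed (fact mono nonneg cont const)+
qed

section \<open>Hausdorff content and a Frostman function\<close>

lemma hausdorff_premeasure_le:
  assumes "A \<subseteq> (\<Union>i. C i)" "\<And>i. bounded (C i)" "\<And>i. diameter (C i) \<le> \<delta>"
  shows "hausdorff_premeasure p \<delta> A \<le> (\<Sum>i. ennreal (diameter (C i) powr p))"
  unfolding hausdorff_premeasure_def using assms by (intro INF_lower) auto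

text \<open>Subadditivity at a fixed scale \<delta>: near-optimal covers with excess e / 2^(i+1) are
  merged along a pairing of the indices. Both the selection of a compact piece and the Hoelder bound
  below work at one scale.\<close>

lemma hausdorff_premeasure_countable_subadditive:
  "hausdorff_premeasure p \<delta> (\<Union>i. A i) \<le> (\<Sum>i. hausdorff_premeasure p \<delta> (A i))"
proof (rule ennreal_le_epsilon)
  let ?P = "hausdorff_premeasure p \<delta>"
  fix e :: real assume fin: "(\<Sum>i. ?P (A i)) < top" and e: "e > 0"
  have "\<exists>C. A i \<subseteq> (\<Union>j. C j) \<and> (\<forall>j. bounded (C j) \<and> diameter (C j) \<le> \<delta>) \<and>
      (\<Sum>j. ennreal (diameter (C j) powr p)) < ?P (A i) + ennreal (e * (1/2) ^ Suc i)" for i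
  proof -
    have "?P (A i) \<noteq> top" using fin ennreal_suminf_lessD less_top by blast
    then have "?P (A i) < ?P (A i) + ennreal (e * (1/2) ^ Suc i)"
      using e by (simp add: ennreal_add_left_cancel_less[of _ 0, simplified] less_top)
    then show ?thesis
      by (subst (asm) (1) hausdorff_premeasure_def) (auto simp: INF_less_iff)
  qed
  then obtain C where C: "\<And>i. A i \<subseteq> (\<Union>j. C i j)" "\<And>i j. bounded (C i j)" "\<And>i j. diameter (C i j) \<le> \<delta>"
    "\<And>i. (\<Sum>j. ennreal (diameter (C i j) powr p)) < ?P (A i) + ennreal (e * (1/2) ^ Suc i)"
    by metis
  define D where "D k = (case prod_decode k of (i, j) \<Rightarrow> C i j)" for k
  have "?P (\<Union>i. A i) \<le> (\<Sum>k. ennreal (diameter (D k) powr p))"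
  proof (rule hausdorff_premeasure_le)
    show "(\<Union>i. A i) \<subseteq> (\<Union>k. D k)"
    proof
      fix x assume "x \<in> (\<Union>i. A i)"
      then obtain i j where "x \<in> C i j" using C(1) by blast
      then have "x \<in> D (prod_encode (i, j))" by (simp add: D_def)
      then show "x \<in> (\<Union>k. D k)" by blast
    qed
  qed (auto simp: D_def C split: prod.split)
  also have "\<dots> = (\<Sum>k. (\<lambda>(i, j). ennreal (diameter (C i j) powr p)) (prod_decode k))"
    by (simp add: D_def split_beta)
  also have "\<dots> = (\<Sum>i. \<Sum>j. ennreal (diameter (C i j) powr p))"
    by (rule suminf_ennreal_2dimen) simp
  also have "\<dots> \<le> (\<Sum>i. ?P (A i) + ennreal (e * (1/2) ^ Suc i))"
    using C(4) by (intro suminf_le less_imp_le) auto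
  also have "\<dots> = (\<Sum>i. ?P (A i)) + (\<Sum>i. ennreal (e * (1/2) ^ Suc i))"
    by (rule suminf_add[symmetric]) auto
  also have "(\<Sum>i. ennreal (e * (1/2) ^ Suc i)) = ennreal e"
    using sums_mult[OF power_half_series, of e] e by (intro suminf_ennreal_eq) auto
  finally show "?P (\<Union>i. A i) \<le> (\<Sum>i. ?P (A i)) + ennreal e" .
qed

lemma hausdorff_premeasure_subset_interval:
  fixes x y :: real
  assumes "B \<subseteq> {x..y}" "x \<le> y" "y - x \<le> \<delta>"
  shows "hausdorff_premeasure p \<delta> B \<le> ennreal ((y - x) powr p)"
proof -
  define C where "C = (\<lambda>i::nat. if i = 0 then {x..y} else {})"
  have "hausdorff_premeasure p \<delta> B \<le> (\<Sum>i. ennreal (diameter (C i) powr p))"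
    using assms by (intro hausdorff_premeasure_le) (auto simp: C_def split: if_splits)
  also have "\<dots> = (\<Sum>i\<in>{0}. ennreal (diameter (C i) powr p))"
    by (rule suminf_finite) (auto simp: C_def)
  also have "\<dots> = ennreal ((y - x) powr p)" using assms by (simp add: C_def)
  finally show ?thesis .
qed

lemma hausdorff_premeasure_empty: "0 \<le> \<delta> \<Longrightarrow> hausdorff_premeasure p \<delta> {} = 0"
  using hausdorff_premeasure_le[of "{}" "\<lambda>_. {}" \<delta> p] by simp

lemma hausdorff_premeasure_Un:
  assumes "0 \<le> \<delta>"
  shows "hausdorff_premeasure p \<delta> (A \<union> B) \<le> hausdorff_premeasure p \<delta> A + hausdorff_premeasure p \<delta> B"
proof -
  define D where "D = (\<lambda>i::nat. if i = 0 then A else if i = 1 then B else {})"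
  have "A \<union> B = (\<Union>i. D i)" by (auto simp: D_def split: if_splits)
  then have "hausdorff_premeasure p \<delta> (A \<union> B) \<le> (\<Sum>i. hausdorff_premeasure p \<delta> (D i))"
    using hausdorff_premeasure_countable_subadditive by metis
  also have "\<dots> = (\<Sum>i\<in>{0,1}. hausdorff_premeasure p \<delta> (D i))"
    by (rule suminf_finite) (auto simp: D_def hausdorff_premeasure_empty assms)
  finally show ?thesis by (simp add: D_def)
qed

text \<open>On the line an F-sigma set is a countable union of compact sets. At a scale where the
  content of the union is positive, subadditivity leaves at least one piece with positive
  content.\<close>

lemma fsigma_hausdorff_compact_subset:
  fixes K :: "real set"
  assumes "fsigma K" "hausdorff_measure p K > 0"
  obtains C \<delta> where "compact C" "C \<subseteq> K" "\<delta> > 0" "hausdorff_premeasure p \<delta> C > 0"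
proof -
  from assms(1) obtain C :: "nat \<Rightarrow> real set" where "range C \<subseteq> Collect compact" "K = (\<Union>i. C i)"
    unfolding fsigma_Union_compact by (elim exE conjE) (rule that)
  then have C: "\<And>i. compact (C i)" "K = (\<Union>i. C i)" by auto
  from assms(2) obtain \<delta> where \<delta>: "\<delta> > 0" "hausdorff_premeasure p \<delta> K > 0"
    unfolding hausdorff_measure_def by (auto simp: less_SUP_iff)
  have "\<exists>i. hausdorff_premeasure p \<delta> (C i) > 0"
  proof (rule ccontr)
    assume "\<not> (\<exists>i. hausdorff_premeasure p \<delta> (C i) > 0)"
    then have "(\<Sum>i. hausdorff_premeasure p \<delta> (C i)) = 0" by simp
    then show False using hausdorff_premeasure_countable_subadditive[of p \<delta> C] \<delta>(2) C(2) by simp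
  qed
  then obtain i where "hausdorff_premeasure p \<delta> (C i) > 0" by blast
  then show ?thesis using C \<delta>(1) by (intro that[of "C i" \<delta>]) auto
qed

text \<open>
  A Frostman function on the line: by subadditivity the Hausdorff content of \<open>C \<inter> {..x}\<close> is
  itself Hoelder continuous in \<open>x\<close>.
\<close>

lemma frostman_function:
  fixes C :: "real set"
  assumes C: "compact C" and \<delta>: "\<delta> > 0" and pos: "hausdorff_premeasure p \<delta> C > 0" and p: "0 < p"
  obtains F a b where "\<And>x y. x \<le> y \<Longrightarrow> F x \<le> F y" "\<And>x. 0 \<le> (F x :: real)" "continuous_on UNIV F"
    "\<And>x y. x \<le> y \<Longrightarrow> {x..y} \<inter> C = {} \<Longrightarrow> F x = F y" "F a < F b" "locally_Hoelder_on p UNIV F"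
proof -
  define G where "G x = hausdorff_premeasure p \<delta> (C \<inter> {..x})" for x
  have G_mono: "G x \<le> G y" if "x \<le> y" for x y
    unfolding G_def using that by (intro hausdorff_premeasure_mono) auto
  have G_step: "G y \<le> G x + ennreal ((y - x) powr p)" if xy: "x \<le> y" "y \<le> x + \<delta>" for x y
  proof -
    have "G y \<le> hausdorff_premeasure p \<delta> ((C \<inter> {..x}) \<union> {x..y})"
      unfolding G_def by (intro hausdorff_premeasure_mono) auto
    also have "\<dots> \<le> G x + hausdorff_premeasure p \<delta> {x..y}"
      unfolding G_def using \<delta> by (intro hausdorff_premeasure_Un) auto
    also have "\<dots> \<le> G x + ennreal ((y - x) powr p)"
      using xy by (intro add_left_mono hausdorff_premeasure_subset_interval) auto
    finally show ?thesis .
  qed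
  obtain N where N: "\<And>x. x \<in> C \<Longrightarrow> \<bar>x\<bar> \<le> N"
    using compact_imp_bounded[OF C] unfolding bounded_iff real_norm_def by blast
  \<comment> \<open>To the left of \<open>C\<close>, so that the content of the initial segment
    starts at 0.\<close>
  define a where "a = - \<bar>N\<bar> - 1"
  have Ga: "G a = 0"
  proof -
    have "C \<inter> {..a} = {}" using N unfolding a_def by fastforce
    then show ?thesis using \<delta> by (simp add: G_def hausdorff_premeasure_empty)
  qed
  \<comment> \<open>A single covering set has diameter at most \<delta>, so the increment bound
    reaches only that far; finiteness spreads from \<open>a\<close> in steps of length
    \<delta>.\<close>
  have "G (a + real k * \<delta>) < top" for k
  proof (induction k)
    case (Suc k)
    have "G (a + real (Suc k) * \<delta>) \<le> G (a + real k * \<delta>) + ennreal (((a + real (Suc k) * \<delta>) - (a + real k * \<delta>)) powr p)"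
      using \<delta> by (intro G_step) (auto simp: algebra_simps)
    also have "\<dots> < top" using Suc by simp
    finally show ?case .
  qed (simp add: Ga)
  moreover have "\<exists>k. x \<le> a + real k * \<delta>" for x
  proof -
    obtain k :: nat where "(x - a) / \<delta> \<le> real k" using real_arch_simple by blast
    then show ?thesis using \<delta> by (intro exI[of _ k]) (simp add: field_simps)
  qed
  ultimately have fin: "G x < top" for x by (meson G_mono le_less_trans)
  define F where "F x = enn2real (G x)" for x
  have GF: "G x = ennreal (F x)" for x using fin[of x] by (simp add: F_def less_top)
  have F_nonneg: "0 \<le> F x" for x by (simp add: F_def)
  have F_mono: "F x \<le> F y" if "x \<le> y" for x y
    using G_mono[OF that] F_nonneg unfolding GF by simp
  have F_step: "\<bar>F y - F x\<bar> \<le> \<bar>y - x\<bar> powr p" if "\<bar>y - x\<bar> \<le> \<delta>" for x y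
  proof -
    have *: "F y \<le> F x + (y - x) powr p" if "x \<le> y" "y \<le> x + \<delta>" for x y
      using G_step[OF that] F_nonneg unfolding GF
      by (simp flip: ennreal_plus)
    show ?thesis
    proof (cases "x \<le> y")
      case True
      then show ?thesis using *[of x y] F_mono[of x y] that by simp
    next
      case False
      then show ?thesis using *[of y x] F_mono[of y x] that by simp
    qed
  qed
  have F_cont: "isCont F x" for x
    unfolding continuous_at_eps_delta
  proof (intro allI impI)
    fix e :: real assume e: "e > 0"
    show "\<exists>d>0. \<forall>x'. dist x' x < d \<longrightarrow> dist (F x') (F x) < e"
    proof (intro exI[of _ "min \<delta> (e powr (1 / p))"] conjI allI impI)
      show "0 < min \<delta> (e powr (1 / p))" using e \<delta> by simp
      fix x' assume x': "dist x' x < min \<delta> (e powr (1 / p))"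
      then have "\<bar>F x' - F x\<bar> \<le> \<bar>x' - x\<bar> powr p" by (intro F_step) (simp add: dist_real_def)
      also have "\<dots> < (e powr (1 / p)) powr p" using x' p by (intro powr_less_mono2) (auto simp: dist_real_def)
      also have "\<dots> = e" using e p by (simp add: powr_powr)
      finally show "dist (F x') (F x) < e" by (simp add: dist_real_def)
    qed
  qed
  show ?thesis
  proof (rule that[of F a "\<bar>N\<bar>"])
    show "continuous_on UNIV F" using F_cont by (simp add: continuous_at_imp_continuous_on)
    show "F x = F y" if "x \<le> y" "{x..y} \<inter> C = {}" for x y
    proof -
      have "C \<inter> {..x} = C \<inter> {..y}" using that by (auto simp: disjoint_iff) (meson not_le less_imp_le)
      then show ?thesis by (simp add: F_def G_def)
    qed
    have "C \<inter> {..\<bar>N\<bar>} = C" using N by fastforce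
    then have "G \<bar>N\<bar> > 0" using pos by (simp add: G_def)
    then show "F a < F \<bar>N\<bar>" using Ga unfolding GF by (simp add: F_nonneg)
    show "locally_Hoelder_on p UNIV F"
      unfolding locally_Hoelder_on_def
    proof
      fix x :: real
      show "\<exists>r>0. \<exists>C. \<forall>y\<in>ball x r \<inter> UNIV. \<forall>z\<in>ball x r \<inter> UNIV. \<bar>F y - F z\<bar> \<le> C * dist y z powr p"
      proof (rule exI[of _ "\<delta> / 2"], intro conjI exI[of _ 1] ballI)
        fix y z assume "y \<in> ball x (\<delta> / 2) \<inter> UNIV" "z \<in> ball x (\<delta> / 2) \<inter> UNIV"
        then have "\<bar>x - y\<bar> < \<delta> / 2" "\<bar>x - z\<bar> < \<delta> / 2" by (auto simp: dist_real_def)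
        then have "\<bar>y - z\<bar> \<le> \<delta>" by linarith
        then show "\<bar>F y - F z\<bar> \<le> 1 * dist y z powr p" using F_step by (simp add: dist_real_def)
      qed (use \<delta> in simp)
    qed
  qed (use F_mono F_nonneg in auto)
qed

section \<open>Uncountable sets and the devil's staircase\<close>

lemma uncountable_Int_interval_less:
  fixes a b :: real
  assumes "uncountable (K \<inter> {a<..<b})"
  shows "a < b"
proof (rule ccontr)
  assume "\<not> a < b"
  then have "K \<inter> {a<..<b} = {}" by auto
  with assms show False by simp
qed

text \<open>Without a splitting point, let \<alpha> be the supremum of the points with only
  countably much of \<open>K\<close> to their left. To the left of \<alpha> the set is countable,
  and beyond any q > \<alpha> it is countable because it is uncountable before q. Exhausting by
  rational q leaves only \<alpha> itself.\<close>

lemma uncountable_split: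
  fixes K :: "real set"
  assumes "uncountable (K \<inter> {a<..<b})"
  shows "\<exists>c. uncountable (K \<inter> {a<..<c}) \<and> uncountable (K \<inter> {c<..<b})"
proof (rule ccontr)
  assume no: "\<not> ?thesis"
  have ab: "a < b" by (rule uncountable_Int_interval_less[OF assms])
  define S where "S = {c. c \<le> b \<and> countable (K \<inter> {a<..<c})}"
  have aS: "a \<in> S" using ab by (simp add: S_def)
  have bdd: "bdd_above S" by (auto simp: S_def bdd_above_def)
  define \<alpha> where "\<alpha> = Sup S"
  have sub: "K \<inter> {a<..<\<alpha>} \<subseteq> (\<Union>q\<in>{q\<in>\<rat>. q < \<alpha>}. K \<inter> {a<..<q})"
    using Rats_dense_in_real by fastforce
  have "countable (K \<inter> {a<..<q})" if "q < \<alpha>" for q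
  proof -
    obtain c where "c \<in> S" "q < c" using \<open>q < \<alpha>\<close> less_cSup_iff[OF _ bdd] aS unfolding \<alpha>_def by blast
    then show ?thesis by (auto simp: S_def intro: countable_subset[of _ "K \<inter> {a<..<c}"])
  qed
  moreover have "countable {q\<in>\<rat>. q < \<alpha>}" by (rule countable_subset[OF _ countable_rat]) auto
  ultimately have "countable (\<Union>q\<in>{q\<in>\<rat>. q < \<alpha>}. K \<inter> {a<..<q})" by (intro countable_UN) auto
  with sub have left: "countable (K \<inter> {a<..<\<alpha>})" by (rule countable_subset)
  have "countable (K \<inter> {q<..<b})" if q: "\<alpha> < q" "q \<le> b" for q
  proof -
    have "q \<notin> S" using cSup_upper[OF _ bdd, of q] q unfolding \<alpha>_def by auto
    then have "uncountable (K \<inter> {a<..<q})" using q by (simp add: S_def)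
    then show ?thesis using no by blast
  qed
  moreover have "countable {q\<in>\<rat>. \<alpha> < q \<and> q \<le> b}" by (rule countable_subset[OF _ countable_rat]) auto
  ultimately have "countable (\<Union>q\<in>{q\<in>\<rat>. \<alpha> < q \<and> q \<le> b}. K \<inter> {q<..<b})" by (intro countable_UN) auto
  moreover have "K \<inter> {\<alpha><..<b} \<subseteq> (\<Union>q\<in>{q\<in>\<rat>. \<alpha> < q \<and> q \<le> b}. K \<inter> {q<..<b})"
  proof
    fix x assume x: "x \<in> K \<inter> {\<alpha><..<b}"
    then obtain q where "q \<in> \<rat>" "\<alpha> < q" "q < x" using Rats_dense_in_real[of \<alpha> x] by auto
    then show "x \<in> (\<Union>q\<in>{q\<in>\<rat>. \<alpha> < q \<and> q \<le> b}. K \<inter> {q<..<b})" using x by auto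
  qed
  ultimately have right: "countable (K \<inter> {\<alpha><..<b})" by (rule countable_subset[rotated])
  have "K \<inter> {a<..<b} \<subseteq> (K \<inter> {a<..<\<alpha>}) \<union> {\<alpha>} \<union> (K \<inter> {\<alpha><..<b})" by auto
  moreover have "countable ((K \<inter> {a<..<\<alpha>}) \<union> {\<alpha>} \<union> (K \<inter> {\<alpha><..<b}))" using left right by simp
  ultimately have "countable (K \<inter> {a<..<b})" by (rule countable_subset)
  with assms show False by simp
qed

text \<open>
  The devil's staircase takes the value \<open>d\<close> at \<open>c d\<close> for dyadic \<open>d\<close>, where any two of the points
  \<open>c d\<close> have uncountably many points of \<open>K\<close> between them.
\<close>

lemma devils_staircase:
  fixes K :: "real set"
  assumes "uncountable K"
  obtains F a b where "\<And>x y. x \<le> y \<Longrightarrow> F x \<le> F y" "\<And>x. 0 \<le> (F x :: real)" "continuous_on UNIV F"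
    "\<And>x y. x \<le> y \<Longrightarrow> {x..y} \<inter> K = {} \<Longrightarrow> F x = F y" "F a < F b"
proof -
  define R where "R x y \<longleftrightarrow> x < y \<and> uncountable (K \<inter> {x<..<y})" for x y :: real
  have "\<exists>N::nat. uncountable (K \<inter> {- real N<..<real N})"
  proof (rule ccontr)
    assume "\<not> ?thesis"
    then have "countable (\<Union>N::nat. K \<inter> {- real N<..<real N})" by (intro countable_UN) auto
    moreover have "K \<subseteq> (\<Union>N::nat. K \<inter> {- real N<..<real N})"
    proof
      fix x assume x: "x \<in> K"
      obtain N :: nat where "\<bar>x\<bar> < real N" using reals_Archimedean2 by blast
      then have "x \<in> K \<inter> {- real N<..<real N}" using x by auto
      then show "x \<in> (\<Union>N::nat. K \<inter> {- real N<..<real N})" by blast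
    qed
    ultimately have "countable K" by (rule countable_subset[rotated])
    with assms show False by simp
  qed
  then obtain N :: nat where N: "uncountable (K \<inter> {- real N<..<real N})" by blast
  \<comment> \<open>Besides the initial pair, recursion over dyadic fractions asks of
    \<open>R\<close> only transitivity and betweenness; betweenness is the splitting lemma.\<close>
  have "\<exists>c :: real \<Rightarrow> real. c 0 = - real N \<and> c 1 = real N \<and>
      (\<forall>x\<in>dyadics \<inter> {0..1}. \<forall>y\<in>dyadics \<inter> {0..1}. x < y \<longrightarrow> R (c x) (c y))"
  proof (rule recursion_on_dyadic_fractions)
    show "R (- real N) (real N)" using N uncountable_Int_interval_less[OF N] by (simp add: R_def)
    show "\<exists>z. R x z \<and> R z y" if "R x y" for x y
      using uncountable_split[of K x y] that uncountable_Int_interval_less unfolding R_def by blast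
    show "R x z" if "R x y" "R y z" for x y z
    proof -
      have "K \<inter> {x<..<y} \<subseteq> K \<inter> {x<..<z}" using that by (auto simp: R_def)
      then have "uncountable (K \<inter> {x<..<z})" using that(1) countable_subset unfolding R_def by blast
      then show ?thesis using that by (simp add: R_def)
    qed
  qed
  then obtain c :: "real \<Rightarrow> real" where c: "\<And>x y. x \<in> dyadics \<inter> {0..1} \<Longrightarrow> y \<in> dyadics \<inter> {0..1} \<Longrightarrow> x < y \<Longrightarrow> R (c x) (c y)"
    by blast
  define D :: "real set" where "D = dyadics \<inter> {0..1}"
  have D01: "0 \<in> D" "1 \<in> D" using real_in_dyadics[of 0] real_in_dyadics[of 1] by (auto simp: D_def)
  have D_dense: "\<exists>d\<in>D. x < d \<and> d < y" if "0 \<le> x" "x < y" "y \<le> 1" for x y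
  proof -
    have "closure ({x<..<y} \<inter> (\<Union>k m. {of_nat m / 2^k})) = closure {x<..<y}"
      using that by (intro closure_dyadic_rationals_in_convex_set_pos_1) (auto simp: interior_open)
    then have "closure ({x<..<y} \<inter> dyadics) \<noteq> {}"
      using that unfolding dyadics_def by simp
    then have "{x<..<y} \<inter> dyadics \<noteq> {}" by auto
    then show ?thesis using that by (auto simp: D_def)
  qed
  \<comment> \<open>The alternative \<open>d = 0\<close> keeps the set nonempty to the left of
    \<open>c 0\<close>, where the supremum is then 0.\<close>
  define A where "A x = {d \<in> D. d = 0 \<or> c d \<le> x}" for x
  define F where "F x = Sup (A x)" for x
  have A: "A x \<noteq> {}" "bdd_above (A x)" for x
  proof -
    have "0 \<in> A x" using D01 by (simp add: A_def)
    then show "A x \<noteq> {}" by blast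
    show "bdd_above (A x)" by (rule bdd_aboveI[of _ 1]) (simp add: A_def D_def)
  qed
  have F0: "0 \<le> F x" for x unfolding F_def using D01 by (intro cSup_upper A) (simp add: A_def)
  have F1: "F x \<le> 1" for x unfolding F_def using A(1) by (intro cSup_least) (auto simp: A_def D_def)
  have F_mono: "F x \<le> F y" if "x \<le> y" for x y
    unfolding F_def using that by (intro cSup_subset_mono A) (auto simp: A_def)
  have below: "c d < x" if d: "d \<in> D" "d < F x" for d x
  proof -
    obtain d' where d': "d' \<in> A x" "d < d'" using d(2) less_cSup_iff[OF A] unfolding F_def by blast
    then have "d' \<noteq> 0" using d(1) by (auto simp: D_def)
    then show ?thesis using c[of d d'] d d' by (auto simp: A_def D_def R_def)
  qed
  have above: "x < c d" if d: "d \<in> D" "F x < d" for d x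
  proof (rule ccontr)
    assume "\<not> x < c d"
    then have "d \<in> A x" using d by (simp add: A_def)
    then have "d \<le> F x" unfolding F_def by (intro cSup_upper A)
    then show False using d by simp
  qed
  have ge: "d \<le> F x" if "d \<in> D" "c d \<le> x" for d x
    using above[OF that(1), of x] that(2) by force
  have le: "F x \<le> d" if "d \<in> D" "x \<le> c d" for d x
    using below[OF that(1), of x] that(2) by force
  have F_cont: "(F \<longlongrightarrow> F x) (at x)" for x
  proof (rule order_tendstoI)
    fix l assume l: "l < F x"
    show "eventually (\<lambda>y. l < F y) (at x)"
    proof (cases "l < 0")
      case True
      then show ?thesis using F0 by (intro always_eventually) (auto intro: less_le_trans)
    next
      case False
      then obtain d where d: "d \<in> D" "l < d" "d < F x" using D_dense[of l "F x"] l F1 by auto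
      have "eventually (\<lambda>y. c d < y) (at x)"
        by (rule order_tendstoD(1)[OF tendsto_ident_at below[OF d(1,3)]])
      then show ?thesis
      proof eventually_elim
        case (elim y)
        then show ?case using ge[OF d(1), of y] d(2) by simp
      qed
    qed
  next
    fix l assume l: "F x < l"
    show "eventually (\<lambda>y. F y < l) (at x)"
    proof (cases "1 < l")
      case True
      then show ?thesis using F1 by (intro always_eventually) (auto intro: le_less_trans)
    next
      case False
      then obtain d where d: "d \<in> D" "F x < d" "d < l" using D_dense[of "F x" l] l F0 by auto
      have "eventually (\<lambda>y. y < c d) (at x)"
        by (rule order_tendstoD(2)[OF tendsto_ident_at above[OF d(1,2)]])
      then show ?thesis
      proof eventually_elim
        case (elim y)
        then show ?case using le[OF d(1), of y] d(3) by simp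
      qed
    qed
  qed
  show ?thesis
  proof (rule that[of F "c 0" "c 1"])
    show "continuous_on UNIV F"
      using F_cont by (simp add: continuous_on_eq_continuous_at isCont_def)
    show "F x = F y" if xy: "x \<le> y" "{x..y} \<inter> K = {}" for x y
    proof (rule ccontr)
      assume "F x \<noteq> F y"
      then have less: "F x < F y" using F_mono[OF xy(1)] by simp
      obtain d where d: "d \<in> D" "F x < d" "d < F y" using D_dense[OF F0 less F1] by blast
      \<comment> \<open>One dyadic value between \<open>F x\<close> and \<open>F y\<close> only
        yields a point \<open>c d\<close> in the interval, which may lie outside \<open>K\<close>.
        Two of them enclose uncountably many points of \<open>K\<close>.\<close>
      obtain d' where d': "d' \<in> D" "d < d'" "d' < F y" using D_dense[of d "F y"] d F1 by (auto simp: D_def)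
      have "uncountable (K \<inter> {c d<..<c d'})" using c[of d d'] d d' by (auto simp: D_def R_def)
      then have "K \<inter> {c d<..<c d'} \<noteq> {}" by auto
      moreover have "{c d<..<c d'} \<subseteq> {x..y}" using above[OF d(1,2)] below[OF d'(1,3)] by auto
      ultimately show False using xy(2) by blast
    qed
    have "F (c 0) \<le> 0" by (rule le[OF D01(1)]) simp
    moreover have "1 \<le> F (c 1)" by (rule ge[OF D01(2)]) simp
    ultimately show "F (c 0) < F (c 1)" by simp
  qed (use F_mono F0 in auto)
qed

lemma fsigma_uncountable_closed_subset:
  assumes "fsigma K" "uncountable K"
  obtains C where "closed C" "C \<subseteq> K" "uncountable C"
  using assms
proof cases
  case (1 G)
  then have "\<exists>n. uncountable (G n)" using assms(2) countable_UN[of UNIV G] by auto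
  then show ?thesis using 1 that by blast
qed

lemma fsigma_borel: "fsigma K \<Longrightarrow> K \<in> sets borel"
  by (induction rule: fsigma.induct) auto

section \<open>Examples with a prescribed image\<close>

context concave_profile
begin

text \<open>The exceptional set is the full preimage of \<open>L\<close>: surjectivity of
  \<open>u\<close> makes its image exactly \<open>L\<close>, and \<open>L\<close> being F-sigma
  makes it Borel. The open neighbourhood is the larger set where \<open>u\<close> avoids the closed
  set \<open>K\<close>.\<close>

lemma example_common:
  fixes T :: "'a::euclidean_space \<Rightarrow> real"
  assumes T: "bounded_linear T" and e: "T e = 1" and K: "closed K" "K \<subseteq> L" and L: "fsigma L"
  defines "u \<equiv> \<lambda>z. \<psi> (T z)"
  shows "C1_on UNIV u" "0 < p \<Longrightarrow> locally_Hoelder_on p UNIV F \<Longrightarrow> C1p_on p UNIV u"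
    "u -` L \<in> sets borel" "open (u -` (- K))" "UNIV - u -` L \<subseteq> u -` (- K)" "u ` (u -` L) = L"
proof -
  show "C1_on UNIV u" using C1_on_affine[OF \<psi>_C1 T, of 0] by (simp add: u_def)
  then have cont: "continuous_on UNIV u" by (rule C1_on_continuous_on)
  show "C1p_on p UNIV u" if "0 < p" "locally_Hoelder_on p UNIV F"
    using C1p_on_affine[OF \<psi>_C1p[OF that] T that(1), of 0] by (simp add: u_def)
  have "u \<in> borel_measurable borel" using cont by (rule borel_measurable_continuous_onI)
  from measurable_sets[OF this fsigma_borel[OF L]] show "u -` L \<in> sets borel" by simp
  show "open (u -` (- K))" using K(1) cont by (intro open_vimage) auto
  show "UNIV - u -` L \<subseteq> u -` (- K)" using K(2) by auto
  have "surj u"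
  proof (rule surjI)
    fix y
    have "T (inv \<psi> y *\<^sub>R e) = inv \<psi> y"
      using linear_scale[OF bounded_linear.linear[OF T]] e by simp
    then show "u (inv \<psi> y *\<^sub>R e) = y" using \<psi>_surj by (simp add: u_def surj_f_inv_f)
  qed
  then show "u ` (u -` L) = L" by (rule surj_image_vimage_eq)
qed

lemma subharmonic_example:
  fixes T :: "'a::euclidean_space \<Rightarrow> real"
  assumes T: "bounded_linear T" and e: "T e = 1" and K: "closed K" "K \<subseteq> L" and L: "fsigma L"
    and F: "F a < F b"
  shows "\<exists>E u. E \<in> sets borel \<and> C1_on UNIV u \<and> (\<forall>p>0. locally_Hoelder_on p UNIV F \<longrightarrow> C1p_on p UNIV u) \<and>
    (\<exists>V. open V \<and> UNIV - E \<subseteq> V \<and> V \<subseteq> UNIV \<and> subharmonic_on V u) \<and> u ` E = L \<and>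
    \<not> subharmonic_on UNIV (u :: 'a \<Rightarrow> real)"
proof -
  define u where "u = (\<lambda>z. \<psi> (T z))"
  note ex = example_common[OF T e K L, folded u_def]
  have "subharmonic_on (u -` (- K)) u"
    using \<psi>_subharmonic_on[OF T, of "u -` (- K)" 0] by (simp add: u_def)
  moreover have "\<not> subharmonic_on UNIV u"
    unfolding u_def by (rule \<psi>_not_subharmonic[OF T e F])
  ultimately show ?thesis using ex by blast
qed

text \<open>On a complex line the real part of a coordinate is a constant plus a real linear
  functional of \<zeta>, so the planar statement covers every line. On the coordinate axis it is the
  real part of \<zeta>, and subharmonicity fails there.\<close>

lemma plurisubharmonic_example:
  assumes K: "closed K" "K \<subseteq> L" and L: "fsigma L" and F: "F a < F b"
  shows "\<exists>E u. E \<in> sets borel \<and> C1_on UNIV u \<and> (\<forall>p>0. locally_Hoelder_on p UNIV F \<longrightarrow> C1p_on p UNIV u) \<and>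
    (\<exists>V. open V \<and> UNIV - E \<subseteq> V \<and> V \<subseteq> UNIV \<and> plurisubharmonic_on V u) \<and> u ` E = L \<and>
    \<not> plurisubharmonic_on UNIV (u :: complex ^ 'n \<Rightarrow> real)"
proof -
  fix i :: 'n
  define T :: "complex ^ 'n \<Rightarrow> real" where "T = (\<lambda>z. Re (z $ i))"
  have T: "bounded_linear T" unfolding T_def
    by (intro bounded_linear_compose[OF bounded_linear_Re] bounded_linear_vec_nth)
  have e: "T (axis i 1) = 1" by (simp add: T_def axis_def)
  define u where "u = (\<lambda>z. \<psi> (T z))"
  note ex = example_common[OF T e K L, folded u_def]
  have T_add: "T (z + w) = T z + T w" for z w by (simp add: T_def)
  have "plurisubharmonic_on (u -` (- K)) u"
    unfolding plurisubharmonic_on_def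
  proof (intro conjI allI)
    show "upper_semicontinuous_on (u -` (- K)) u"
      using C1_on_continuous_on[OF ex(1)] continuous_on_subset
      by (blast intro: continuous_on_upper_semicontinuous_on)
    fix a b :: "complex ^ 'n"
    show "subharmonic_on {\<zeta>. a + \<zeta> *s b \<in> u -` (- K)} (\<lambda>\<zeta>. u (a + \<zeta> *s b))"
      using \<psi>_subharmonic_on[OF bounded_linear_compose[OF T bounded_linear_scalar_mult[of b]],
          of "{\<zeta>. a + \<zeta> *s b \<in> u -` (- K)}" "T a"]
      by (simp add: u_def T_add)
  qed
  moreover have "\<not> plurisubharmonic_on UNIV u"
  proof
    assume "plurisubharmonic_on UNIV u"
    then have "subharmonic_on {\<zeta>. 0 + \<zeta> *s axis i 1 \<in> UNIV} (\<lambda>\<zeta>. u (0 + \<zeta> *s axis i 1))"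
      unfolding plurisubharmonic_on_def by blast
    moreover have "(\<lambda>\<zeta>. u (0 + \<zeta> *s axis i 1)) = (\<lambda>\<zeta>. \<psi> (Re \<zeta>))"
      by (simp add: u_def T_def axis_def)
    ultimately show False
      using \<psi>_not_subharmonic[OF bounded_linear_Re, of 1 a b] F by simp
  qed
  ultimately show ?thesis using ex by blast
qed

end

text \<open>\<open>K\<close> is the compact piece of positive content, so \<open>F\<close> grows
  only inside \<open>L\<close> while retaining the Hoelder exponent \<open>p\<close>.\<close>

lemma null_sharp_profile:
  assumes p: "0 < p" and L: "fsigma L" "hausdorff_measure p L > 0"
  obtains F K \<psi> a b where "concave_profile F K \<psi>" "closed K" "K \<subseteq> L" "F a < F b" "locally_Hoelder_on p UNIV F"
proof -
  obtain C \<delta> where C: "compact C" "C \<subseteq> L" "\<delta> > 0" "hausdorff_premeasure p \<delta> C > 0"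
    using fsigma_hausdorff_compact_subset[OF L] by blast
  obtain F a b where F: "\<And>x y. x \<le> y \<Longrightarrow> F x \<le> F y" "\<And>x. 0 \<le> (F x :: real)" "continuous_on UNIV F"
    "\<And>x y. x \<le> y \<Longrightarrow> {x..y} \<inter> C = {} \<Longrightarrow> F x = F y" "F a < F b" "locally_Hoelder_on p UNIV F"
    using frostman_function[OF C(1,3,4) p] by blast
  obtain \<psi> where "concave_profile F C \<psi>" using concave_profile_exists[OF F(1-4)] by blast
  then show ?thesis using that compact_imp_closed[OF C(1)] C(2) F(5,6) by blast
qed

lemma countable_sharp_profile:
  assumes L: "fsigma L" "uncountable L"
  obtains F K \<psi> a b where "concave_profile F K \<psi>" "closed K" "K \<subseteq> L" "F a < F b"
proof -
  obtain C where C: "closed C" "C \<subseteq> L" "uncountable C"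
    using fsigma_uncountable_closed_subset[OF L] by blast
  obtain F a b where F: "\<And>x y. x \<le> y \<Longrightarrow> F x \<le> F y" "\<And>x. 0 \<le> (F x :: real)" "continuous_on UNIV F"
    "\<And>x y. x \<le> y \<Longrightarrow> {x..y} \<inter> C = {} \<Longrightarrow> F x = F y" "F a < F b"
    using devils_staircase[OF C(3)] by blast
  obtain \<psi> where "concave_profile F C \<psi>" using concave_profile_exists[OF F(1-4)] by blast
  then show ?thesis using that C F(5) by blast
qed

lemma subharmonic_null_sharp:
  assumes "0 < p" "fsigma L" "hausdorff_measure p L > 0"
  shows "\<exists>(\<Omega> :: (real ^ 'n) set) E u. open \<Omega> \<and> E \<subseteq> \<Omega> \<and> E \<in> sets borel \<and> C1p_on p \<Omega> u \<and>
    (\<exists>V. open V \<and> \<Omega> - E \<subseteq> V \<and> V \<subseteq> \<Omega> \<and> subharmonic_on V u) \<and> u ` E = L \<and> \<not> subharmonic_on \<Omega> u"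
proof -
  fix i :: 'n
  obtain F K \<psi> a b where F: "concave_profile F K \<psi>" "closed K" "K \<subseteq> L" "F a < F b" "locally_Hoelder_on p UNIV F"
    using null_sharp_profile[OF assms] by blast
  interpret concave_profile F K \<psi> by (rule F)
  have e: "axis i 1 $ i = (1 :: real)" by (simp add: axis_def)
  obtain E and u :: "real ^ 'n \<Rightarrow> real" where "E \<in> sets borel" "C1p_on p UNIV u"
    "\<exists>V. open V \<and> UNIV - E \<subseteq> V \<and> V \<subseteq> UNIV \<and> subharmonic_on V u" "u ` E = L" "\<not> subharmonic_on UNIV u"
    using subharmonic_example[OF bounded_linear_vec_nth e F(2,3) assms(2) F(4)] assms(1) F(5) by blast
  then show ?thesis by (intro exI[of _ UNIV] exI[of _ E] exI[of _ u]) simp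
qed

lemma subharmonic_countable_sharp:
  assumes "fsigma L" "uncountable L"
  shows "\<exists>(\<Omega> :: (real ^ 'n) set) E u. open \<Omega> \<and> E \<subseteq> \<Omega> \<and> E \<in> sets borel \<and> C1_on \<Omega> u \<and>
    (\<exists>V. open V \<and> \<Omega> - E \<subseteq> V \<and> V \<subseteq> \<Omega> \<and> subharmonic_on V u) \<and> u ` E = L \<and> \<not> subharmonic_on \<Omega> u"
proof -
  fix i :: 'n
  obtain F K \<psi> a b where F: "concave_profile F K \<psi>" "closed K" "K \<subseteq> L" "F a < F b"
    using countable_sharp_profile[OF assms] by blast
  interpret concave_profile F K \<psi> by (rule F)
  have e: "axis i 1 $ i = (1 :: real)" by (simp add: axis_def)
  obtain E and u :: "real ^ 'n \<Rightarrow> real" where "E \<in> sets borel" "C1_on UNIV u"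
    "\<exists>V. open V \<and> UNIV - E \<subseteq> V \<and> V \<subseteq> UNIV \<and> subharmonic_on V u" "u ` E = L" "\<not> subharmonic_on UNIV u"
    using subharmonic_example[OF bounded_linear_vec_nth e F(2,3) assms(1) F(4)] by blast
  then show ?thesis by (intro exI[of _ UNIV] exI[of _ E] exI[of _ u]) simp
qed

lemma plurisubharmonic_null_sharp:
  assumes "0 < p" "fsigma L" "hausdorff_measure p L > 0"
  shows "\<exists>(\<Omega> :: (complex ^ 'n) set) E u. open \<Omega> \<and> E \<subseteq> \<Omega> \<and> E \<in> sets borel \<and> C1p_on p \<Omega> u \<and>
    (\<exists>V. open V \<and> \<Omega> - E \<subseteq> V \<and> V \<subseteq> \<Omega> \<and> plurisubharmonic_on V u) \<and> u ` E = L \<and> \<not> plurisubharmonic_on \<Omega> u"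
proof -
  obtain F K \<psi> a b where F: "concave_profile F K \<psi>" "closed K" "K \<subseteq> L" "F a < F b" "locally_Hoelder_on p UNIV F"
    using null_sharp_profile[OF assms] by blast
  interpret concave_profile F K \<psi> by (rule F)
  obtain E and u :: "complex ^ 'n \<Rightarrow> real" where "E \<in> sets borel" "C1p_on p UNIV u"
    "\<exists>V. open V \<and> UNIV - E \<subseteq> V \<and> V \<subseteq> UNIV \<and> plurisubharmonic_on V u" "u ` E = L" "\<not> plurisubharmonic_on UNIV u"
    using plurisubharmonic_example[OF F(2,3) assms(2) F(4)] assms(1) F(5) by blast
  then show ?thesis by (intro exI[of _ UNIV] exI[of _ E] exI[of _ u]) simp
qed

lemma plurisubharmonic_countable_sharp:
  assumes "fsigma L" "uncountable L"
  shows "\<exists>(\<Omega> :: (complex ^ 'n) set) E u. open \<Omega> \<and> E \<subseteq> \<Omega> \<and> E \<in> sets borel \<and> C1_on \<Omega> u \<and>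
    (\<exists>V. open V \<and> \<Omega> - E \<subseteq> V \<and> V \<subseteq> \<Omega> \<and> plurisubharmonic_on V u) \<and> u ` E = L \<and> \<not> plurisubharmonic_on \<Omega> u"
proof -
  obtain F K \<psi> a b where F: "concave_profile F K \<psi>" "closed K" "K \<subseteq> L" "F a < F b"
    using countable_sharp_profile[OF assms] by blast
  interpret concave_profile F K \<psi> by (rule F)
  obtain E and u :: "complex ^ 'n \<Rightarrow> real" where "E \<in> sets borel" "C1_on UNIV u"
    "\<exists>V. open V \<and> UNIV - E \<subseteq> V \<and> V \<subseteq> UNIV \<and> plurisubharmonic_on V u" "u ` E = L" "\<not> plurisubharmonic_on UNIV u"
    using plurisubharmonic_example[OF F(2,3) assms(1) F(4)] by blast
  then show ?thesis by (intro exI[of _ UNIV] exI[of _ E] exI[of _ u]) simp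
qed

text \<open>Optimality is read in a strong form: no F-sigma set of values that fails the smallness
  condition can be tolerated, rather than one extremal example being exhibited. A neighbourhood may
  always be intersected with \<Omega>, hence the condition that \<open>V\<close> lies in
  \<Omega>.\<close>

theorem theorem1p2:
  shows "(\<forall>p (\<Omega> :: (real ^ 'n) set) E u.
          0 < p \<longrightarrow> p \<le> 1 \<longrightarrow> open \<Omega> \<longrightarrow> E \<subseteq> \<Omega> \<longrightarrow> E \<in> sets borel \<longrightarrow> C1p_on p \<Omega> u \<longrightarrow>
          (\<exists>V. open V \<and> \<Omega> - E \<subseteq> V \<and> V \<subseteq> \<Omega> \<and> subharmonic_on V u) \<longrightarrow>
          hausdorff_measure p (u ` E) = 0 \<longrightarrow>
          subharmonic_on \<Omega> u) \<and>
         (\<forall>(\<Omega> :: (real ^ 'n) set) E u.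
          open \<Omega> \<longrightarrow> E \<subseteq> \<Omega> \<longrightarrow> E \<in> sets borel \<longrightarrow> C1_on \<Omega> u \<longrightarrow>
          (\<exists>V. open V \<and> \<Omega> - E \<subseteq> V \<and> V \<subseteq> \<Omega> \<and> subharmonic_on V u) \<longrightarrow>
          countable (u ` E) \<longrightarrow>
          subharmonic_on \<Omega> u) \<and>
         (\<forall>p (\<Omega> :: (complex ^ 'n) set) E u.
          0 < p \<longrightarrow> p \<le> 1 \<longrightarrow> open \<Omega> \<longrightarrow> E \<subseteq> \<Omega> \<longrightarrow> E \<in> sets borel \<longrightarrow> C1p_on p \<Omega> u \<longrightarrow>
          (\<exists>V. open V \<and> \<Omega> - E \<subseteq> V \<and> V \<subseteq> \<Omega> \<and> plurisubharmonic_on V u) \<longrightarrow>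
          hausdorff_measure p (u ` E) = 0 \<longrightarrow>
          plurisubharmonic_on \<Omega> u) \<and>
         (\<forall>(\<Omega> :: (complex ^ 'n) set) E u.
          open \<Omega> \<longrightarrow> E \<subseteq> \<Omega> \<longrightarrow> E \<in> sets borel \<longrightarrow> C1_on \<Omega> u \<longrightarrow>
          (\<exists>V. open V \<and> \<Omega> - E \<subseteq> V \<and> V \<subseteq> \<Omega> \<and> plurisubharmonic_on V u) \<longrightarrow>
          countable (u ` E) \<longrightarrow>
          plurisubharmonic_on \<Omega> u) \<and>
         (\<forall>p K :: real set.
          0 < p \<longrightarrow> p \<le> 1 \<longrightarrow> fsigma K \<longrightarrow> hausdorff_measure p K > 0 \<longrightarrow>
          (\<exists>(\<Omega> :: (real ^ 'n) set) E u.
             open \<Omega> \<and> E \<subseteq> \<Omega> \<and> E \<in> sets borel \<and> C1p_on p \<Omega> u \<and>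
             (\<exists>V. open V \<and> \<Omega> - E \<subseteq> V \<and> V \<subseteq> \<Omega> \<and> subharmonic_on V u) \<and>
             u ` E = K \<and>
             \<not> subharmonic_on \<Omega> u)) \<and>
         (\<forall>K :: real set.
          fsigma K \<longrightarrow> uncountable K \<longrightarrow>
          (\<exists>(\<Omega> :: (real ^ 'n) set) E u.
             open \<Omega> \<and> E \<subseteq> \<Omega> \<and> E \<in> sets borel \<and> C1_on \<Omega> u \<and>
             (\<exists>V. open V \<and> \<Omega> - E \<subseteq> V \<and> V \<subseteq> \<Omega> \<and> subharmonic_on V u) \<and>
             u ` E = K \<and>
             \<not> subharmonic_on \<Omega> u)) \<and>
         (\<forall>p K :: real set.
          0 < p \<longrightarrow> p \<le> 1 \<longrightarrow> fsigma K \<longrightarrow> hausdorff_measure p K > 0 \<longrightarrow>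
          (\<exists>(\<Omega> :: (complex ^ 'n) set) E u.
             open \<Omega> \<and> E \<subseteq> \<Omega> \<and> E \<in> sets borel \<and> C1p_on p \<Omega> u \<and>
             (\<exists>V. open V \<and> \<Omega> - E \<subseteq> V \<and> V \<subseteq> \<Omega> \<and> plurisubharmonic_on V u) \<and>
             u ` E = K \<and>
             \<not> plurisubharmonic_on \<Omega> u)) \<and>
         (\<forall>K :: real set.
          fsigma K \<longrightarrow> uncountable K \<longrightarrow>
          (\<exists>(\<Omega> :: (complex ^ 'n) set) E u.
             open \<Omega> \<and> E \<subseteq> \<Omega> \<and> E \<in> sets borel \<and> C1_on \<Omega> u \<and>
             (\<exists>V. open V \<and> \<Omega> - E \<subseteq> V \<and> V \<subseteq> \<Omega> \<and> plurisubharmonic_on V u) \<and>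
             u ` E = K \<and>
             \<not> plurisubharmonic_on \<Omega> u))"
  by (intro conjI allI impI; (elim exE conjE)?)
    (rule subharmonic_on_extension_null subharmonic_on_extension_countable
      plurisubharmonic_on_extension_null plurisubharmonic_on_extension_countable
      subharmonic_null_sharp subharmonic_countable_sharp
      plurisubharmonic_null_sharp plurisubharmonic_countable_sharp; assumption)+

end
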